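(* Let $N\in\mathbb{N}$, let $\varphi_1,\dots,\varphi_N\in C^2(\mathbb{T})$ be real-valued, and let $X=M(\mathbb{T},\mathbb{R})\times\mathbb{R}^N$, $K:X\to\mathbb{R}^N$, $R:X\to[0,\infty)$ be as in the context. Let $$\mu_0=\sum_{i=1}^n c_0^i(\sigma_0^i\delta_{x_0^i},0)+\sum_{j=1}^m d_0^j(0,\zeta_0^j)\in X,$$ where $c_0^i,d_0^j\in\mathbb{R}\setminus\{0\}$, $\sigma_0^i\in\{-1,+1\}$, $x_0^i\in\mathbb{T}$ and $(0,\zeta_0^j)\in E_2$, with $E_2=\{(0,ae_k): k=1,\dots,N,\ a\in\mathbb{R},\ |a|=1\}$. Put $y=K\mu_0$ and let $\eta_0=(\eta_0^1,\eta_0^2)\in C(\mathbb{T},\mathbb{R})\times\mathbb{R}^N$ be the minimal-norm dual certificate associated with $y$ (see context). Suppose that (a) $\operatorname{Im}K_*\cap\partial R(\mu_0)\neq\emptyset$; (b) for $\sigma\in\{-1,+1\}$ and $x\in\mathbb{T}$, one has $\sigma\,\eta_0^1(x)=1$ if and only if $(\sigma,x)=(\sigma_0^i,x_0^i)$ for some $i\in\{1,\dots,n\}$; and for $(0,\zeta)\in E_2$, one has $\langle\eta_0^2,\zeta\rangle=1$ if and only if $\zeta=\zeta_0^j$ for some $j\in\{1,\dots,m\}$; (c) $\eta_0^1\in C^2(\mathbb{T})$ and $\sigma_0^i(\eta_0^1)''(x_0^i)<0$ for $i=1,\dots,n$. Suppose additionally that the vectors $K(\sigma_0^i\delta_{x_0^i},0)$,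 $i=1,\dots,n$, together with $K(0,\zeta_0^j)$, $j=1,\dots,m$, are linearly independent in $\mathbb{R}^N$. Then for every sufficiently small $\varepsilon>0$ there exist $\alpha>0$ and $\lambda_0>0$ such that, for every $\lambda\in\mathbb{R}$ and $w\in\mathbb{R}^N$ with $0<\lambda\leqslant\lambda_0$ and $\|w\|_2\leqslant\alpha\lambda$, the problem $$\min_{(\mu,\zeta)\in X}\ \frac12\sum_{i=1}^N\Big|\int_{\mathbb{T}}\varphi_i(x)\,d\mu(x)+\zeta_i-(y_i+w_i)\Big|^2+\lambda\big(\|\mu\|_{TV}+\|\zeta\|_1\big)$$ has a unique solution $\tilde\mu_\lambda\in X$, and $\tilde\mu_\lambda$ admits a unique representation of the form $$\tilde\mu_\lambda=\sum_{i=1}^n\tilde c_\lambda^i(\sigma_0^i\delta_{\tilde x_\lambda^i},0)+\sum_{j=1}^m\tilde d_\lambda^j(0,\zeta_0^j),$$ where $|\tilde x_\lambda^i-x_0^i|\leqslant\varepsilon$, $|\tilde c_\lambda^i-c_0^i|\leqslant\varepsilon$ and $|\tilde d_\lambda^j-d_0^j|\leqslant\varepsilon$ for $i=1,\dots,n$ and $j=1,\dots,m$.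
   Context: $\mathbb{T}$ is the one-dimensional torus, and $|x-x'|$ denotes the distance on $\mathbb{T}$. $M(\mathbb{T},\mathbb{R})$ is the space of finite signed Radon measures on $\mathbb{T}$ with total variation norm $\|\cdot\|_{TV}$; $\delta_x$ is the Dirac delta at $x$; $e_1,\dots,e_N$ is the canonical basis of $\mathbb{R}^N$. The space $X=M(\mathbb{T},\mathbb{R})\times\mathbb{R}^N$ is the dual of $X_*=C(\mathbb{T},\mathbb{R})\times\mathbb{R}^N$ with pairing $\langle(\eta^1,\eta^2),(\mu,\zeta)\rangle=\int_{\mathbb{T}}\eta^1\,d\mu+\langle\eta^2,\zeta\rangle$, where $\langle\eta^2,\zeta\rangle$ is the Euclidean inner product. The measurement operator $K:X\to\mathbb{R}^N$ is $(K(\mu,\zeta))_i=\int_{\mathbb{T}}\varphi_i(x)\,d\mu(x)+\zeta_i$, $i=1,\dots,N$. Its pre-adjoint $K_*:\mathbb{R}^N\to X_*$ is $K_*p=(\sum_{i=1}^N p_i\varphi_i,\ p)$. The regularizer is $R(\mu,\zeta)=\|\mu\|_{TV}+\|\zeta\|_1$. For $u\in X$, the subdifferential is taken in the predual: $\partial R(u)=\{\eta\in X_*: R(v)\geqslant R(u)+\langle\eta,v-u\rangle\ \ \forall v\in X\}$. Minimal-norm dual certificate: for $y\in\mathbb{R}^N$ consider the dual problem $\sup\{(y,p): p\in\mathbb{R}^N,\ K_*p\in\partial R(0)\}$ of the problem $\inf\{R(u): u\in X,\ Ku=y\}$, where $(\cdot,\cdot)$ is the Euclidean inner product. The minimal-norm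 dual certificate is $\eta_0=K_*p_0$, where $p_0$ is the unique solution of this dual problem with minimal Euclidean norm. *)

theory Defs
  imports "HOL-Analysis.Analysis"
begin

section \<open>The torus\<close>

text \<open>The torus is the quotient of the real line by the integers, with the quotient distance:
  the distance of \<open>s\<close> and \<open>t\<close> is the distance of \<open>s - t\<close> to the nearest integer.\<close>

quotient_type torus = real / "\<lambda>s t :: real. s - t \<in> \<int>"
  morphisms torus_rep to_torus
proof (rule equivpI)
  show "reflp (\<lambda>s t :: real. s - t \<in> \<int>)"
    by (rule reflpI) simp
  show "symp (\<lambda>s t :: real. s - t \<in> \<int>)"
    by (rule sympI) (metis Ints_minus minus_diff_eq)
  show "transp (\<lambda>s t :: real. s - t \<in> \<int>)"
    by (rule transpI) (metis Ints_add diff_add_eq diff_add_cancel add_diff_eq)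
qed

lemma round_dist_le:
  fixes t :: real
  shows "\<bar>t - of_int (round t)\<bar> \<le> \<bar>t - of_int k\<bar>"
  using round_diff_minimal[of t k] by (simp add: abs_minus_commute)

lemma round_dist_cong:
  fixes s t :: real
  assumes "s - t \<in> \<int>"
  shows "\<bar>s - of_int (round s)\<bar> = \<bar>t - of_int (round t)\<bar>"
proof -
  obtain k where k: "s = t + of_int k"
    using assms by (metis Ints_cases add.commute diff_add_cancel)
  have "\<bar>s - of_int (round s)\<bar> \<le> \<bar>t - of_int (round t)\<bar>"
    using round_dist_le[of s "round t + k"] k by simp
  moreover have "\<bar>t - of_int (round t)\<bar> \<le> \<bar>s - of_int (round s)\<bar>"
    using round_dist_le[of t "round s - k"] k by simp
  ultimately show ?thesis by simp
qed

instantiation torus :: metric_space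
begin

lift_definition dist_torus :: "torus \<Rightarrow> torus \<Rightarrow> real"
  is "\<lambda>s t. \<bar>(s - t) - of_int (round (s - t))\<bar>"
  by (rule round_dist_cong) (metis Ints_diff add_diff_add diff_diff_eq2 diff_diff_eq add_diff_eq diff_add_eq)

definition uniformity_torus :: "(torus \<times> torus) filter"
  where "uniformity_torus = (INF e\<in>{0<..}. principal {(x, y). dist x y < e})"

definition open_torus :: "torus set \<Rightarrow> bool"
  where "open_torus U \<longleftrightarrow> (\<forall>x\<in>U. eventually (\<lambda>(x', y). x' = x \<longrightarrow> y \<in> U) uniformity)"

instance
proof
  fix x y z :: torus
  show "dist x y = 0 \<longleftrightarrow> x = y"
  proof transfer
    fix s t :: real
    show "\<bar>s - t - of_int (round (s - t))\<bar> = 0 \<longleftrightarrow> s - t \<in> \<int>"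
      by (metis Ints_cases Ints_of_int abs_eq_0 eq_iff_diff_eq_0 round_of_int)
  qed
  show "dist x y \<le> dist x z + dist y z"
  proof transfer
    fix s t u :: real
    have "\<bar>s - t - of_int (round (s - t))\<bar> \<le> \<bar>s - t - of_int (round (s - u) - round (t - u))\<bar>"
      by (rule round_dist_le)
    also have "\<dots> \<le> \<bar>s - u - of_int (round (s - u))\<bar> + \<bar>t - u - of_int (round (t - u))\<bar>"
      by simp
    finally show "\<bar>s - t - of_int (round (s - t))\<bar>
      \<le> \<bar>s - u - of_int (round (s - u))\<bar> + \<bar>t - u - of_int (round (t - u))\<bar>" .
  qed
qed (simp_all add: uniformity_torus_def open_torus_def)

end

text \<open>Functions on the torus are differentiated through their 1-periodic lift to the real line,
  so the value at a point does not depend on the representative.\<close>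

definition torus_C2 :: "(torus \<Rightarrow> real) \<Rightarrow> bool" where
  "torus_C2 f \<longleftrightarrow>
     (\<forall>t. (f \<circ> to_torus) differentiable (at t)) \<and>
     (\<forall>t. deriv (f \<circ> to_torus) differentiable (at t)) \<and>
     continuous_on UNIV (deriv (deriv (f \<circ> to_torus)))"

definition torus_deriv2 :: "(torus \<Rightarrow> real) \<Rightarrow> torus \<Rightarrow> real" where
  "torus_deriv2 f x = deriv (deriv (f \<circ> to_torus)) (torus_rep x)"

lemma deriv_periodic:
  fixes g :: "real \<Rightarrow> real"
  assumes "\<And>t. g (t + k) = g t"
  shows "deriv g (t + k) = deriv g t"
proof -
  have "(g has_field_derivative D) (at (t + k)) \<longleftrightarrow> (g has_field_derivative D) (at t)" for D
    using DERIV_shift[of g D t k] assms by simp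
  then show ?thesis
    by (simp add: deriv_def)
qed

lemma torus_deriv2_to_torus:
  "torus_deriv2 f (to_torus t) = deriv (deriv (f \<circ> to_torus)) t"
proof -
  have "torus_rep (to_torus t) - t \<in> \<int>"
    using Quotient3_abs_rep[OF Quotient3_torus, of "to_torus t"] by (simp add: torus.abs_eq_iff)
  then obtain k where k: "torus_rep (to_torus t) = t + of_int k"
    by (metis Ints_cases add.commute diff_add_cancel)
  have "(f \<circ> to_torus) (s + of_int k) = (f \<circ> to_torus) s" for s
  proof -
    have "to_torus (s + of_int k) = to_torus s"
      by (simp add: torus.abs_eq_iff)
    then show ?thesis by simp
  qed
  then show ?thesis
    unfolding torus_deriv2_def k by (intro deriv_periodic)
qed


section \<open>Finite signed Radon measures on the torus\<close>

definition partition_sums :: "(torus set \<Rightarrow> real) \<Rightarrow> torus set \<Rightarrow> real set" where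
  "partition_sums m A =
     {(\<Sum>B\<in>P. \<bar>m B\<bar>) | P. finite P \<and> P \<subseteq> sets borel \<and> partition_on A P}"

definition variation :: "(torus set \<Rightarrow> real) \<Rightarrow> torus set \<Rightarrow> real" where
  "variation m A = Sup (partition_sums m A)"

text \<open>A signed measure is represented by its set function on the Borel sets, extended by 0 to the
  other sets so that equality of measures is equality of the set functions.  Finiteness of the
  total variation and inner regularity are part of the definition of a finite Radon measure.\<close>

definition signed_radon :: "(torus set \<Rightarrow> real) \<Rightarrow> bool" where
  "signed_radon m \<longleftrightarrow>
     (\<forall>A. A \<notin> sets borel \<longrightarrow> m A = 0) \<and>
     (\<forall>A :: nat \<Rightarrow> torus set. range A \<subseteq> sets borel \<longrightarrow> disjoint_family A \<longrightarrow>
        (\<lambda>n. m (A n)) sums m (\<Union>n. A n)) \<and>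
     bdd_above (partition_sums m UNIV) \<and>
     (\<forall>A\<in>sets borel. \<forall>e>0. \<exists>C. compact C \<and> C \<subseteq> A \<and> variation m (A - C) < e)"

lemma signed_radonD:
  assumes "signed_radon m"
  shows "A \<notin> sets borel \<Longrightarrow> m A = 0"
    and "range F \<subseteq> sets borel \<Longrightarrow> disjoint_family F \<Longrightarrow> (\<lambda>n. m (F n)) sums m (\<Union>n. F n)"
    and "bdd_above (partition_sums m UNIV)"
    and "A \<in> sets borel \<Longrightarrow> e > 0 \<Longrightarrow> \<exists>C. compact C \<and> C \<subseteq> A \<and> variation m (A - C) < e"
  using assms unfolding signed_radon_def by simp_all

lemma partition_sums_extend:
  assumes "A \<in> sets borel" "B \<in> sets borel" "A \<subseteq> B" "s \<in> partition_sums m A"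
  shows "\<exists>t\<in>partition_sums m B. s \<le> t"
proof (cases "A = B")
  case False
  obtain P where P: "finite P" "P \<subseteq> sets borel" "partition_on A P" "s = (\<Sum>B\<in>P. \<bar>m B\<bar>)"
    using assms(4) unfolding partition_sums_def by blast
  have new: "B - A \<notin> P" "B - A \<noteq> {}"
    using P(3) False assms(3) by (auto simp: partition_on_def)
  have "partition_on B (insert (B - A) P)"
    using P(3) new assms(3) by (auto simp: partition_on_def disjoint_def)
  moreover have "insert (B - A) P \<subseteq> sets borel"
    using P(2) assms(1,2) by auto
  ultimately have "(\<Sum>B\<in>insert (B - A) P. \<bar>m B\<bar>) \<in> partition_sums m B"
    unfolding partition_sums_def using P(1) by blast
  then show ?thesis
    using P new by (intro bexI) auto
qed (use assms(4) in auto)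

lemma partition_sums_nonempty:
  assumes "A \<in> sets borel"
  shows "partition_sums m A \<noteq> {}"
proof (cases "A = {}")
  case True
  then have "(\<Sum>B\<in>{}. \<bar>m B\<bar>) \<in> partition_sums m A"
    unfolding partition_sums_def by (intro CollectI exI[of _ "{}"]) (simp add: partition_on_def)
  then show ?thesis by blast
next
  case False
  then have "partition_on A {A}" by (simp add: partition_on_def)
  then have "(\<Sum>B\<in>{A}. \<bar>m B\<bar>) \<in> partition_sums m A"
    unfolding partition_sums_def using assms by blast
  then show ?thesis by blast
qed

lemma bdd_above_partition_sums:
  assumes "bdd_above (partition_sums m UNIV)" "A \<in> sets borel"
  shows "bdd_above (partition_sums m A)"
  using partition_sums_extend[OF assms(2), of UNIV _ m] assms(1)
  by (meson bdd_above_def order_trans sets.top space_borel subset_UNIV borel_closed closed_UNIV)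

lemma variation_mono:
  assumes "bdd_above (partition_sums m UNIV)" "A \<in> sets borel" "B \<in> sets borel" "A \<subseteq> B"
  shows "variation m A \<le> variation m B"
  unfolding variation_def
  by (rule cSup_mono)
    (use assms in \<open>auto intro: bdd_above_partition_sums partition_sums_extend
       simp: partition_sums_nonempty\<close>)

lemma partition_sums_add:
  assumes "s \<in> partition_sums (\<lambda>A. a * f A + b * g A) A"
  shows "\<exists>t\<in>partition_sums f A. \<exists>u\<in>partition_sums g A. s \<le> \<bar>a\<bar> * t + \<bar>b\<bar> * u"
proof -
  obtain P where P: "finite P" "P \<subseteq> sets borel" "partition_on A P"
      "s = (\<Sum>B\<in>P. \<bar>a * f B + b * g B\<bar>)"
    using assms unfolding partition_sums_def by blast
  have "s \<le> (\<Sum>B\<in>P. \<bar>a\<bar> * \<bar>f B\<bar> + \<bar>b\<bar> * \<bar>g B\<bar>)"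
    unfolding P(4) by (intro sum_mono) (metis abs_mult abs_triangle_ineq)
  also have "\<dots> = \<bar>a\<bar> * (\<Sum>B\<in>P. \<bar>f B\<bar>) + \<bar>b\<bar> * (\<Sum>B\<in>P. \<bar>g B\<bar>)"
    by (simp add: sum.distrib sum_distrib_left)
  finally show ?thesis
    unfolding partition_sums_def using P by blast
qed

lemma signed_radon_lincomb:
  assumes f: "signed_radon f" and g: "signed_radon g"
  shows "signed_radon (\<lambda>A. a * f A + b * g A)"
proof -
  let ?h = "\<lambda>A. a * f A + b * g A"
  have le: "s \<le> \<bar>a\<bar> * variation f A + \<bar>b\<bar> * variation g A"
    if s: "s \<in> partition_sums ?h A" and A: "A \<in> sets borel" for s A
  proof -
    obtain t u where tu: "t \<in> partition_sums f A" "u \<in> partition_sums g A"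
        "s \<le> \<bar>a\<bar> * t + \<bar>b\<bar> * u"
      using partition_sums_add[OF s] by blast
    have "t \<le> variation f A" "u \<le> variation g A"
      unfolding variation_def
      using tu bdd_above_partition_sums[OF signed_radonD(3)[OF f] A]
        bdd_above_partition_sums[OF signed_radonD(3)[OF g] A]
      by (auto intro: cSup_upper)
    then have "\<bar>a\<bar> * t + \<bar>b\<bar> * u \<le> \<bar>a\<bar> * variation f A + \<bar>b\<bar> * variation g A"
      by (intro add_mono mult_left_mono) auto
    with tu(3) show ?thesis by simp
  qed
  have reg: "\<exists>C. compact C \<and> C \<subseteq> A \<and> variation ?h (A - C) < e"
    if A: "A \<in> sets borel" and e: "e > 0" for A and e :: real
  proof -
    define d where "d = e / (\<bar>a\<bar> + \<bar>b\<bar> + 1)"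
    have d: "d > 0" using e by (simp add: d_def add_nonneg_pos)
    obtain C where C: "compact C" "C \<subseteq> A" "variation f (A - C) < d"
      using signed_radonD(4)[OF f A d] by blast
    obtain D where D: "compact D" "D \<subseteq> A" "variation g (A - D) < d"
      using signed_radonD(4)[OF g A d] by blast
    have CD: "C \<in> sets borel" "D \<in> sets borel"
      using C(1) D(1) by (auto simp: borel_compact)
    let ?E = "A - (C \<union> D)"
    have E: "?E \<in> sets borel" using A CD by auto
    have "variation f ?E \<le> variation f (A - C)" "variation g ?E \<le> variation g (A - D)"
      using A CD by (auto intro!: variation_mono signed_radonD(3)[OF f] signed_radonD(3)[OF g])
    then have 1: "variation f ?E \<le> d" "variation g ?E \<le> d" using C D by auto
    have "variation ?h ?E \<le> \<bar>a\<bar> * variation f ?E + \<bar>b\<bar> * variation g ?E"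
      unfolding variation_def[of ?h]
      using le E by (intro cSup_least partition_sums_nonempty) auto
    also have "\<dots> \<le> \<bar>a\<bar> * d + \<bar>b\<bar> * d"
      using 1 by (intro add_mono mult_left_mono) auto
    also have "\<dots> < (\<bar>a\<bar> + \<bar>b\<bar> + 1) * d"
      using d by (simp add: algebra_simps)
    also have "\<dots> = e"
      unfolding d_def using add_nonneg_pos[of "\<bar>a\<bar> + \<bar>b\<bar>" 1] by simp
    finally show ?thesis
      using C D by (intro exI[of _ "C \<union> D"]) auto
  qed
  have "bdd_above (partition_sums ?h UNIV)"
    using le[of _ UNIV] by (intro bdd_aboveI) auto
  then show ?thesis
    unfolding signed_radon_def
    using signed_radonD(1,2)[OF f] signed_radonD(1,2)[OF g] reg
    by (auto intro!: sums_add sums_mult)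
qed

lemma partition_sums_zero: "partition_sums (\<lambda>_. 0) A \<subseteq> {0}"
  unfolding partition_sums_def by auto

lemma signed_radon_zero: "signed_radon (\<lambda>_. 0)"
proof -
  have "bdd_above (partition_sums (\<lambda>_. 0) UNIV)"
    using bdd_above_mono[OF _ partition_sums_zero] by simp
  moreover have "variation (\<lambda>_. 0) (A - {}) < e" if "A \<in> sets borel" "e > 0" for A and e :: real
  proof -
    have "partition_sums (\<lambda>_. 0) (A - {}) = {0}"
      using partition_sums_zero partition_sums_nonempty[of "A - {}"] that(1) by fastforce
    then show ?thesis using that(2) by (simp add: variation_def)
  qed
  ultimately show ?thesis
    unfolding signed_radon_def by (auto intro: exI[of _ "{}"])
qed

definition dirac_fun :: "torus \<Rightarrow> torus set \<Rightarrow> real" where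
  "dirac_fun x A = (if A \<in> sets borel \<and> x \<in> A then 1 else 0)"

lemma partition_sums_dirac_le:
  assumes "s \<in> partition_sums (dirac_fun x) A"
  shows "s \<le> (if x \<in> A then 1 else 0)"
proof -
  obtain P where P: "finite P" "P \<subseteq> sets borel" "partition_on A P"
      "s = (\<Sum>B\<in>P. \<bar>dirac_fun x B\<bar>)"
    using assms unfolding partition_sums_def by blast
  have s: "s = (\<Sum>B\<in>P. if x \<in> B then 1 else 0)"
    unfolding P(4) using P(2) by (intro sum.cong) (auto simp: dirac_fun_def)
  show ?thesis
  proof (cases "x \<in> A")
    case True
    then obtain B where B: "B \<in> P" "x \<in> B" using P(3) by (auto simp: partition_on_def)
    have "x \<in> C \<longleftrightarrow> C = B" if "C \<in> P" for C
      using P(3) B that by (auto simp: partition_on_def disjoint_def)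
    then have "s = (\<Sum>C\<in>P. if C = B then 1 else 0)"
      unfolding s by (intro sum.cong) auto
    then show ?thesis using P(1) B True by simp
  next
    case False
    then have "x \<notin> B" if "B \<in> P" for B using P(3) that by (auto simp: partition_on_def)
    then show ?thesis unfolding s using False by simp
  qed
qed

lemma signed_radon_dirac: "signed_radon (dirac_fun x)"
proof -
  have "(\<lambda>n. dirac_fun x (F n)) sums dirac_fun x (\<Union>n. F n)"
    if F: "range F \<subseteq> sets borel" "disjoint_family F" for F :: "nat \<Rightarrow> torus set"
  proof (cases "\<exists>k. x \<in> F k")
    case True
    then obtain k where k: "x \<in> F k" by blast
    have "x \<in> F n \<longleftrightarrow> n = k" for n
      using F(2) k by (auto simp: disjoint_family_on_def)
    then have "(\<lambda>n. dirac_fun x (F n)) = (\<lambda>n. if n = k then 1 else 0)"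
      using F(1) by (auto simp: dirac_fun_def fun_eq_iff)
    moreover have "dirac_fun x (\<Union>n. F n) = 1"
      using F(1) k by (auto simp: dirac_fun_def)
    ultimately show ?thesis using sums_single[of k "\<lambda>_. 1 :: real"] by simp
  qed (simp add: dirac_fun_def)
  moreover have "bdd_above (partition_sums (dirac_fun x) UNIV)"
    using partition_sums_dirac_le[of _ x UNIV] by (intro bdd_aboveI) auto
  moreover have "\<exists>C. compact C \<and> C \<subseteq> A \<and> variation (dirac_fun x) (A - C) < e"
    if "A \<in> sets borel" "e > 0" for A and e :: real
  proof -
    have "variation (dirac_fun x) (A - A \<inter> {x}) \<le> 0"
      unfolding variation_def
      by (rule cSup_least)
        (use that partition_sums_dirac_le[of _ x "A - A \<inter> {x}"] in
          \<open>auto simp: partition_sums_nonempty\<close>)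
    moreover have "compact (A \<inter> {x})"
      by (cases "x \<in> A") auto
    ultimately show ?thesis
      using that by (intro exI[of _ "A \<inter> {x}"]) auto
  qed
  ultimately show ?thesis
    unfolding signed_radon_def by (auto simp: dirac_fun_def)
qed

typedef radon = "{m. signed_radon m}"
  morphisms meas Radon
  using signed_radon_zero by blast

lemma signed_radon_meas: "signed_radon (meas \<mu>)"
  using meas[of \<mu>] by simp

lemma meas_Radon: "signed_radon m \<Longrightarrow> meas (Radon m) = m"
  by (simp add: Radon_inverse)

definition dirac :: "torus \<Rightarrow> radon" where
  "dirac x = Radon (dirac_fun x)"

instantiation radon :: real_vector
begin

definition "0 = Radon (\<lambda>_. 0)"
definition "\<mu> + \<nu> = Radon (\<lambda>A. meas \<mu> A + meas \<nu> A)"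
definition "- \<mu> = Radon (\<lambda>A. - meas \<mu> A)"
definition "\<mu> - \<nu> = Radon (\<lambda>A. meas \<mu> A - meas \<nu> A)"
definition "r *\<^sub>R \<mu> = Radon (\<lambda>A. r * meas \<mu> A)"

lemma meas_simps:
  "meas 0 = (\<lambda>_. 0)"
  "meas (\<mu> + \<nu>) = (\<lambda>A. meas \<mu> A + meas \<nu> A)"
  "meas (- \<mu>) = (\<lambda>A. - meas \<mu> A)"
  "meas (\<mu> - \<nu>) = (\<lambda>A. meas \<mu> A - meas \<nu> A)"
  "meas (r *\<^sub>R \<mu>) = (\<lambda>A. r * meas \<mu> A)"
proof -
  note L = signed_radon_lincomb[OF signed_radon_meas[of \<mu>] signed_radon_meas[of \<nu>]]
  show "meas 0 = (\<lambda>_. 0)"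
    by (simp add: zero_radon_def meas_Radon signed_radon_zero)
  show "meas (\<mu> + \<nu>) = (\<lambda>A. meas \<mu> A + meas \<nu> A)"
    using L[of 1 1] by (simp add: plus_radon_def meas_Radon)
  show "meas (- \<mu>) = (\<lambda>A. - meas \<mu> A)"
    using L[of "-1" 0] by (simp add: uminus_radon_def meas_Radon)
  show "meas (\<mu> - \<nu>) = (\<lambda>A. meas \<mu> A - meas \<nu> A)"
    using L[of 1 "-1"] by (simp add: minus_radon_def meas_Radon)
  show "meas (r *\<^sub>R \<mu>) = (\<lambda>A. r * meas \<mu> A)"
    using L[of r 0] by (simp add: scaleR_radon_def meas_Radon)
qed

instance
  by standard (simp_all add: meas_inject[symmetric] meas_simps fun_eq_iff algebra_simps)

end

definition tv_norm :: "radon \<Rightarrow> real" where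
  "tv_norm \<mu> = variation (meas \<mu>) UNIV"

text \<open>The Jordan decomposition: the positive and negative parts of \<open>\<mu>\<close> are
  \<open>(|\<mu>| + \<mu>) / 2\<close> and \<open>(|\<mu>| - \<mu>) / 2\<close>.\<close>

definition pos_measure :: "radon \<Rightarrow> torus measure" where
  "pos_measure \<mu> = measure_of UNIV (sets borel)
     (\<lambda>A. ennreal ((variation (meas \<mu>) A + meas \<mu> A) / 2))"

definition neg_measure :: "radon \<Rightarrow> torus measure" where
  "neg_measure \<mu> = measure_of UNIV (sets borel)
     (\<lambda>A. ennreal ((variation (meas \<mu>) A - meas \<mu> A) / 2))"

definition radon_integral :: "radon \<Rightarrow> (torus \<Rightarrow> real) \<Rightarrow> real" where
  "radon_integral \<mu> f = (\<integral>x. f x \<partial>pos_measure \<mu>) - (\<integral>x. f x \<partial>neg_measure \<mu>)"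


section \<open>The optimization problem\<close>

definition pairing :: "(torus \<Rightarrow> real) \<times> (real^'N) \<Rightarrow> radon \<times> (real^'N) \<Rightarrow> real" where
  "pairing \<eta> u = radon_integral (fst u) (fst \<eta>) + snd \<eta> \<bullet> snd u"

definition meas_op :: "('N \<Rightarrow> torus \<Rightarrow> real) \<Rightarrow> radon \<times> (real^'N) \<Rightarrow> real^'N" where
  "meas_op \<phi> u = (\<chi> i. radon_integral (fst u) (\<phi> i) + snd u $ i)"

definition meas_op_pre :: "('N \<Rightarrow> torus \<Rightarrow> real) \<Rightarrow> real^'N \<Rightarrow> (torus \<Rightarrow> real) \<times> (real^'N)" where
  "meas_op_pre \<phi> p = ((\<lambda>x. \<Sum>i\<in>UNIV. p $ i * \<phi> i x), p)"

definition regularizer :: "radon \<times> (real^'N) \<Rightarrow> real" where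
  "regularizer u = tv_norm (fst u) + (\<Sum>i\<in>UNIV. \<bar>snd u $ i\<bar>)"

definition subdiff :: "(radon \<times> (real^'N) \<Rightarrow> real) \<Rightarrow> radon \<times> (real^'N)
    \<Rightarrow> ((torus \<Rightarrow> real) \<times> (real^'N)) set" where
  "subdiff G u = {\<eta>. continuous_on UNIV (fst \<eta>) \<and> (\<forall>v. G v \<ge> G u + pairing \<eta> (v - u))}"

definition dual_solutions :: "('N \<Rightarrow> torus \<Rightarrow> real) \<Rightarrow> real^'N \<Rightarrow> (real^'N) set" where
  "dual_solutions \<phi> y =
     {p. is_arg_max (\<lambda>q. y \<bullet> q) (\<lambda>q. meas_op_pre \<phi> q \<in> subdiff regularizer 0) p}"

text \<open>The solution set of the dual problem is convex, so the minimizer of the Euclidean norm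
  on it is unique.\<close>

definition min_norm_certificate ::
    "('N \<Rightarrow> torus \<Rightarrow> real) \<Rightarrow> real^'N \<Rightarrow> (torus \<Rightarrow> real) \<times> (real^'N)" where
  "min_norm_certificate \<phi> y = meas_op_pre \<phi> (ARG_MIN norm p. p \<in> dual_solutions \<phi> y)"

definition E2 :: "(radon \<times> (real^'N)) set" where
  "E2 = {(0, a *\<^sub>R axis k 1) | a k. \<bar>a\<bar> = 1}"

definition objective ::
    "('N \<Rightarrow> torus \<Rightarrow> real) \<Rightarrow> real \<Rightarrow> real^'N \<Rightarrow> radon \<times> (real^'N) \<Rightarrow> real" where
  "objective \<phi> l z = (\<lambda>(\<mu>, \<zeta>).
     1 / 2 * (\<Sum>i\<in>UNIV. \<bar>radon_integral \<mu> (\<phi> i) + \<zeta> $ i - z $ i\<bar>\<^sup>2)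
       + l * (tv_norm \<mu> + (\<Sum>i\<in>UNIV. \<bar>\<zeta> $ i\<bar>)))"

text \<open>Linear independence of a family; unlike \<^const>\<open>independent\<close> of its range, this rules out
  repeated vectors.\<close>

definition independent_family :: "'i set \<Rightarrow> ('i \<Rightarrow> 'v::real_vector) \<Rightarrow> bool" where
  "independent_family I v \<longleftrightarrow> inj_on v I \<and> independent (v ` I)"

text \<open>Families indexed by \<open>1, ..., n\<close> are functions on the natural numbers of which only the
  values on \<open>{1..n}\<close> matter; where uniqueness of such a family is claimed, it is
  normalized by membership in \<^term>\<open>extensional {1..n}\<close>.\<close>

definition sparse_measure :: "nat \<Rightarrow> nat \<Rightarrow> (nat \<Rightarrow> real) \<Rightarrow> (nat \<Rightarrow> real^'N) \<Rightarrow>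
    (nat \<Rightarrow> real) \<Rightarrow> (nat \<Rightarrow> torus) \<Rightarrow> (nat \<Rightarrow> real) \<Rightarrow> radon \<times> (real^'N)" where
  "sparse_measure n m \<sigma> \<zeta> c x d =
     (\<Sum>i\<in>{1..n}. c i *\<^sub>R (\<sigma> i *\<^sub>R dirac (x i), 0)) + (\<Sum>j\<in>{1..m}. d j *\<^sub>R (0, \<zeta> j))"

end

theory Submission
  imports Defs
begin

text \<open>Dual feasibility of \<open>p\<close> means that \<open>p\<close> lies in the polar set of the compact set of atoms
  \<open>\<plusminus>\<Phi> x = \<plusminus>(\<phi>\<^sub>k x)\<^sub>k\<close> and \<open>\<plusminus>e\<^sub>k\<close>.  The dual certificate of the regularized problem is the projection
  of \<open>(y + w) / l\<close> onto this set.  For \<open>w = 0\<close> it tends to the minimal-norm solution as \<open>l \<rightarrow> 0\<close>, and since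
  projections are nonexpansive, noise with \<open>\<parallel>w\<parallel> \<le> \<alpha> l\<close> moves it by at most \<open>\<alpha>\<close>.  The nondegeneracy of the
  minimal-norm certificate is an open condition: its active constraints can only move slightly and
  cannot split.

  The normal cone of the polar set at the projection \<open>p\<close> is generated by the active atoms, which yields
  a sparse \<open>u\<close> with \<open>K u = y + w - l p\<close> and \<open>R u = p \<bullet> K u\<close>, hence a minimizer.  Every other minimizer \<open>v\<close>
  satisfies \<open>K v = K u\<close> and \<open>R v = p \<bullet> K v\<close>, so it is concentrated on the active atoms, and their linear
  independence forces \<open>v = u\<close>.  The coefficients of \<open>u\<close> are close to the original ones because linear
  independence survives small perturbations and \<open>K u - y = O(l)\<close>.\<close>

section \<open>Convex analysis in Euclidean spaces\<close>

text \<open>The projection comes from duality: for data z, the dual of the regularized problem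
  maximizes z \<bullet> p - l |p|^2 / 2 over the polar set, which is the same as minimizing |z / l -
  p|. The primal minimizer is then written down from the normal cone, so existence needs no
  weak-star compactness of measures. Two facts carry the way back from p to u. The active set is
  finite, hence the cone it generates is closed and an outside vector can be strictly separated from
  it. And p \<bullet> K v falls short of R v by integrals of nonnegative functions against the
  Jordan parts and a sum of nonnegative terms, so equality confines v to the active atoms. The
  Jordan parts do not depend linearly on the measure, so linearity of K is itself obtained by
  approximation. Positions and coefficients are controlled separately: the positions are governed by
  p alone, and only afterwards are the coefficients estimated from a linear system whose columns
  have moved slightly.\<close>

lemma convex_cone_hull_finite_explicit:
  fixes W :: "'a::real_vector set"
  assumes "finite W" "z \<in> convex_cone hull W"
  obtains c where "\<And>w. w \<in> W \<Longrightarrow> 0 \<le> c w" "z = (\<Sum>w\<in>W. c w *\<^sub>R w)"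
proof -
  let ?S = "{z. \<exists>c. (\<forall>w\<in>W. 0 \<le> c w) \<and> z = (\<Sum>w\<in>W. c w *\<^sub>R w)}"
  have "W \<subseteq> ?S"
  proof
    fix v assume "v \<in> W"
    then show "v \<in> ?S"
      using assms(1)
      by (intro CollectI exI[of _ "\<lambda>w. if w = v then 1 else 0"]) (auto simp: if_distrib[of "\<lambda>t. t *\<^sub>R _"] cong: if_cong)
  qed
  moreover have "convex_cone ?S"
    unfolding convex_cone_iff
  proof (intro conjI ballI allI impI)
    show "0 \<in> ?S"
      by (auto intro!: exI[of _ "\<lambda>_. 0"])
    fix x assume "x \<in> ?S"
    then obtain c where c: "\<forall>w\<in>W. 0 \<le> c w" "x = (\<Sum>w\<in>W. c w *\<^sub>R w)"
      by blast
    {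
      fix y assume "y \<in> ?S"
      then obtain d where d: "\<forall>w\<in>W. 0 \<le> d w" "y = (\<Sum>w\<in>W. d w *\<^sub>R w)"
        by blast
      show "x + y \<in> ?S"
        using c d by (intro CollectI exI[of _ "\<lambda>w. c w + d w"])
          (auto simp: scaleR_add_left sum.distrib)
    }
    fix t :: real assume "0 \<le> t"
    then show "t *\<^sub>R x \<in> ?S"
      using c by (intro CollectI exI[of _ "\<lambda>w. t * c w"]) (auto simp: scaleR_sum_right)
  qed
  ultimately have "convex_cone hull W \<subseteq> ?S"
    by (rule hull_minimal)
  with assms(2) that show thesis
    by blast
qed

text \<open>A pair (a, b) stands for the value of a constraint and its rate of change along a
  direction. Constraints with b < 0 only improve. Those with b >= 0 form a compact set on which a <
  1, hence stay a fixed gap below 1, and a step of length gap over maximal rate cannot exhaust that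
  gap.\<close>

lemma compact_push_below_one:
  fixes T :: "(real \<times> real) set"
  assumes "compact T"
    and le1: "\<And>a b. (a, b) \<in> T \<Longrightarrow> a \<le> 1"
    and act: "\<And>b. (1, b) \<in> T \<Longrightarrow> b < 0"
  obtains t where "t > 0" "\<And>a b. (a, b) \<in> T \<Longrightarrow> a + t * b \<le> 1"
proof -
  let ?S = "T \<inter> {u. 0 \<le> snd u}"
  have S: "compact ?S"
    using assms(1) by (intro compact_Int_closed closed_Collect_le continuous_intros)
  obtain g where g: "g > 0" "\<And>a b. (a, b) \<in> ?S \<Longrightarrow> a \<le> 1 - g"
  proof (cases "?S = {}")
    case True
    then show thesis
      using that[of 1] by simp
  next
    case False
    then obtain u where u: "u \<in> ?S" "\<And>v. v \<in> ?S \<Longrightarrow> fst v \<le> fst u"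
      using continuous_attains_sup[OF S False continuous_on_fst[OF continuous_on_id]] by auto
    have "fst u < 1"
      using u(1) le1[of "fst u" "snd u"] act[of "snd u"]
      by (cases u) (fastforce simp: less_le)
    then show thesis
      using that[of "1 - fst u"] u(2) by fastforce
  qed
  obtain M where M: "\<And>u. u \<in> T \<Longrightarrow> norm u \<le> M" "M > 0"
    using compact_imp_bounded[OF assms(1)] unfolding bounded_pos by blast
  have "a + (g / M) * b \<le> 1" if ab: "(a, b) \<in> T" for a b
  proof (cases "b \<ge> 0")
    case True
    have "b \<le> M"
      using M(1)[OF ab] norm_snd_le[of b a] by simp
    then have "(g / M) * b \<le> g"
      using g(1) M(2) by (simp add: field_simps)
    then show ?thesis
      using g(2)[of a b] ab True by simp
  next
    case False
    then have "(g / M) * b \<le> 0"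
      using g(1) M(2) by (intro mult_nonneg_nonpos) auto
    then show ?thesis
      using le1[OF ab] by simp
  qed
  then show thesis
    using that[of "g / M"] g(1) M(2) by simp
qed

section \<open>Polar sets and their normal cones\<close>

definition polar :: "'a::euclidean_space set \<Rightarrow> 'a set" where
  "polar A = {p. \<forall>a\<in>A. p \<bullet> a \<le> 1}"

lemma closed_polar: "closed (polar A)"
proof -
  have "polar A = (\<Inter>a\<in>A. {p. p \<bullet> a \<le> 1})"
    by (auto simp: polar_def)
  then show ?thesis
    by (auto intro!: closed_INT closed_Collect_le continuous_intros)
qed

lemma convex_polar: "convex (polar A)"
proof -
  have "polar A = (\<Inter>a\<in>A. {p. a \<bullet> p \<le> 1})"
    by (auto simp: polar_def inner_commute)
  then show ?thesis
    by (auto intro!: convex_INT convex_halfspace_le)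
qed

lemma zero_in_polar: "0 \<in> polar A"
  by (simp add: polar_def)

text \<open>If \<open>z\<close> is not in the cone of the active constraints, a separating direction, tilted slightly
  towards \<open>- p\<close>, strictly decreases all active constraints and so stays in the polar set.\<close>

lemma normal_cone_polar:
  fixes A :: "'a::euclidean_space set"
  assumes A: "compact A" and p: "p \<in> polar A"
    and z: "\<And>q. q \<in> polar A \<Longrightarrow> z \<bullet> (q - p) \<le> 0"
    and fin: "finite {a\<in>A. p \<bullet> a = 1}"
  shows "z \<in> convex_cone hull {a\<in>A. p \<bullet> a = 1}"
proof (rule ccontr)
  let ?W = "{a\<in>A. p \<bullet> a = 1}"
  assume "z \<notin> convex_cone hull ?W"
  \<comment> \<open>Finiteness of the active set enters here: a finitely generated cone is closed,
    so the separation is strict.\<close>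
  then obtain h b where hb: "h \<bullet> z < b" "\<And>x. x \<in> convex_cone hull ?W \<Longrightarrow> b < h \<bullet> x"
    using separating_hyperplane_closed_point[OF convex_convex_cone_hull closed_convex_cone_hull[OF fin]]
    by blast
  have "b < 0"
    using hb(2)[OF convex_cone_hull_contains_0] by simp
  then have hz: "h \<bullet> z < 0"
    using hb(1) by simp
  \<comment> \<open>If h were negative at a generator w, the nonnegative multiple of w by b / (h
    \<bullet> w) would be a cone element where h equals b, against the strict bound.\<close>
  have hw: "0 \<le> h \<bullet> w" if w: "w \<in> ?W" for w
  proof (rule ccontr)
    assume neg: "\<not> 0 \<le> h \<bullet> w"
    have "b < h \<bullet> ((b / (h \<bullet> w)) *\<^sub>R w)"
      using neg \<open>b < 0\<close> by (intro hb(2) convex_cone_hull_mul hull_inc w) (simp add: divide_nonpos_neg)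
    then show False
      using neg by simp
  qed
  \<comment> \<open>This s keeps |s (p \<bullet> z)| at most half of - (h \<bullet> z), so the tilt
    leaves q \<bullet> z positive; the + 1 avoids a zero denominator. On active atoms the tilt
    contributes exactly - s, since p \<bullet> a = 1 there.\<close>
  define s where "s = - (h \<bullet> z) / (2 * (\<bar>p \<bullet> z\<bar> + 1))"
  have s: "s > 0"
    using hz unfolding s_def by (intro divide_pos_pos) auto
  define q where "q = - h - s *\<^sub>R p"
  have "\<bar>s * (p \<bullet> z)\<bar> \<le> s * (\<bar>p \<bullet> z\<bar> + 1)"
    using s by (simp add: abs_mult)
  also have "\<dots> = - (h \<bullet> z) / 2"
    unfolding s_def by (simp add: field_simps)
  finally have qz: "0 < q \<bullet> z"
    using hz unfolding q_def by (simp add: inner_diff_left)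
  let ?T = "(\<lambda>a. (p \<bullet> a, q \<bullet> a)) ` A"
  obtain t where t: "t > 0" "\<And>a b. (a, b) \<in> ?T \<Longrightarrow> a + t * b \<le> 1"
  proof (rule compact_push_below_one)
    show "compact ?T"
      using A by (intro compact_continuous_image continuous_intros)
    show "a \<le> 1" if "(a, b) \<in> ?T" for a b
      using that p by (auto simp: polar_def)
    show "b < 0" if "(1, b) \<in> ?T" for b
      using that s hw unfolding q_def by (force simp: inner_diff_left)
  qed blast
  have "p + t *\<^sub>R q \<in> polar A"
    using t(2) by (auto simp: polar_def inner_add_left)
  then have "z \<bullet> (t *\<^sub>R q) \<le> 0"
    using z by fastforce
  then show False
    using t(1) qz by (simp add: inner_commute mult_le_0_iff)
qed

section \<open>Linear independence: dual vectors, coefficient bounds, perturbation\<close>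

text \<open>Injectivity and independence let the k-th coordinate functional on the family extend
  linearly to the whole space; \<open>adjoint f 1\<close> is the vector representing it.\<close>

lemma independent_family_dual:
  fixes v :: "'i \<Rightarrow> 'a::euclidean_space"
  assumes "independent_family I v" "k \<in> I"
  obtains g where "\<And>l. l \<in> I \<Longrightarrow> g \<bullet> v l = (if l = k then 1 else 0 :: real)"
proof -
  have inj: "inj_on v I" and ind: "independent (v ` I)"
    using assms(1) by (auto simp: independent_family_def)
  obtain f :: "'a \<Rightarrow> real" where f: "linear f" "\<And>x. x \<in> v ` I \<Longrightarrow> f x = (if x = v k then 1 else 0)"
    using real_vector.linear_independent_extend[OF ind, of "\<lambda>x. if x = v k then 1 else 0 :: real"] by blast
  have "adjoint f 1 \<bullet> v l = (if l = k then 1 else 0)" if "l \<in> I" for l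
    using adjoint_works[OF f(1), of "v l" 1] f(2)[of "v l"] that inj assms(2)
    by (auto simp: inner_commute inj_on_def)
  then show thesis
    using that by blast
qed

text \<open>Each coefficient is recovered by pairing with a dual vector, so the sum of the norms of
  the dual vectors serves as \<open>K\<close>; the added 1 keeps it positive when \<open>I\<close>
  is empty.\<close>

lemma independent_family_bound:
  fixes v :: "'i \<Rightarrow> 'a::euclidean_space"
  assumes "independent_family I v" "finite I"
  obtains K where "K > 0" "\<And>c. (\<Sum>l\<in>I. \<bar>c l\<bar>) \<le> K * norm (\<Sum>l\<in>I. c l *\<^sub>R v l)"
proof -
  have "\<forall>k\<in>I. \<exists>g. \<forall>l\<in>I. g \<bullet> v l = (if l = k then 1 else 0)"
    using independent_family_dual[OF assms(1)] by metis
  then obtain g where g: "\<And>k l. k \<in> I \<Longrightarrow> l \<in> I \<Longrightarrow> g k \<bullet> v l = (if l = k then 1 else 0)"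
    by metis
  let ?K = "(\<Sum>k\<in>I. norm (g k)) + 1"
  have "(\<Sum>l\<in>I. \<bar>c l\<bar>) \<le> ?K * norm (\<Sum>l\<in>I. c l *\<^sub>R v l)" for c
  proof -
    let ?x = "\<Sum>l\<in>I. c l *\<^sub>R v l"
    have "c k = g k \<bullet> ?x" if "k \<in> I" for k
    proof -
      have "g k \<bullet> ?x = (\<Sum>l\<in>I. if l = k then c l else 0)"
        unfolding inner_sum_right using that g by (intro sum.cong) auto
      then show ?thesis
        using that assms(2) by simp
    qed
    then have "(\<Sum>l\<in>I. \<bar>c l\<bar>) \<le> (\<Sum>l\<in>I. norm (g l) * norm ?x)"
      by (intro sum_mono) (metis Cauchy_Schwarz_ineq2)
    also have "\<dots> \<le> ?K * norm ?x"
      by (simp add: sum_distrib_right[symmetric] distrib_right)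
    finally show ?thesis .
  qed
  moreover have "?K > 0"
    by (simp add: add_nonneg_pos sum_nonneg)
  ultimately show thesis
    using that by blast
qed

text \<open>Moving each vector by at most 1 / (2 K) changes K times the norm of the combination by
  at most half of the coefficient sum, which is absorbed on the left by doubling K. The constants
  are uniform in \<open>w\<close>, because the positions of the moved atoms become known only
  later.\<close>

lemma independent_family_perturb:
  fixes v :: "'i \<Rightarrow> 'a::euclidean_space"
  assumes "independent_family I v" "finite I"
  obtains \<delta> K where "\<delta> > 0" "K > 0"
    "\<And>w c. (\<And>l. l \<in> I \<Longrightarrow> norm (w l - v l) \<le> \<delta>) \<Longrightarrow>
      (\<Sum>l\<in>I. \<bar>c l\<bar>) \<le> K * norm (\<Sum>l\<in>I. c l *\<^sub>R w l)"
proof -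
  obtain K where K: "K > 0" "\<And>c. (\<Sum>l\<in>I. \<bar>c l\<bar>) \<le> K * norm (\<Sum>l\<in>I. c l *\<^sub>R v l)"
    using independent_family_bound[OF assms] by blast
  have "(\<Sum>l\<in>I. \<bar>c l\<bar>) \<le> (2 * K) * norm (\<Sum>l\<in>I. c l *\<^sub>R w l)"
    if w: "\<And>l. l \<in> I \<Longrightarrow> norm (w l - v l) \<le> 1 / (2 * K)" for w c
  proof -
    let ?s = "\<Sum>l\<in>I. \<bar>c l\<bar>"
    have "norm (\<Sum>l\<in>I. c l *\<^sub>R (w l - v l)) \<le> (\<Sum>l\<in>I. \<bar>c l\<bar> * (1 / (2 * K)))"
      using w by (intro sum_norm_le) (simp add: mult_left_mono del: times_divide_eq_right)
    then have 1: "K * norm (\<Sum>l\<in>I. c l *\<^sub>R (w l - v l)) \<le> ?s / 2"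
      using K(1) by (simp add: sum_distrib_right[symmetric] field_simps flip: sum_divide_distrib)
    have "(\<Sum>l\<in>I. c l *\<^sub>R v l) = (\<Sum>l\<in>I. c l *\<^sub>R w l) - (\<Sum>l\<in>I. c l *\<^sub>R (w l - v l))"
      by (simp add: scaleR_diff_right sum_subtractf)
    then have "norm (\<Sum>l\<in>I. c l *\<^sub>R v l) \<le>
        norm (\<Sum>l\<in>I. c l *\<^sub>R w l) + norm (\<Sum>l\<in>I. c l *\<^sub>R (w l - v l))"
      by (metis norm_triangle_ineq4)
    then have "K * norm (\<Sum>l\<in>I. c l *\<^sub>R v l) \<le>
        K * norm (\<Sum>l\<in>I. c l *\<^sub>R w l) + K * norm (\<Sum>l\<in>I. c l *\<^sub>R (w l - v l))"
      using K(1) by (simp flip: distrib_left)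
    with K(2)[of c] 1 show ?thesis
      by simp
  qed
  then show thesis
    using that[of "1 / (2 * K)" "2 * K"] K(1) by simp
qed

section \<open>Projections of rescaled data and the minimal-norm maximizer\<close>

text \<open>Expanding |y / l - q|^2 and multiplying by l shows that the projection of y / l
  maximizes 2 (y \<bullet> q) - l |q|^2 over \<open>C\<close>, a linear problem with a vanishing
  quadratic penalty.\<close>

lemma closest_point_scaled_le:
  fixes y q :: "'a::euclidean_space"
  assumes "closed C" "q \<in> C" "l > 0"
  shows "2 * (y \<bullet> q) - l * (norm q)\<^sup>2 \<le>
    2 * (y \<bullet> closest_point C (y /\<^sub>R l)) - l * (norm (closest_point C (y /\<^sub>R l)))\<^sup>2"
proof -
  define p where "p = closest_point C (y /\<^sub>R l)"
  have "dist (y /\<^sub>R l) p \<le> dist (y /\<^sub>R l) q"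
    unfolding p_def by (rule closest_point_le) fact+
  then have "(dist (y /\<^sub>R l) p)\<^sup>2 \<le> (dist (y /\<^sub>R l) q)\<^sup>2"
    by (rule power_mono) simp
  then have "- 2 * ((y /\<^sub>R l) \<bullet> p) + (norm p)\<^sup>2 \<le> - 2 * ((y /\<^sub>R l) \<bullet> q) + (norm q)\<^sup>2"
    by (simp add: dist_norm power2_norm_eq_inner inner_diff_left inner_diff_right inner_commute)
  then have "l * (- 2 * ((y /\<^sub>R l) \<bullet> p) + (norm p)\<^sup>2) \<le> l * (- 2 * ((y /\<^sub>R l) \<bullet> q) + (norm q)\<^sup>2)"
    using assms(3) by (intro mult_left_mono) auto
  moreover have "l * ((y /\<^sub>R l) \<bullet> r) = y \<bullet> r" for r
    using assms(3) by simp
  ultimately show ?thesis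
    unfolding p_def[symmetric] distrib_left by(simp only: mult.left_commute[of l])
qed

text \<open>Comparing the penalized values at the projection p and at p0 gives |p| <= |p0| and y
  \<bullet> p >= y \<bullet> p0 - l |p0|^2 / 2. By compactness, points of \<open>C\<close> of norm
  at most |p0| and at distance at least d from p0 miss the maximum of y by a fixed gap g, so a small
  l forces p close to p0.\<close>

lemma closest_point_tendsto_min_norm:
  fixes y :: "'a::euclidean_space"
  assumes C: "compact C" "convex C"
    and p0: "p0 \<in> C" "\<And>q. q \<in> C \<Longrightarrow> y \<bullet> q \<le> y \<bullet> p0"
    and min: "\<And>q. q \<in> C \<Longrightarrow> y \<bullet> q = y \<bullet> p0 \<Longrightarrow> norm p0 \<le> norm q"
    and d: "d > 0"
  obtains l0 where "l0 > 0"
    "\<And>l. 0 < l \<Longrightarrow> l \<le> l0 \<Longrightarrow> norm (closest_point C (y /\<^sub>R l) - p0) < d"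
proof -
  have clC: "closed C"
    using C(1) by (rule compact_imp_closed)
  let ?D = "C \<inter> {q. y \<bullet> p0 \<le> y \<bullet> q}"
  have D: "convex ?D" "closed ?D"
    using C(2) clC by (auto intro!: convex_Int convex_halfspace_ge closed_Int closed_Collect_le continuous_intros)
  \<comment> \<open>The maximizers form the closed convex set \<open>?D\<close>, in which p0 is the
    point nearest to the origin; such a point is unique.\<close>
  have uniq: "q = p0" if q: "q \<in> C" "y \<bullet> q = y \<bullet> p0" "norm q \<le> norm p0" for q
  proof (rule any_closest_point_unique[OF D, of q p0 0])
    show "\<forall>z\<in>?D. dist 0 p0 \<le> dist 0 z"
      using min p0(2) by (auto intro: order_antisym)
    then show "\<forall>z\<in>?D. dist 0 q \<le> dist 0 z"
      using q(3) by force
  qed (use q p0 in auto)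
  let ?S = "C \<inter> (cball 0 (norm p0) \<inter> - ball p0 d)"
  have S: "compact ?S"
    using C(1) by (intro compact_Int_closed) auto
  obtain g where g: "g > 0" "\<And>q. q \<in> ?S \<Longrightarrow> y \<bullet> q \<le> y \<bullet> p0 - g"
  proof (cases "?S = {}")
    case True
    then show thesis
      using that[of 1] by simp
  next
    case False
    then obtain u where u: "u \<in> ?S" "\<And>v. v \<in> ?S \<Longrightarrow> y \<bullet> v \<le> y \<bullet> u"
      using continuous_attains_sup[OF S False continuous_on_inner[OF continuous_on_const continuous_on_id], of y]
      by blast
    have "y \<bullet> u \<noteq> y \<bullet> p0"
      using uniq[of u] u(1) d by auto
    then have "y \<bullet> u < y \<bullet> p0"
      using p0(2)[of u] u(1) by auto
    then show thesis
      using that[of "y \<bullet> p0 - y \<bullet> u"] u(2) by fastforce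
  qed
  \<comment> \<open>Makes l |p0|^2 at most g for all l <= l0, also when p0 = 0.\<close>
  define l0 where "l0 = g / ((norm p0)\<^sup>2 + 1)"
  have l0: "l0 > 0"
    unfolding l0_def using g(1) by (intro divide_pos_pos add_nonneg_pos) auto
  have "l0 * (norm p0)\<^sup>2 \<le> l0 * ((norm p0)\<^sup>2 + 1)"
    using l0 by (intro mult_left_mono) auto
  also have "\<dots> = g"
    unfolding l0_def using add_nonneg_pos[of "(norm p0)\<^sup>2" 1] by simp
  finally have l0g: "l0 * (norm p0)\<^sup>2 \<le> g" .
  show thesis
  proof (rule that[OF l0])
    fix l :: real assume l: "0 < l" "l \<le> l0"
    define p where "p = closest_point C (y /\<^sub>R l)"
    have pC: "p \<in> C"
      unfolding p_def using clC p0(1) by (intro closest_point_in_set) auto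
    have key: "2 * (y \<bullet> p0) - l * (norm p0)\<^sup>2 \<le> 2 * (y \<bullet> p) - l * (norm p)\<^sup>2"
      unfolding p_def using clC p0(1) l(1) by (rule closest_point_scaled_le)
    then have "l * (norm p)\<^sup>2 \<le> l * (norm p0)\<^sup>2"
      using p0(2)[OF pC] by simp
    then have np: "norm p \<le> norm p0"
      using l(1) by (simp add: power2_le_iff_abs_le)
    have "l * (norm p0)\<^sup>2 \<le> l0 * (norm p0)\<^sup>2"
      using l by (intro mult_right_mono) auto
    moreover have "0 \<le> l * (norm p)\<^sup>2"
      using l by simp
    ultimately have "y \<bullet> p > y \<bullet> p0 - g"
      using key l0g g(1) by linarith
    then have "p \<notin> ?S"
      using g(2) by fastforce
    then show "norm (p - p0) < d"
      using pC np by (auto simp: dist_norm norm_minus_commute)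
  qed
qed

lemma closest_point_near_min_norm:
  fixes y :: "'a::euclidean_space"
  assumes C: "compact C" "convex C"
    and p0: "p0 \<in> C" "\<And>q. q \<in> C \<Longrightarrow> y \<bullet> q \<le> y \<bullet> p0"
    and min: "\<And>q. q \<in> C \<Longrightarrow> y \<bullet> q = y \<bullet> p0 \<Longrightarrow> norm p0 \<le> norm q"
    and d: "d > 0"
  obtains \<alpha> l0 where "\<alpha> > 0" "l0 > 0"
    "\<And>l w. 0 < l \<Longrightarrow> l \<le> l0 \<Longrightarrow> norm w \<le> \<alpha> * l \<Longrightarrow> norm (closest_point C ((y + w) /\<^sub>R l) - p0) < d"
proof -
  obtain l0 where l0: "l0 > 0"
    "\<And>l. 0 < l \<Longrightarrow> l \<le> l0 \<Longrightarrow> norm (closest_point C (y /\<^sub>R l) - p0) < d / 2"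
    using closest_point_tendsto_min_norm[OF C p0 min half_gt_zero[OF d]] by blast
  \<comment> \<open>The budget d is split evenly between the bias caused by l and the displacement
    norm w / l of the rescaled noise, which gives \<alpha> = d / 2.\<close>
  show thesis
  proof (rule that[of "d / 2" l0])
    fix l and w :: 'a assume l: "0 < l" "l \<le> l0" "norm w \<le> d / 2 * l"
    have "dist (closest_point C ((y + w) /\<^sub>R l)) (closest_point C (y /\<^sub>R l)) \<le> dist ((y + w) /\<^sub>R l) (y /\<^sub>R l)"
      using C p0(1) by (intro closest_point_lipschitz) (auto intro: compact_imp_closed)
    also have "\<dots> = norm w / l"
      using l(1) by (simp add: dist_norm scaleR_add_right divide_inverse)
    also have "\<dots> \<le> d / 2"
      using l by (simp add: field_simps)
    finally show "norm (closest_point C ((y + w) /\<^sub>R l) - p0) < d"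
      using l0(2)[OF l(1,2)] dist_triangle[of "closest_point C ((y + w) /\<^sub>R l)" p0 "closest_point C (y /\<^sub>R l)"]
      by (simp add: dist_norm)
  qed (use d l0 in auto)
qed

section \<open>Topology of the torus\<close>

lemma dist_to_torus: "dist (to_torus s) (to_torus t) = \<bar>(s - t) - of_int (round (s - t))\<bar>"
  by (simp add: dist_torus.abs_eq)

lemma dist_to_torus_le: "dist (to_torus s) (to_torus t) \<le> \<bar>s - t\<bar>"
  using round_dist_le[of "s - t" 0] by (simp add: dist_to_torus)

lemma to_torus_torus_rep [simp]: "to_torus (torus_rep x) = x"
  by (rule Quotient3_abs_rep[OF Quotient3_torus])

lemma to_torus_add_int: "to_torus (t + of_int k) = to_torus t"
  by (simp add: torus.abs_eq_iff)

text \<open>Shifting the representative by the integer nearest to its difference from t realizes the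
  torus distance on the line. Local arguments on the torus are moved to an interval around t in this
  way.\<close>

lemma torus_near_lift:
  obtains s where "to_torus s = x" "\<bar>s - t\<bar> = dist x (to_torus t)"
proof -
  let ?r = "torus_rep x"
  have "to_torus (?r - of_int (round (?r - t))) = x"
    using to_torus_add_int[of ?r "- round (?r - t)"] by simp
  moreover have "\<bar>?r - of_int (round (?r - t)) - t\<bar> = dist x (to_torus t)"
    using dist_to_torus[of ?r t] by (simp add: algebra_simps)
  ultimately show thesis
    using that by blast
qed

lemma continuous_on_to_torus: "continuous_on S to_torus"
  unfolding continuous_on_iff
proof (intro ballI allI impI)
  fix s e :: real assume "e > 0"
  then show "\<exists>d>0. \<forall>t\<in>S. dist t s < d \<longrightarrow> dist (to_torus t) (to_torus s) < e"
    using le_less_trans[OF dist_to_torus_le] by (intro exI[of _ e]) (simp add: dist_real_def)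
qed

lemma compact_UNIV_torus: "compact (UNIV :: torus set)"
proof -
  have "x \<in> to_torus ` {-1..1}" for x
  proof -
    obtain s where s: "to_torus s = x" "\<bar>s - 0\<bar> = dist x (to_torus 0)"
      by (rule torus_near_lift)
    have "dist x (to_torus 0) \<le> 1"
      using dist_to_torus[of "torus_rep x" 0] of_int_round_abs_le[of "torus_rep x"]
      by (simp add: abs_minus_commute)
    then show ?thesis
      using s by (auto simp: image_iff abs_le_iff intro!: bexI[of _ s])
  qed
  then have "UNIV = to_torus ` {-1..1}"
    by blast
  then show ?thesis
    by (metis compact_continuous_image[OF continuous_on_to_torus] compact_Icc)
qed

lemma continuous_torusI:
  fixes f :: "torus \<Rightarrow> 'a::metric_space"
  assumes "continuous_on UNIV (f \<circ> to_torus)"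
  shows "continuous_on UNIV f"
  unfolding continuous_on_iff
proof (intro ballI allI impI)
  fix x and e :: real assume "e > 0"
  then obtain d where d: "d > 0"
    "\<And>s. \<bar>s - torus_rep x\<bar> < d \<Longrightarrow> dist (f (to_torus s)) (f (to_torus (torus_rep x))) < e"
    using assms unfolding continuous_on_iff dist_real_def o_def by (metis UNIV_I)
  have "dist (f y) (f x) < e" if "dist y x < d" for y
  proof -
    obtain s where "to_torus s = y" "\<bar>s - torus_rep x\<bar> = dist y (to_torus (torus_rep x))"
      by (rule torus_near_lift)
    then show ?thesis
      using d(2)[of s] that by simp
  qed
  then show "\<exists>d>0. \<forall>y\<in>UNIV. dist y x < d \<longrightarrow> dist (f y) (f x) < e"
    using d(1) by blast
qed

lemma torus_bounded:
  fixes f :: "torus \<Rightarrow> real"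
  assumes "continuous_on UNIV f"
  obtains K where "K > 0" "\<And>x. \<bar>f x\<bar> \<le> K"
proof -
  have "bounded (range f)"
    using compact_continuous_image[OF assms compact_UNIV_torus] by (rule compact_imp_bounded)
  then show thesis
    using that unfolding bounded_pos by auto
qed

section \<open>Variation and integration of signed Radon measures\<close>

text \<open>A constant series converges only if its term is 0.\<close>

lemma signed_radon_empty:
  assumes "signed_radon m"
  shows "m {} = 0"
proof -
  have "(\<lambda>n::nat. m {}) sums m (\<Union>n::nat. {})"
    using assms by (intro signed_radonD(2)) (auto simp: disjoint_family_on_def)
  then show ?thesis
    using summable_LIMSEQ_zero[of "\<lambda>n::nat. m {}"] by (simp add: sums_iff LIMSEQ_const_iff)
qed

lemma signed_radon_Un:
  assumes m: "signed_radon m" and AB: "A \<in> sets borel" "B \<in> sets borel" "A \<inter> B = {}"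
  shows "m (A \<union> B) = m A + m B"
proof -
  have "(\<lambda>n. m (binaryset A B n)) sums m (\<Union>n. binaryset A B n)"
    using AB by (intro signed_radonD(2)[OF m]) (auto simp: binaryset_def disjoint_family_on_def)
  moreover have "(\<lambda>n. m (binaryset A B n)) sums (m A + m B)"
    by (rule binaryset_sums) (simp add: signed_radon_empty[OF m])
  ultimately show ?thesis
    by (simp add: UN_binaryset_eq sums_unique2)
qed

lemma bdd_above_signed_radon:
  assumes "signed_radon m" "A \<in> sets borel"
  shows "bdd_above (partition_sums m A)"
  by (rule bdd_above_partition_sums[OF signed_radonD(3)[OF assms(1)] assms(2)])

text \<open>Intersecting the pieces with \<open>A\<close> and discarding empty intersections, which
  have mass 0, gives a partition of \<open>A\<close>. Letting \<open>P\<close> partition a larger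
  set \<open>X\<close> allows one partition of a countable union to be compared with the variation
  on each member.\<close>

lemma partition_sum_le_variation:
  assumes m: "signed_radon m" and A: "A \<in> sets borel" "A \<subseteq> X"
    and P: "finite P" "P \<subseteq> sets borel" "partition_on X P"
  shows "(\<Sum>B\<in>P. \<bar>m (B \<inter> A)\<bar>) \<le> variation m A"
proof -
  let ?Q = "{B\<in>P. B \<inter> A \<noteq> {}}"
  have "(\<Sum>B\<in>P. \<bar>m (B \<inter> A)\<bar>) = (\<Sum>B\<in>?Q. \<bar>m (B \<inter> A)\<bar>)"
    using P(1) signed_radon_empty[OF m] by (intro sum.mono_neutral_right) auto
  also have "\<dots> = (\<Sum>B\<in>(\<lambda>B. B \<inter> A) ` ?Q. \<bar>m B\<bar>)"
  proof (rule sum.reindex_cong[symmetric, OF _ refl refl])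
    show "inj_on (\<lambda>B. B \<inter> A) ?Q"
    proof (rule inj_onI)
      fix B C assume BC: "B \<in> ?Q" "C \<in> ?Q" "B \<inter> A = C \<inter> A"
      then have "B \<inter> C \<noteq> {}"
        by blast
      then show "B = C"
        using BC(1,2) disjointD[OF partition_onD2[OF P(3)]] by blast
    qed
  qed
  also have "\<dots> \<le> variation m A"
    unfolding variation_def
  proof (rule cSup_upper[OF _ bdd_above_signed_radon[OF m A(1)]])
    have "partition_on A ((\<lambda>B. B \<inter> A) ` ?Q)"
    proof -
      have "(\<inter>) A ` P - {{}} = (\<lambda>B. B \<inter> A) ` ?Q"
        by (auto simp: Int_commute)
      then show ?thesis
        using partition_on_restrict[OF P(3), of A] A(2) by (simp add: Int_absorb2)
    qed
    then show "(\<Sum>B\<in>(\<lambda>B. B \<inter> A) ` ?Q. \<bar>m B\<bar>) \<in> partition_sums m A"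
      unfolding partition_sums_def using P(1,2) A(1)
      by (intro CollectI exI[of _ "(\<lambda>B. B \<inter> A) ` ?Q"]) auto
  qed
  finally show ?thesis .
qed

lemma abs_le_variation:
  assumes m: "signed_radon m" and A: "A \<in> sets borel"
  shows "\<bar>m A\<bar> \<le> variation m A"
proof (cases "A = {}")
  case True
  have "(\<Sum>B\<in>{}. \<bar>m (B \<inter> A)\<bar>) \<le> variation m A"
    using True by (intro partition_sum_le_variation[OF m A, of "{}"]) (auto simp: partition_on_def)
  then show ?thesis
    using True signed_radon_empty[OF m] by simp
next
  case False
  then have "(\<Sum>B\<in>{A}. \<bar>m (B \<inter> A)\<bar>) \<le> variation m A"
    using A by (intro partition_sum_le_variation[OF m A order_refl]) (auto simp: partition_on_def)
  then show ?thesis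
    by simp
qed

lemma variation_least:
  assumes "A \<in> sets borel"
    "\<And>P. finite P \<Longrightarrow> P \<subseteq> sets borel \<Longrightarrow> partition_on A P \<Longrightarrow> (\<Sum>B\<in>P. \<bar>m B\<bar>) \<le> K"
  shows "variation m A \<le> K"
  unfolding variation_def
  by (rule cSup_least[OF partition_sums_nonempty[OF assms(1)]])
    (use assms(2) in \<open>auto simp: partition_sums_def\<close>)

text \<open>A partition of \<open>A\<close> and one of \<open>B\<close> combine to one of the union,
  and disjointness ensures that they share no piece. The two suprema are then taken one after the
  other.\<close>

lemma variation_superadditive:
  assumes m: "signed_radon m" and AB: "A \<in> sets borel" "B \<in> sets borel" "A \<inter> B = {}"
  shows "variation m A + variation m B \<le> variation m (A \<union> B)"
proof -
  have add: "(\<Sum>C\<in>P. \<bar>m C\<bar>) + (\<Sum>C\<in>Q. \<bar>m C\<bar>) \<le> variation m (A \<union> B)"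
    if P: "finite P" "P \<subseteq> sets borel" "partition_on A P"
      and Q: "finite Q" "Q \<subseteq> sets borel" "partition_on B Q" for P Q
  proof -
    have PQ: "\<Union>P = A" "\<Union>Q = B" "{} \<notin> P" "{} \<notin> Q" "disjoint P" "disjoint Q"
      using P(3) Q(3) by (auto simp: partition_on_def)
    have "P \<inter> Q = {}"
    proof (rule ccontr)
      assume "P \<inter> Q \<noteq> {}"
      then obtain C where "C \<in> P" "C \<in> Q"
        by blast
      then have "C \<subseteq> A \<inter> B"
        using PQ(1,2) by blast
      then show False
        using \<open>C \<in> P\<close> PQ(3) AB(3) by simp
    qed
    moreover have "partition_on (A \<union> B) (P \<union> Q)"
      unfolding partition_on_def
    proof (intro conjI)
      show "disjoint (P \<union> Q)"
        using PQ AB(3) by (intro disjoint_union) simp_all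
    qed (use PQ in auto)
    moreover have "(\<Sum>C\<in>P \<union> Q. \<bar>m (C \<inter> (A \<union> B))\<bar>) = (\<Sum>C\<in>P \<union> Q. \<bar>m C\<bar>)"
    proof (intro sum.cong refl)
      fix C assume "C \<in> P \<union> Q"
      then have "C \<inter> (A \<union> B) = C"
        using PQ(1,2) by blast
      then show "\<bar>m (C \<inter> (A \<union> B))\<bar> = \<bar>m C\<bar>"
        by simp
    qed
    ultimately show ?thesis
      using partition_sum_le_variation[OF m _ order_refl, of "A \<union> B" "P \<union> Q"] P(1,2) Q(1,2) AB(1,2)
      by (simp add: sum.union_disjoint)
  qed
  have "variation m A \<le> variation m (A \<union> B) - variation m B"
  proof (rule variation_least[OF AB(1)])
    fix P assume P: "finite P" "P \<subseteq> sets borel" "partition_on A P"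
    have "variation m B \<le> variation m (A \<union> B) - (\<Sum>C\<in>P. \<bar>m C\<bar>)"
      by (rule variation_least[OF AB(2)]) (use add[OF P] in fastforce)
    then show "(\<Sum>C\<in>P. \<bar>m C\<bar>) \<le> variation m (A \<union> B) - variation m B"
      by simp
  qed
  then show ?thesis
    by simp
qed

lemma variation_empty:
  assumes "signed_radon m"
  shows "variation m {} = 0"
  using variation_superadditive[OF assms, of "{}" "{}"] abs_le_variation[OF assms, of "{}"] by simp

text \<open>One inequality is finite superadditivity and monotonicity in the limit. For the other,
  each piece of a partition of the union is cut along the \<open>F n\<close> by countable additivity
  of \<open>m\<close>, the finite and the infinite sum are exchanged, and the cut pieces inside
  \<open>F n\<close> are bounded by its variation.\<close>

lemma variation_sums:
  fixes F :: "nat \<Rightarrow> torus set"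
  assumes m: "signed_radon m" and F: "range F \<subseteq> sets borel" "disjoint_family F"
  shows "(\<lambda>n. variation m (F n)) sums variation m (\<Union>n. F n)"
proof -
  let ?V = "variation m"
  note bdd = signed_radonD(3)[OF m]
  have F': "F n \<in> sets borel" for n
    using F(1) by auto
  then have UF: "(\<Union>n. F n) \<in> sets borel"
    by auto
  have nonneg: "0 \<le> ?V (F n)" for n
    using abs_le_variation[OF m F'[of n]] by simp
  have fin: "(\<Sum>n<k. ?V (F n)) \<le> ?V (\<Union>n<k. F n)" for k
  proof (induction k)
    case 0
    then show ?case
      by (simp add: variation_empty[OF m])
  next
    case (Suc k)
    have "?V (\<Union>n<k. F n) + ?V (F k) \<le> ?V ((\<Union>n<k. F n) \<union> F k)"
    proof (rule variation_superadditive[OF m])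
      show "(\<Union>n<k. F n) \<inter> F k = {}"
      proof -
        have "F n \<inter> F k = {}" if "n < k" for n
          using disjoint_family_onD[OF F(2), of n k] that by simp
        then show ?thesis
          by blast
      qed
    qed (use F' in auto)
    moreover have "(\<Union>n<Suc k. F n) = (\<Union>n<k. F n) \<union> F k"
      by (auto simp: less_Suc_eq)
    ultimately show ?case
      using Suc by simp
  qed
  also have "?V (\<Union>n<k. F n) \<le> ?V (\<Union>n. F n)" for k
    using F' UF by (intro variation_mono[OF bdd]) auto
  finally have part: "(\<Sum>n<k. ?V (F n)) \<le> ?V (\<Union>n. F n)" for k .
  have summ: "summable (\<lambda>n. ?V (F n))"
    by (rule summableI_nonneg_bounded[OF nonneg part])
  have le: "(\<Sum>n. ?V (F n)) \<le> ?V (\<Union>n. F n)"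
    by (rule suminf_le_const[OF summ part])
  have "?V (\<Union>n. F n) \<le> (\<Sum>n. ?V (F n))"
  proof (rule variation_least[OF UF])
    fix P assume P: "finite P" "P \<subseteq> sets borel" "partition_on (\<Union>n. F n) P"
    have B: "summable (\<lambda>n. \<bar>m (B \<inter> F n)\<bar>) \<and> \<bar>m B\<bar> \<le> (\<Sum>n. \<bar>m (B \<inter> F n)\<bar>)" if "B \<in> P" for B
    proof -
      have Bb: "B \<in> sets borel"
        using that P(2) by blast
      have BU: "B = (\<Union>n. B \<inter> F n)"
        using P(3) that by (auto simp: partition_on_def)
      have "\<bar>m (B \<inter> F n)\<bar> \<le> ?V (F n)" for n
        using Bb F' abs_le_variation[OF m, of "B \<inter> F n"] variation_mono[OF bdd, of "B \<inter> F n" "F n"]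
        by fastforce
      then have s: "summable (\<lambda>n. \<bar>m (B \<inter> F n)\<bar>)"
        by (intro summable_comparison_test[OF _ summ]) auto
      have "(\<lambda>n. m (B \<inter> F n)) sums m (\<Union>n. B \<inter> F n)"
        using Bb F' F(2) by (intro signed_radonD(2)[OF m]) (auto simp: disjoint_family_on_def)
      then have "m B = (\<Sum>n. m (B \<inter> F n))"
        using BU by (simp add: sums_iff)
      then show ?thesis
        using summable_rabs[OF s] s by simp
    qed
    then have "(\<Sum>B\<in>P. \<bar>m B\<bar>) \<le> (\<Sum>B\<in>P. \<Sum>n. \<bar>m (B \<inter> F n)\<bar>)"
      by (intro sum_mono) blast
    also have "\<dots> = (\<Sum>n. \<Sum>B\<in>P. \<bar>m (B \<inter> F n)\<bar>)"
      using B by (intro suminf_sum[symmetric]) blast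
    also have "\<dots> \<le> (\<Sum>n. ?V (F n))"
    proof (rule suminf_le[OF _ _ summ])
      show "(\<Sum>B\<in>P. \<bar>m (B \<inter> F n)\<bar>) \<le> ?V (F n)" for n
        using F' P by (intro partition_sum_le_variation[OF m]) auto
      show "summable (\<lambda>n. \<Sum>B\<in>P. \<bar>m (B \<inter> F n)\<bar>)"
        using B by (intro summable_sum) blast
    qed
    finally show "(\<Sum>B\<in>P. \<bar>m B\<bar>) \<le> (\<Sum>n. ?V (F n))" .
  qed
  with le summ show ?thesis
    by (simp add: sums_iff)
qed

section \<open>The Jordan parts as measures and the integral against a signed measure\<close>

text \<open>\<open>measure_of\<close> silently yields the zero measure unless the set function is
  positive and countably additive, so the Jordan parts have their intended values only after this
  check.\<close>

lemma emeasure_measure_of_real_sums: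
  fixes g :: "torus set \<Rightarrow> real"
  assumes nonneg: "\<And>A. A \<in> sets borel \<Longrightarrow> 0 \<le> g A"
    and sums: "\<And>F :: nat \<Rightarrow> torus set. range F \<subseteq> sets borel \<Longrightarrow> disjoint_family F \<Longrightarrow>
      (\<lambda>n. g (F n)) sums g (\<Union>n. F n)"
    and A: "A \<in> sets borel"
  shows "emeasure (measure_of UNIV (sets borel) (\<lambda>A. ennreal (g A))) A = ennreal (g A)"
proof (rule emeasure_measure_of_sigma)
  show "sigma_algebra UNIV (sets (borel :: torus measure))"
    using sets.sigma_algebra_axioms[of "borel :: torus measure"] by simp
  have "g {} = 0"
    using sums[of "\<lambda>_. {}"] summable_LIMSEQ_zero[of "\<lambda>n::nat. g {}"]
    by (auto simp: sums_iff LIMSEQ_const_iff disjoint_family_on_def)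
  then show "positive (sets borel) (\<lambda>A. ennreal (g A))"
    by (simp add: positive_def)
  show "countably_additive (sets borel) (\<lambda>A. ennreal (g A))"
  proof (rule countably_additiveI)
    fix F :: "nat \<Rightarrow> torus set"
    assume F: "range F \<subseteq> sets borel" "disjoint_family F"
    have "(\<lambda>n. ennreal (g (F n))) sums ennreal (g (\<Union>n. F n))"
      using sums[OF F] nonneg F(1) by (subst sums_ennreal) auto
    then show "(\<Sum>n. ennreal (g (F n))) = ennreal (g (\<Union>n. F n))"
      by (simp add: sums_iff)
  qed
qed (rule A)

lemma sets_pos_neg_measure [simp, measurable_cong]:
  "sets (pos_measure \<mu>) = sets borel" "sets (neg_measure \<mu>) = sets borel"
  "space (pos_measure \<mu>) = UNIV" "space (neg_measure \<mu>) = UNIV"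
  unfolding pos_measure_def neg_measure_def
  using sigma_algebra.sigma_sets_eq[OF sets.sigma_algebra_axioms[of "borel :: torus measure"]]
  by simp_all

lemma variation_pos_neg_bounds:
  assumes "A \<in> sets borel"
  shows "0 \<le> variation (meas \<mu>) A + meas \<mu> A" "0 \<le> variation (meas \<mu>) A - meas \<mu> A"
  using abs_le_variation[OF signed_radon_meas assms, of \<mu>] by auto

lemma emeasure_pos_neg:
  assumes A: "A \<in> sets borel"
  shows "emeasure (pos_measure \<mu>) A = ennreal ((variation (meas \<mu>) A + meas \<mu> A) / 2)"
    and "emeasure (neg_measure \<mu>) A = ennreal ((variation (meas \<mu>) A - meas \<mu> A) / 2)"
proof -
  note S = variation_sums[OF signed_radon_meas] signed_radonD(2)[OF signed_radon_meas]
  show "emeasure (pos_measure \<mu>) A = ennreal ((variation (meas \<mu>) A + meas \<mu> A) / 2)"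
    unfolding pos_measure_def
    by (rule emeasure_measure_of_real_sums[OF _ _ A])
      (use variation_pos_neg_bounds S in \<open>auto intro!: sums_divide sums_add\<close>)
  show "emeasure (neg_measure \<mu>) A = ennreal ((variation (meas \<mu>) A - meas \<mu> A) / 2)"
    unfolding neg_measure_def
    by (rule emeasure_measure_of_real_sums[OF _ _ A])
      (use variation_pos_neg_bounds S in \<open>auto intro!: sums_divide sums_diff\<close>)
qed

lemma measure_pos_neg:
  assumes A: "A \<in> sets borel"
  shows "measure (pos_measure \<mu>) A = (variation (meas \<mu>) A + meas \<mu> A) / 2"
    and "measure (neg_measure \<mu>) A = (variation (meas \<mu>) A - meas \<mu> A) / 2"
  using variation_pos_neg_bounds[OF A, of \<mu>]
  by (simp_all add: measure_def emeasure_pos_neg[OF A])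

lemma finite_measure_pos_neg: "finite_measure (pos_measure \<mu>)" "finite_measure (neg_measure \<mu>)"
  by (auto intro!: finite_measureI simp: emeasure_pos_neg)

lemma integrable_bounded_borel:
  fixes f :: "torus \<Rightarrow> real"
  assumes M: "finite_measure M" "sets M = sets borel" and f: "f \<in> borel_measurable borel" "\<And>x. \<bar>f x\<bar> \<le> K"
  shows "integrable M f"
  by (rule finite_measure.integrable_const_bound[OF M(1), of _ K])
    (use f measurable_cong_sets[OF M(2) refl, of borel] in auto)

lemma floor_level_set_borel:
  fixes f :: "torus \<Rightarrow> real"
  assumes "f \<in> borel_measurable borel"
  shows "{x. \<lfloor>real (Suc k) * f x\<rfloor> = j} \<in> sets borel"
proof -
  have "{x \<in> space borel. of_int j \<le> real (Suc k) * f x \<and> real (Suc k) * f x < of_int j + 1} \<in> sets borel"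
    using assms by measurable
  then show ?thesis
    by (simp add: floor_eq_iff)
qed

text \<open>The approximants see the measure only through its values on level sets, which makes the
  integral linear in the measure in the limit.\<close>

lemma integral_simple_approx:
  fixes f :: "torus \<Rightarrow> real"
  assumes M: "finite_measure M" "sets M = sets borel"
    and f: "f \<in> borel_measurable borel" "\<And>x. \<bar>f x\<bar> \<le> of_int K"
  shows "(\<lambda>k. \<Sum>j\<in>{- (int (Suc k) * K) - 1..int (Suc k) * K}.
      of_int j / real (Suc k) * measure M {x. \<lfloor>real (Suc k) * f x\<rfloor> = j}) \<longlonglongrightarrow> (\<integral>x. f x \<partial>M)"
proof -
  interpret finite_measure M by (rule M(1))
  have f': "f \<in> borel_measurable M"
    using f(1) measurable_cong_sets[OF M(2) refl] by blast
  have sp: "space M = UNIV"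
    using sets_eq_imp_space_eq[OF M(2)] by simp
  let ?J = "\<lambda>k. {- (int (Suc k) * K) - 1..int (Suc k) * K}"
  let ?A = "\<lambda>k j. {x. \<lfloor>real (Suc k) * f x\<rfloor> = j}"
  \<comment> \<open>\<open>?s k\<close> rounds f down to a multiple of 1 / (k + 1); it takes
    finitely many values, and its level sets are the \<open>?A k j\<close>.\<close>
  let ?s = "\<lambda>k x. of_int \<lfloor>real (Suc k) * f x\<rfloor> / real (Suc k)"
  have A: "?A k j \<in> sets M" for k j
    unfolding M(2) by (rule floor_level_set_borel[OF f(1)])
  have dist: "\<bar>?s k x - f x\<bar> \<le> 1 / real (Suc k)" for k x
  proof -
    have "\<bar>of_int \<lfloor>real (Suc k) * f x\<rfloor> - real (Suc k) * f x\<bar> \<le> 1"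
      by linarith
    then have "\<bar>of_int \<lfloor>real (Suc k) * f x\<rfloor> - real (Suc k) * f x\<bar> / real (Suc k) \<le> 1 / real (Suc k)"
      by (intro divide_right_mono) auto
    moreover have "?s k x - f x = (of_int \<lfloor>real (Suc k) * f x\<rfloor> - real (Suc k) * f x) / real (Suc k)"
      by (simp add: diff_divide_distrib del: of_nat_Suc)
    ultimately show ?thesis
      by (simp add: abs_divide del: of_nat_Suc)
  qed
  have in_J: "\<lfloor>real (Suc k) * f x\<rfloor> \<in> ?J k" for k x
  proof -
    have "real (Suc k) * \<bar>f x\<bar> \<le> real (Suc k) * of_int K"
      using f(2) by (intro mult_left_mono) auto
    then have "\<bar>real (Suc k) * f x\<bar> \<le> of_int (int (Suc k) * K)"
      by (simp add: abs_mult del: of_nat_Suc)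
    then show ?thesis
      by (simp add: floor_le_iff le_floor_iff abs_le_iff del: of_nat_Suc of_int_mult)
  qed
  have s_eq: "?s k x = (\<Sum>j\<in>?J k. of_int j / real (Suc k) * indicat_real (?A k j) x)" for k x
  proof -
    have "(\<Sum>j\<in>?J k. of_int j / real (Suc k) * indicat_real (?A k j) x) =
        (\<Sum>j\<in>?J k. if j = \<lfloor>real (Suc k) * f x\<rfloor> then ?s k x else 0)"
      by (intro sum.cong) (auto simp: indicator_def)
    then show ?thesis
      using in_J[of k x] by simp
  qed
  have int: "(\<integral>x. ?s k x \<partial>M) = (\<Sum>j\<in>?J k. of_int j / real (Suc k) * measure M (?A k j))" for k
  proof -
    have "integrable M (\<lambda>x. of_int j / real (Suc k) * indicat_real (?A k j) x)" for j
      by (intro integrable_mult_right integrable_real_indicator A) (simp add: emeasure_eq_measure)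
    then show ?thesis
      unfolding s_eq by (subst Bochner_Integration.integral_sum)
        (simp_all only: integral_mult_right_zero Bochner_Integration.integral_indicator sp Int_UNIV_right)
  qed
  \<comment> \<open>Rounding moves f by at most 1, so the constant K + 1 dominates every
    approximant; it is integrable because M is finite.\<close>
  have "(\<lambda>k. \<integral>x. ?s k x \<partial>M) \<longlonglongrightarrow> (\<integral>x. f x \<partial>M)"
  proof (rule integral_dominated_convergence[where w = "\<lambda>_. of_int K + 1"])
    show "?s k \<in> borel_measurable M" for k
      using f' by measurable
    show "AE x in M. (\<lambda>k. ?s k x) \<longlonglongrightarrow> f x"
    proof (rule AE_I2)
      fix x
      have "(\<lambda>k. ?s k x - f x) \<longlonglongrightarrow> 0"
        by (rule tendsto_0_le[OF LIMSEQ_inverse_real_of_nat, of _ 1])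
          (use dist in \<open>auto simp: inverse_eq_divide intro!: always_eventually\<close>)
      then show "(\<lambda>k. ?s k x) \<longlonglongrightarrow> f x"
        by (simp add: LIM_zero_iff)
    qed
    show "AE x in M. norm (?s k x) \<le> of_int K + 1" for k
    proof (rule AE_I2)
      fix x
      have "1 / real (Suc k) \<le> 1"
        by simp
      then show "norm (?s k x) \<le> of_int K + 1"
        using dist[of k x] f(2)[of x] unfolding real_norm_def by linarith
    qed
  qed (use f' in auto)
  then show ?thesis
    unfolding int .
qed

text \<open>On each level set the variation cancels between the two Jordan parts, and only the value
  of the signed measure remains.\<close>

lemma radon_integral_simple_approx:
  fixes f :: "torus \<Rightarrow> real"
  assumes f: "f \<in> borel_measurable borel" "\<And>x. \<bar>f x\<bar> \<le> of_int K"
  shows "(\<lambda>k. \<Sum>j\<in>{- (int (Suc k) * K) - 1..int (Suc k) * K}.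
      of_int j / real (Suc k) * meas \<mu> {x. \<lfloor>real (Suc k) * f x\<rfloor> = j}) \<longlonglongrightarrow> radon_integral \<mu> f"
proof -
  have eq: "meas \<mu> A = measure (pos_measure \<mu>) A - measure (neg_measure \<mu>) A" if "A \<in> sets borel" for A
    using that by (simp add: measure_pos_neg field_simps)
  show ?thesis
    unfolding radon_integral_def
    by (simp only: eq[OF floor_level_set_borel[OF f(1)]] right_diff_distrib sum_subtractf)
      (intro tendsto_diff integral_simple_approx f finite_measure_pos_neg sets_pos_neg_measure)
qed

lemma continuous_torus_bound:
  fixes f :: "torus \<Rightarrow> real"
  assumes "continuous_on UNIV f"
  obtains K :: int where "\<And>x. \<bar>f x\<bar> \<le> of_int K"
proof -
  obtain K where "\<And>x. \<bar>f x\<bar> \<le> K"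
    using torus_bounded[OF assms] by blast
  then have "\<bar>f x\<bar> \<le> of_int \<lceil>K\<rceil>" for x
    by (meson le_of_int_ceiling order_trans)
  then show thesis
    using that by blast
qed

text \<open>The variation is not additive in the measure, so the Jordan parts of a combination are
  not the combination of the Jordan parts. The level-set sums are linear in \<open>meas\<close>, and
  their limits are unique.\<close>

lemma radon_integral_lincomb:
  assumes f: "continuous_on UNIV f"
  shows "radon_integral (a *\<^sub>R \<mu> + b *\<^sub>R \<nu>) f = a * radon_integral \<mu> f + b * radon_integral \<nu> f"
proof -
  obtain K :: int where K: "\<And>x. \<bar>f x\<bar> \<le> of_int K"
    using continuous_torus_bound[OF f] by blast
  note L = radon_integral_simple_approx[OF borel_measurable_continuous_onI[OF f] K]
  have "(\<lambda>k. \<Sum>j\<in>{- (int (Suc k) * K) - 1..int (Suc k) * K}.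
      of_int j / real (Suc k) * meas (a *\<^sub>R \<mu> + b *\<^sub>R \<nu>) {x. \<lfloor>real (Suc k) * f x\<rfloor> = j})
      \<longlonglongrightarrow> a * radon_integral \<mu> f + b * radon_integral \<nu> f"
    unfolding meas_simps distrib_left sum.distrib mult.left_commute[of _ a] mult.left_commute[of _ b]
      sum_distrib_left[symmetric]
    by (intro tendsto_add tendsto_mult_left L)
  then show ?thesis
    using L LIMSEQ_unique by blast
qed

lemma radon_integral_add:
  "continuous_on UNIV f \<Longrightarrow> radon_integral (\<mu> + \<nu>) f = radon_integral \<mu> f + radon_integral \<nu> f"
  using radon_integral_lincomb[of f 1 \<mu> 1 \<nu>] by simp

lemma radon_integral_scaleR:
  "continuous_on UNIV f \<Longrightarrow> radon_integral (a *\<^sub>R \<mu>) f = a * radon_integral \<mu> f"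
  using radon_integral_lincomb[of f a \<mu> 0 \<mu>] by simp

lemma meas_dirac: "meas (dirac x) = dirac_fun x"
  by (simp add: dirac_def meas_Radon signed_radon_dirac)

text \<open>Avoids computing the variation of a Dirac measure: an ordinary point mass, the counting
  measure on a one-point space pushed forward to x, has the same values on Borel sets and hence the
  same level-set sums.\<close>

lemma radon_integral_dirac:
  assumes f: "continuous_on UNIV f"
  shows "radon_integral (dirac x) f = f x"
proof -
  obtain K :: int where K: "\<And>x. \<bar>f x\<bar> \<le> of_int K"
    using continuous_torus_bound[OF f] by blast
  note fb = borel_measurable_continuous_onI[OF f]
  interpret pm: finite_measure "distr (count_space {()}) borel (\<lambda>_. x)"
    by (rule finite_measureI) (simp add: emeasure_distr)
  let ?M = "distr (count_space {()}) borel (\<lambda>_. x)"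
  have M: "measure ?M A = meas (dirac x) A" if "A \<in> sets borel" for A
    using that by (subst measure_distr) (auto simp: meas_dirac dirac_fun_def measure_count_space)
  have "sets ?M = sets borel"
    by simp
  note I = integral_simple_approx[OF pm.finite_measure_axioms this fb K]
  have "radon_integral (dirac x) f = (\<integral>x. f x \<partial>?M)"
    by (rule LIMSEQ_unique[OF radon_integral_simple_approx[OF fb K] I[unfolded M[OF floor_level_set_borel[OF fb]]]])
  also have "\<dots> = f x"
    using fb by (subst integral_distr) (simp_all add: lebesgue_integral_count_space_finite)
  finally show ?thesis .
qed

lemma radon_integral_sum:
  fixes f :: "'i \<Rightarrow> torus \<Rightarrow> real"
  assumes "\<And>i. i \<in> I \<Longrightarrow> continuous_on UNIV (f i)"
  shows "radon_integral \<mu> (\<lambda>x. \<Sum>i\<in>I. c i * f i x) = (\<Sum>i\<in>I. c i * radon_integral \<mu> (f i))"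
proof -
  have int: "integrable M (f i)" if "i \<in> I" "finite_measure M" "sets M = sets borel" for M i
    using torus_bounded[OF assms[OF that(1)]]
      integrable_bounded_borel[OF that(2,3) borel_measurable_continuous_onI[OF assms[OF that(1)]]]
    by metis
  have "(\<integral>x. (\<Sum>i\<in>I. c i * f i x) \<partial>M) = (\<Sum>i\<in>I. c i * (\<integral>x. f i x \<partial>M))"
    if "finite_measure M" "sets M = sets borel" for M
    using int that by (subst Bochner_Integration.integral_sum) auto
  then show ?thesis
    by (simp add: radon_integral_def finite_measure_pos_neg right_diff_distrib sum_subtractf)
qed

lemma variation_eq_pos_neg:
  assumes "A \<in> sets borel"
  shows "variation (meas \<mu>) A = measure (pos_measure \<mu>) A + measure (neg_measure \<mu>) A"
  using assms by (simp add: measure_pos_neg field_simps)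

text \<open>Both integrands on the right are nonnegative, so this identity yields the dual bound for
  the total variation and describes its equality case.\<close>

lemma tv_norm_minus_radon_integral:
  assumes f: "continuous_on UNIV f" "\<And>x. \<bar>f x\<bar> \<le> 1"
  shows "tv_norm \<mu> - radon_integral \<mu> f =
    (\<integral>x. 1 - f x \<partial>pos_measure \<mu>) + (\<integral>x. 1 + f x \<partial>neg_measure \<mu>)"
proof -
  have int: "integrable M f" if "finite_measure M" "sets M = sets borel" for M
    using integrable_bounded_borel[OF that borel_measurable_continuous_onI[OF f(1)] f(2)] .
  interpret p: finite_measure "pos_measure \<mu>" by (rule finite_measure_pos_neg)
  interpret n: finite_measure "neg_measure \<mu>" by (rule finite_measure_pos_neg)
  show ?thesis
    using int[OF p.finite_measure_axioms] int[OF n.finite_measure_axioms]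
    by (simp add: tv_norm_def variation_eq_pos_neg radon_integral_def)
qed

lemma radon_integral_le_tv_norm:
  assumes f: "continuous_on UNIV f" "\<And>x. \<bar>f x\<bar> \<le> 1"
  shows "radon_integral \<mu> f \<le> tv_norm \<mu>"
proof -
  have "0 \<le> 1 - f x" "0 \<le> 1 + f x" for x
    using f(2)[of x] by (auto simp: abs_le_iff)
  then have "0 \<le> (\<integral>x. 1 - f x \<partial>pos_measure \<mu>)" "0 \<le> (\<integral>x. 1 + f x \<partial>neg_measure \<mu>)"
    by (auto intro!: Bochner_Integration.integral_nonneg)
  then show ?thesis
    using tv_norm_minus_radon_integral[OF f, of \<mu>] by simp
qed

text \<open>In the equality case two nonnegative integrals add up to 0, so f = 1 almost everywhere
  for the positive part and f = -1 for the negative part; a set on which |f| is never 1 is null for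
  both.\<close>

lemma meas_eq_0_off_saturation:
  assumes f: "continuous_on UNIV f" "\<And>x. \<bar>f x\<bar> \<le> 1"
    and eq: "radon_integral \<mu> f = tv_norm \<mu>"
    and A: "A \<in> sets borel" "\<And>x. x \<in> A \<Longrightarrow> \<bar>f x\<bar> \<noteq> 1"
  shows "meas \<mu> A = 0"
proof -
  have int: "integrable M f" if "finite_measure M" "sets M = sets borel" for M
    using integrable_bounded_borel[OF that borel_measurable_continuous_onI[OF f(1)] f(2)] .
  interpret p: finite_measure "pos_measure \<mu>" by (rule finite_measure_pos_neg)
  interpret n: finite_measure "neg_measure \<mu>" by (rule finite_measure_pos_neg)
  have f01: "0 \<le> 1 - f x" "0 \<le> 1 + f x" for x
    using f(2)[of x] by (auto simp: abs_le_iff)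
  have ip: "integrable (pos_measure \<mu>) (\<lambda>x. 1 - f x)" and ineg: "integrable (neg_measure \<mu>) (\<lambda>x. 1 + f x)"
    using int[OF p.finite_measure_axioms] int[OF n.finite_measure_axioms] by simp_all
  have "0 \<le> (\<integral>x. 1 - f x \<partial>pos_measure \<mu>)" "0 \<le> (\<integral>x. 1 + f x \<partial>neg_measure \<mu>)"
    using f01 by (auto intro!: Bochner_Integration.integral_nonneg)
  then have "(\<integral>x. 1 - f x \<partial>pos_measure \<mu>) = 0" "(\<integral>x. 1 + f x \<partial>neg_measure \<mu>) = 0"
    using tv_norm_minus_radon_integral[OF f, of \<mu>] eq by auto
  then have ae: "AE x in pos_measure \<mu>. 1 - f x = 0" "AE x in neg_measure \<mu>. 1 + f x = 0"
    using integral_nonneg_eq_0_iff_AE[OF ip] integral_nonneg_eq_0_iff_AE[OF ineg] f01 by auto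
  have "AE x in pos_measure \<mu>. x \<notin> A" "AE x in neg_measure \<mu>. x \<notin> A"
    using A(2) by (auto intro!: eventually_mono[OF ae(1)] eventually_mono[OF ae(2)])
      (metis abs_1 abs_minus_cancel add_eq_0_iff)+
  then have "emeasure (pos_measure \<mu>) A = 0" "emeasure (neg_measure \<mu>) A = 0"
    using emeasure_eq_0_AE[of "\<lambda>x. x \<in> A" "pos_measure \<mu>"]
      emeasure_eq_0_AE[of "\<lambda>x. x \<in> A" "neg_measure \<mu>"] by simp_all
  then have "measure (pos_measure \<mu>) A = 0" "measure (neg_measure \<mu>) A = 0"
    by (simp_all add: measure_def)
  then show ?thesis
    by (simp add: measure_pos_neg[OF A(1)])
qed

section \<open>Discrete measures and bounds for the total variation norm\<close>

lemma borel_finite_torus: "finite (F :: torus set) \<Longrightarrow> F \<in> sets borel"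
  by (simp add: borel_closed finite_imp_closed)

lemma meas_sum: "meas (\<Sum>i\<in>I. \<mu> i) A = (\<Sum>i\<in>I. meas (\<mu> i) A)"
  by (induction I rule: infinite_finite_induct) (simp_all add: meas_simps)

lemma radon_eq_sum_dirac:
  assumes F: "finite F"
    and null: "\<And>A. A \<in> sets borel \<Longrightarrow> A \<inter> F = {} \<Longrightarrow> meas \<mu> A = 0"
  shows "\<mu> = (\<Sum>x\<in>F. meas \<mu> {x} *\<^sub>R dirac x)"
proof -
  note sr = signed_radon_meas[of \<mu>]
  have fin: "meas \<mu> G = (\<Sum>x\<in>G. meas \<mu> {x})" if "finite G" for G
    using that
  proof (induction G rule: finite_induct)
    case empty
    then show ?case
      by (simp add: signed_radon_empty[OF sr])
  next
    case (insert x G)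
    then show ?case
      using signed_radon_Un[OF sr, of "{x}" G] by (simp add: borel_finite_torus)
  qed
  have "meas \<mu> A = meas (\<Sum>x\<in>F. meas \<mu> {x} *\<^sub>R dirac x) A" for A
  proof (cases "A \<in> sets borel")
    case True
    have "meas \<mu> ((A - F) \<union> (A \<inter> F)) = meas \<mu> (A - F) + meas \<mu> (A \<inter> F)"
      using F True by (intro signed_radon_Un[OF sr]) (auto simp: borel_finite_torus)
    moreover have "meas \<mu> (A - F) = 0"
      using F True by (intro null) (auto simp: borel_finite_torus)
    ultimately have "meas \<mu> A = meas \<mu> (A \<inter> F)"
      by (simp add: Un_Diff_Int)
    also have "\<dots> = (\<Sum>x\<in>A \<inter> F. meas \<mu> {x})"
      using F by (intro fin) simp
    also have "\<dots> = (\<Sum>x\<in>F. meas \<mu> {x} * dirac_fun x A)"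
      using F True by (intro sum.mono_neutral_cong_left) (auto simp: dirac_fun_def)
    finally show ?thesis
      by (simp add: meas_sum meas_simps meas_dirac)
  next
    case False
    then show ?thesis
      using signed_radonD(1)[OF signed_radon_meas] by simp
  qed
  then have "meas \<mu> = meas (\<Sum>x\<in>F. meas \<mu> {x} *\<^sub>R dirac x)"
    by (rule ext)
  then show ?thesis
    by (simp only: meas_inject)
qed

lemma variation_lincomb_le:
  assumes f: "signed_radon f" and g: "signed_radon g" and A: "A \<in> sets borel"
  shows "variation (\<lambda>A. a * f A + b * g A) A \<le> \<bar>a\<bar> * variation f A + \<bar>b\<bar> * variation g A"
  unfolding variation_def[of "\<lambda>A. a * f A + b * g A"]
proof (rule cSup_least[OF partition_sums_nonempty[OF A]])
  fix s assume "s \<in> partition_sums (\<lambda>A. a * f A + b * g A) A"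
  then obtain t u where tu: "t \<in> partition_sums f A" "u \<in> partition_sums g A" "s \<le> \<bar>a\<bar> * t + \<bar>b\<bar> * u"
    using partition_sums_add by blast
  have "t \<le> variation f A" "u \<le> variation g A"
    unfolding variation_def using tu bdd_above_signed_radon[OF f A] bdd_above_signed_radon[OF g A]
    by (auto intro: cSup_upper)
  then have "\<bar>a\<bar> * t + \<bar>b\<bar> * u \<le> \<bar>a\<bar> * variation f A + \<bar>b\<bar> * variation g A"
    by (intro add_mono mult_left_mono) auto
  with tu(3) show "s \<le> \<bar>a\<bar> * variation f A + \<bar>b\<bar> * variation g A"
    by simp
qed

lemma tv_norm_lincomb_le: "tv_norm (a *\<^sub>R \<mu> + b *\<^sub>R \<nu>) \<le> \<bar>a\<bar> * tv_norm \<mu> + \<bar>b\<bar> * tv_norm \<nu>"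
  unfolding tv_norm_def meas_simps
  by (rule variation_lincomb_le) (auto simp: signed_radon_meas)

lemma tv_norm_dirac_le: "tv_norm (dirac x) \<le> 1"
  unfolding tv_norm_def meas_dirac variation_def
  by (rule cSup_least[OF partition_sums_nonempty]) (use partition_sums_dirac_le[of _ x UNIV] in auto)

lemma tv_norm_zero: "tv_norm 0 = 0"
proof -
  have "partition_sums (\<lambda>_. 0) UNIV = {0}"
    using partition_sums_zero[of UNIV] partition_sums_nonempty[of UNIV "\<lambda>_. 0"] by auto
  then show ?thesis
    by (simp add: tv_norm_def variation_def meas_simps)
qed

text \<open>Points may repeat and their masses may cancel, so in general only an upper bound
  holds.\<close>

lemma tv_norm_sum_dirac_le: "tv_norm (\<Sum>i\<in>I. c i *\<^sub>R dirac (x i)) \<le> (\<Sum>i\<in>I. \<bar>c i\<bar>)"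
proof (induction I rule: infinite_finite_induct)
  case (insert i I)
  have "tv_norm (c i *\<^sub>R dirac (x i) + 1 *\<^sub>R (\<Sum>i\<in>I. c i *\<^sub>R dirac (x i)))
      \<le> \<bar>c i\<bar> * tv_norm (dirac (x i)) + \<bar>1\<bar> * tv_norm (\<Sum>i\<in>I. c i *\<^sub>R dirac (x i))"
    by (rule tv_norm_lincomb_le)
  moreover have "\<bar>c i\<bar> * tv_norm (dirac (x i)) \<le> \<bar>c i\<bar>"
    using tv_norm_dirac_le[of "x i"] by (simp add: mult_left_le)
  ultimately show ?case
    using insert by simp
qed (simp_all add: tv_norm_zero)

section \<open>Stability of the active constraints\<close>

text \<open>Compactness leaves a margin between b and the maximum over \<open>S\<close> at p0;
  divided by a bound for |\<Psi>|, it is a radius that works for all x at once by Cauchy-Schwarz.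
  The filter form lets finitely many such conditions be intersected.\<close>

lemma eventually_compact_less:
  fixes \<Psi> :: "'b::topological_space \<Rightarrow> 'a::real_inner"
  assumes S: "compact S" and \<Psi>: "continuous_on S \<Psi>" and less: "\<And>x. x \<in> S \<Longrightarrow> p0 \<bullet> \<Psi> x < b"
  shows "\<forall>\<^sub>F p in nhds p0. \<forall>x\<in>S. p \<bullet> \<Psi> x < b"
proof (cases "S = {}")
  case False
  have "continuous_on S (\<lambda>x. p0 \<bullet> \<Psi> x)"
    by (intro continuous_intros \<Psi>)
  then obtain x1 where x1: "x1 \<in> S" "\<And>x. x \<in> S \<Longrightarrow> p0 \<bullet> \<Psi> x \<le> p0 \<bullet> \<Psi> x1"
    using continuous_attains_sup[OF S False] by blast
  obtain B where B: "B > 0" "\<And>x. x \<in> S \<Longrightarrow> norm (\<Psi> x) \<le> B"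
    using compact_imp_bounded[OF compact_continuous_image[OF \<Psi> S]] unfolding bounded_pos by auto
  have "0 < (b - p0 \<bullet> \<Psi> x1) / B"
    using less[OF x1(1)] B(1) by simp
  then have "\<forall>\<^sub>F p in nhds p0. dist p p0 < (b - p0 \<bullet> \<Psi> x1) / B"
    by (auto simp: eventually_nhds_metric)
  then show ?thesis
  proof (rule eventually_mono, intro ballI)
    fix p x assume p: "dist p p0 < (b - p0 \<bullet> \<Psi> x1) / B" and x: "x \<in> S"
    have "(p - p0) \<bullet> \<Psi> x \<le> norm (p - p0) * norm (\<Psi> x)"
      by (rule norm_cauchy_schwarz)
    also have "\<dots> \<le> norm (p - p0) * B"
      by (intro mult_left_mono B x) simp
    also have "\<dots> < b - p0 \<bullet> \<Psi> x1"
      using p B(1) by (simp add: dist_norm field_simps)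
    finally show "p \<bullet> \<Psi> x < b"
      using x1(2)[OF x] by (simp add: inner_diff_left)
  qed
qed simp

text \<open>The image under K of the Dirac measure at x; pairing it with p evaluates the function
  component of K_* p at x.\<close>

definition feature :: "('N::finite \<Rightarrow> torus \<Rightarrow> real) \<Rightarrow> torus \<Rightarrow> real^'N" where
  "feature \<phi> x = (\<chi> k. \<phi> k x)"

text \<open>The argument is a real number because the derivatives are those of the periodic lift and
  their sign is needed on intervals of the line.\<close>

definition feature2 :: "('N::finite \<Rightarrow> torus \<Rightarrow> real) \<Rightarrow> real \<Rightarrow> real^'N" where
  "feature2 \<phi> t = (\<chi> k. deriv (deriv (\<phi> k \<circ> to_torus)) t)"

lemma inner_feature: "p \<bullet> feature \<phi> x = (\<Sum>k\<in>UNIV. p $ k * \<phi> k x)"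
  by (simp add: inner_vec_def feature_def)

lemma torus_C2_continuous:
  assumes "torus_C2 f"
  shows "continuous_on UNIV f"
proof (rule continuous_torusI)
  show "continuous_on UNIV (f \<circ> to_torus)"
    using assms differentiable_imp_continuous_within
    unfolding torus_C2_def continuous_on_eq_continuous_at[OF open_UNIV] by blast
qed

lemma continuous_feature:
  assumes "\<And>k. continuous_on UNIV (\<phi> k)"
  shows "continuous_on S (feature \<phi>)"
proof -
  have "continuous_on UNIV (feature \<phi>)"
    unfolding feature_def by (intro continuous_on_vec_lambda assms)
  then show ?thesis
    by (rule continuous_on_subset) simp
qed

lemma continuous_feature2:
  assumes "\<And>k. torus_C2 (\<phi> k)"
  shows "continuous_on S (feature2 \<phi>)"
proof -
  have "continuous_on UNIV (feature2 \<phi>)"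
    unfolding feature2_def using assms
    by (intro continuous_on_vec_lambda) (auto simp: torus_C2_def)
  then show ?thesis
    by (rule continuous_on_subset) simp
qed

lemma inner_feature_derivs:
  assumes "\<And>k. torus_C2 (\<phi> k)"
  shows "((\<lambda>t. p \<bullet> feature \<phi> (to_torus t)) has_real_derivative
      (\<Sum>k\<in>UNIV. p $ k * deriv (\<phi> k \<circ> to_torus) t)) (at t)"
    and "((\<lambda>t. \<Sum>k\<in>UNIV. p $ k * deriv (\<phi> k \<circ> to_torus) t) has_real_derivative
      p \<bullet> feature2 \<phi> t) (at t)"
proof -
  have D: "((\<phi> k \<circ> to_torus) has_real_derivative deriv (\<phi> k \<circ> to_torus) t) (at t)"
    "(deriv (\<phi> k \<circ> to_torus) has_real_derivative deriv (deriv (\<phi> k \<circ> to_torus)) t) (at t)" for k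
    using assms[of k] unfolding torus_C2_def
    by (simp_all add: DERIV_deriv_iff_real_differentiable)
  show "((\<lambda>t. p \<bullet> feature \<phi> (to_torus t)) has_real_derivative
      (\<Sum>k\<in>UNIV. p $ k * deriv (\<phi> k \<circ> to_torus) t)) (at t)"
    unfolding inner_feature using D(1) by (intro DERIV_sum DERIV_cmult) (simp add: o_def)
  show "((\<lambda>t. \<Sum>k\<in>UNIV. p $ k * deriv (\<phi> k \<circ> to_torus) t) has_real_derivative
      p \<bullet> feature2 \<phi> t) (at t)"
    unfolding inner_vec_def feature2_def inner_real_def vec_lambda_beta
    using D(2) by (intro DERIV_sum DERIV_cmult)
qed

lemma torus_deriv2_inner_feature:
  assumes "\<And>k. torus_C2 (\<phi> k)"
  shows "torus_deriv2 (\<lambda>x. p \<bullet> feature \<phi> x) x = p \<bullet> feature2 \<phi> (torus_rep x)"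
proof -
  have "deriv ((\<lambda>x. p \<bullet> feature \<phi> x) \<circ> to_torus) = (\<lambda>t. \<Sum>k\<in>UNIV. p $ k * deriv (\<phi> k \<circ> to_torus) t)"
    unfolding o_def by (intro ext DERIV_imp_deriv inner_feature_derivs[OF assms, unfolded o_def])
  then show ?thesis
    unfolding torus_deriv2_def by (simp add: DERIV_imp_deriv[OF inner_feature_derivs(2)[OF assms]])
qed

text \<open>Points with value 1 are maxima, so the derivative of the lift vanishes at both. If the
  lifts differed, the mean value theorem would give a zero of the second derivative between them,
  inside the ball where it is negative.\<close>

lemma concave_max_unique:
  assumes \<phi>: "\<And>k. torus_C2 (\<phi> k)"
    and le: "\<And>x. p \<bullet> feature \<phi> x \<le> 1"
    and neg: "\<And>t. t \<in> cball t0 r \<Longrightarrow> p \<bullet> feature2 \<phi> t < 0"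
    and x: "p \<bullet> feature \<phi> x = 1" "dist x (to_torus t0) \<le> r"
    and x': "p \<bullet> feature \<phi> x' = 1" "dist x' (to_torus t0) \<le> r"
  shows "x = x'"
proof -
  let ?g' = "\<lambda>t. \<Sum>k\<in>UNIV. p $ k * deriv (\<phi> k \<circ> to_torus) t"
  have crit: "?g' t = 0" if "p \<bullet> feature \<phi> (to_torus t) = 1" for t
    by (rule DERIV_local_max[OF inner_feature_derivs(1)[OF \<phi>] zero_less_one]) (use le that in auto)
  have False if st: "s < t" "s \<in> cball t0 r" "t \<in> cball t0 r"
    "p \<bullet> feature \<phi> (to_torus s) = 1" "p \<bullet> feature \<phi> (to_torus t) = 1" for s t
  proof -
    obtain z where z: "s < z" "z < t" "?g' t - ?g' s = (t - s) * (p \<bullet> feature2 \<phi> z)"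
      using MVT2[OF st(1) inner_feature_derivs(2)[where \<phi> = \<phi>, OF \<phi>]] by blast
    have "z \<in> cball t0 r"
      using z(1,2) st(2,3) by (auto simp: dist_real_def)
    then show False
      using z neg[of z] st(1) crit[OF st(4)] crit[OF st(5)] by simp
  qed
  moreover obtain s where s: "to_torus s = x" "\<bar>s - t0\<bar> = dist x (to_torus t0)"
    by (rule torus_near_lift)
  moreover obtain t where t: "to_torus t = x'" "\<bar>t - t0\<bar> = dist x' (to_torus t0)"
    by (rule torus_near_lift)
  moreover have "s \<in> cball t0 r" "t \<in> cball t0 r"
    using s(2) t(2) x(2) x'(2) by (auto simp: dist_real_def abs_minus_commute)
  ultimately have "s = t"
    using x(1) x'(1) by (metis linorder_neqE)
  then show ?thesis
    using s(1) t(1) by simp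
qed

section \<open>The atoms, dual feasibility and activity\<close>

text \<open>The measurements of signed Dirac masses and signed unit vectors. Both signs are
  included, so the one-sided bounds of \<open>polar\<close> amount to bounds on absolute
  values.\<close>

definition atoms :: "('N::finite \<Rightarrow> torus \<Rightarrow> real) \<Rightarrow> (real^'N) set" where
  "atoms \<phi> = {s *\<^sub>R feature \<phi> x | s x. s \<in> {-1, 1}} \<union> {s *\<^sub>R axis k 1 | s k. s \<in> {-1, 1}}"

lemma compact_atoms:
  assumes "\<And>k. continuous_on UNIV (\<phi> k)"
  shows "compact (atoms \<phi>)"
proof -
  have "compact ((\<lambda>x. s *\<^sub>R feature \<phi> x) ` UNIV)" for s :: real
    by (intro compact_continuous_image compact_UNIV_torus continuous_intros continuous_feature assms)
  moreover have "compact ((\<lambda>k. s *\<^sub>R axis k 1 :: real^'N) ` UNIV)" for s :: real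
    by (intro finite_imp_compact) simp
  moreover have "atoms \<phi> = (\<Union>s\<in>{-1, 1}. (\<lambda>x. s *\<^sub>R feature \<phi> x) ` UNIV \<union> (\<lambda>k. s *\<^sub>R axis k 1) ` UNIV)"
    unfolding atoms_def image_def by blast
  ultimately show ?thesis
    by (simp only:) (intro compact_UN compact_Un finite.intros)
qed

lemma ball_atoms:
  "(\<forall>a\<in>atoms \<phi>. P a) \<longleftrightarrow>
    (\<forall>s\<in>{-1, 1}. (\<forall>x. P (s *\<^sub>R feature \<phi> x)) \<and> (\<forall>k. P (s *\<^sub>R axis k 1)))"
  unfolding atoms_def by blast

lemma polar_atoms_iff:
  "p \<in> polar (atoms \<phi>) \<longleftrightarrow> (\<forall>x. \<bar>p \<bullet> feature \<phi> x\<bar> \<le> 1) \<and> (\<forall>k. \<bar>p $ k\<bar> \<le> 1)"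
  unfolding polar_def mem_Collect_eq ball_atoms by (auto simp: inner_axis abs_le_iff)

lemma polar_atomsD:
  assumes "p \<in> polar (atoms \<phi>)" "s \<in> {-1, 1}"
  shows "s * (p \<bullet> feature \<phi> x) \<le> 1" "s * p $ k \<le> 1"
  using assms unfolding polar_def mem_Collect_eq ball_atoms by (auto simp: inner_axis)

text \<open>The unit-vector atoms alone confine p to the cube [-1, 1]^N, whatever the features
  are.\<close>

lemma compact_polar_atoms: "compact (polar (atoms \<phi>))"
proof -
  have "norm p \<le> real CARD('a)" if "p \<in> polar (atoms \<phi>)" for p :: "real^'a"
  proof -
    have "(\<Sum>k\<in>UNIV. \<bar>p $ k\<bar>) \<le> (\<Sum>k\<in>(UNIV :: 'a set). 1)"
      using that by (intro sum_mono) (auto simp: polar_atoms_iff)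
    then show ?thesis
      using norm_le_l1_cart[of p] by simp
  qed
  then show ?thesis
    using closed_polar by (auto simp: compact_eq_bounded_closed bounded_iff)
qed

text \<open>Only an inclusion: each index i offers a single position, and some of the listed
  constraints may be inactive.\<close>

definition active_within :: "nat \<Rightarrow> nat \<Rightarrow> ('N::finite \<Rightarrow> torus \<Rightarrow> real) \<Rightarrow> (nat \<Rightarrow> real) \<Rightarrow>
    (nat \<Rightarrow> real^'N) \<Rightarrow> (nat \<Rightarrow> torus) \<Rightarrow> real^'N \<Rightarrow> bool" where
  "active_within n m \<phi> \<sigma> \<zeta> x p \<longleftrightarrow> (\<forall>s\<in>{-1, 1}.
     (\<forall>x'. s * (p \<bullet> feature \<phi> x') = 1 \<longrightarrow> (\<exists>i\<in>{1..n}. s = \<sigma> i \<and> x' = x i)) \<and>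
     (\<forall>k. s * p $ k = 1 \<longrightarrow> (\<exists>j\<in>{1..m}. \<zeta> j = s *\<^sub>R axis k 1)))"

lemma active_withinD:
  assumes "active_within n m \<phi> \<sigma> \<zeta> x p" "s \<in> {-1, 1}"
  shows "s * (p \<bullet> feature \<phi> x') = 1 \<Longrightarrow> \<exists>i\<in>{1..n}. s = \<sigma> i \<and> x' = x i"
    and "s * p $ k = 1 \<Longrightarrow> \<exists>j\<in>{1..m}. \<zeta> j = s *\<^sub>R axis k 1"
  using assms unfolding active_within_def by blast+

text \<open>Away from the \<open>x0 i\<close> the constraints stay inactive by compactness; near \<open>x0 i\<close> strict concavity
  leaves at most one active point.\<close>

lemma active_set_stable:
  fixes \<phi> :: "'N::finite \<Rightarrow> torus \<Rightarrow> real"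
  assumes \<phi>: "\<And>k. torus_C2 (\<phi> k)"
    and \<sigma>0: "\<And>i. i \<in> {1..n} \<Longrightarrow> \<sigma>0 i \<in> {-1, 1}"
    and p0: "p0 \<in> polar (atoms \<phi>)"
    and act: "active_within n m \<phi> \<sigma>0 \<zeta>0 x0 p0"
    and neg: "\<And>i. i \<in> {1..n} \<Longrightarrow> \<sigma>0 i * (p0 \<bullet> feature2 \<phi> (torus_rep (x0 i))) < 0"
  obtains r0 where "r0 > 0"
    "\<And>r. 0 < r \<Longrightarrow> r \<le> r0 \<Longrightarrow> \<forall>\<^sub>F p in nhds p0. p \<in> polar (atoms \<phi>) \<longrightarrow>
      (\<exists>x. (\<forall>i\<in>{1..n}. dist (x i) (x0 i) \<le> r) \<and> active_within n m \<phi> \<sigma>0 \<zeta>0 x p)"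
proof -
  note cont = torus_C2_continuous[OF \<phi>]
  let ?t = "\<lambda>i. torus_rep (x0 i)"
  have ball: "\<forall>\<^sub>F r in at_right 0. \<forall>t\<in>cball (?t i) r. \<sigma>0 i * (p0 \<bullet> feature2 \<phi> t) < 0"
    if i: "i \<in> {1..n}" for i
  proof -
    have "continuous_on UNIV (\<lambda>t. \<sigma>0 i * (p0 \<bullet> feature2 \<phi> t))"
      by (intro continuous_intros continuous_feature2 \<phi>)
    then have "open {t. \<sigma>0 i * (p0 \<bullet> feature2 \<phi> t) < 0}"
      by (intro open_Collect_less) auto
    then obtain e where e: "e > 0" "ball (?t i) e \<subseteq> {t. \<sigma>0 i * (p0 \<bullet> feature2 \<phi> t) < 0}"
      using neg[OF i] by (metis (mono_tags, lifting) mem_Collect_eq open_contains_ball)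
    have "\<forall>\<^sub>F r in at_right 0. r < e"
      using e(1) by (rule eventually_at_right_real[THEN eventually_mono]) auto
    then show ?thesis
    proof (rule eventually_mono)
      fix r assume "r < e"
      then have "cball (?t i) r \<subseteq> ball (?t i) e"
        by (auto simp: subset_iff)
      then show "\<forall>t\<in>cball (?t i) r. \<sigma>0 i * (p0 \<bullet> feature2 \<phi> t) < 0"
        using e(2) by blast
    qed
  qed
  have "\<forall>\<^sub>F r in at_right 0. \<forall>i\<in>{1..n}. \<forall>t\<in>cball (?t i) r. \<sigma>0 i * (p0 \<bullet> feature2 \<phi> t) < 0"
    by (intro eventually_ball_finite ballI ball) simp
  then obtain r1 where r1: "r1 > 0" "\<And>r i t. 0 < r \<Longrightarrow> r < r1 \<Longrightarrow> i \<in> {1..n} \<Longrightarrow> t \<in> cball (?t i) r \<Longrightarrow>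
      \<sigma>0 i * (p0 \<bullet> feature2 \<phi> t) < 0"
    unfolding eventually_at_right_field by blast
  show thesis
  proof (rule that[of "r1 / 2"])
    fix r assume r: "0 < r" "r \<le> r1 / 2"
    have "\<forall>\<^sub>F p in nhds p0. \<forall>t\<in>cball (?t i) r. p \<bullet> (\<sigma>0 i *\<^sub>R feature2 \<phi> t) < 0" if "i \<in> {1..n}" for i
      using r r1 that
      by (intro eventually_compact_less compact_cball continuous_intros continuous_feature2 \<phi>) auto
    then have E1: "\<forall>\<^sub>F p in nhds p0. \<forall>i\<in>{1..n}. \<forall>t\<in>cball (?t i) r. p \<bullet> (\<sigma>0 i *\<^sub>R feature2 \<phi> t) < 0"
      by (intro eventually_ball_finite) auto
    \<comment> \<open>Only positions carrying the sign s are cut out; at every remaining point, even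
      one carrying the opposite sign, the constraint with sign s is inactive for p0.\<close>
    have E2: "\<forall>\<^sub>F p in nhds p0. \<forall>x\<in>{x. \<forall>i\<in>{1..n}. \<sigma>0 i = s \<longrightarrow> r \<le> dist x (x0 i)}. p \<bullet> (s *\<^sub>R feature \<phi> x) < 1"
      if s: "s \<in> {-1, 1}" for s
    proof (rule eventually_compact_less)
      let ?S = "{x. \<forall>i\<in>{1..n}. \<sigma>0 i = s \<longrightarrow> r \<le> dist x (x0 i)}"
      have "?S = (\<Inter>i\<in>{i\<in>{1..n}. \<sigma>0 i = s}. {x. r \<le> dist x (x0 i)})"
        by auto
      then have "closed ?S"
        by (auto intro!: closed_INT closed_Collect_le continuous_intros)
      then show "compact ?S"
        using compact_Int_closed[OF compact_UNIV_torus] by simp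
      show "continuous_on ?S (\<lambda>x. s *\<^sub>R feature \<phi> x)"
        by (intro continuous_intros continuous_feature cont)
      fix x assume x: "x \<in> ?S"
      have "s * (p0 \<bullet> feature \<phi> x) \<noteq> 1"
        using active_withinD(1)[OF act s, of x] x r by fastforce
      moreover have "s * (p0 \<bullet> feature \<phi> x) \<le> 1"
        by (rule polar_atomsD[OF p0 s])
      ultimately show "p0 \<bullet> (s *\<^sub>R feature \<phi> x) < 1"
        by simp
    qed
    \<comment> \<open>There are finitely many coordinate constraints, so inactive ones stay
      inactive. Nothing can move here, which is why the \<zeta>0 j are kept unchanged.\<close>
    have E3: "\<forall>\<^sub>F p in nhds p0. \<forall>k\<in>{k. s * p0 $ k < 1}. s * p $ k < 1" for s
    proof (intro eventually_ball_finite ballI)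
      fix k assume "k \<in> {k. s * p0 $ k < 1}"
      moreover have "((\<lambda>p. s * p $ k) \<longlongrightarrow> s * p0 $ k) (nhds p0)"
        by (intro tendsto_intros filterlim_ident)
      ultimately show "\<forall>\<^sub>F p in nhds p0. s * p $ k < 1"
        by (simp add: order_tendstoD)
    qed simp
    have "\<forall>\<^sub>F p in nhds p0. \<forall>s\<in>{-1, 1}.
        \<forall>x\<in>{x. \<forall>i\<in>{1..n}. \<sigma>0 i = s \<longrightarrow> r \<le> dist x (x0 i)}. p \<bullet> (s *\<^sub>R feature \<phi> x) < 1"
      by (intro eventually_ball_finite ballI E2) simp_all
    moreover have "\<forall>\<^sub>F p in nhds p0. \<forall>s\<in>{-1, 1}. \<forall>k\<in>{k. s * p0 $ k < 1}. s * p $ k < 1"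
      by (intro eventually_ball_finite ballI E3) simp_all
    ultimately show "\<forall>\<^sub>F p in nhds p0. p \<in> polar (atoms \<phi>) \<longrightarrow>
      (\<exists>x. (\<forall>i\<in>{1..n}. dist (x i) (x0 i) \<le> r) \<and> active_within n m \<phi> \<sigma>0 \<zeta>0 x p)"
      using E1
    proof eventually_elim
      case (elim p)
      show ?case
      proof
        assume p: "p \<in> polar (atoms \<phi>)"
        have near: "\<exists>i\<in>{1..n}. \<sigma>0 i = s \<and> dist x' (x0 i) \<le> r"
          if "s \<in> {-1, 1}" "s * (p \<bullet> feature \<phi> x') = 1" for s x'
        proof (rule ccontr)
          assume "\<not> ?thesis"
          then have "\<forall>i\<in>{1..n}. \<sigma>0 i = s \<longrightarrow> r \<le> dist x' (x0 i)"
            by (meson linear)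
          then have "p \<bullet> (s *\<^sub>R feature \<phi> x') < 1"
            using elim(1) that(1) by blast
          then show False
            using that(2) by simp
        qed
        \<comment> \<open>If no point near x0 i is active for p, the position defaults to x0 i; this
          is harmless because \<open>active_within\<close> asks only for an inclusion.\<close>
        define x where "x i = (if \<exists>x'. \<sigma>0 i * (p \<bullet> feature \<phi> x') = 1 \<and> dist x' (x0 i) \<le> r
          then SOME x'. \<sigma>0 i * (p \<bullet> feature \<phi> x') = 1 \<and> dist x' (x0 i) \<le> r else x0 i)" for i
        have xP: "\<sigma>0 i * (p \<bullet> feature \<phi> (x i)) = 1 \<and> dist (x i) (x0 i) \<le> r"
          if "\<sigma>0 i * (p \<bullet> feature \<phi> x') = 1" "dist x' (x0 i) \<le> r" for i x'
          using someI_ex[of "\<lambda>x'. \<sigma>0 i * (p \<bullet> feature \<phi> x') = 1 \<and> dist x' (x0 i) \<le> r"] that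
          by (auto simp: x_def)
        have "dist (x i) (x0 i) \<le> r" for i
          using xP[of i] r(1) by (cases "\<exists>x'. \<sigma>0 i * (p \<bullet> feature \<phi> x') = 1 \<and> dist x' (x0 i) \<le> r") (auto simp: x_def)
        moreover have "x' = x i"
          if i: "i \<in> {1..n}" and x': "\<sigma>0 i * (p \<bullet> feature \<phi> x') = 1" "dist x' (x0 i) \<le> r" for i x'
        proof (rule concave_max_unique[where \<phi> = \<phi> and p = "\<sigma>0 i *\<^sub>R p" and ?t0.0 = "?t i" and r = r, OF \<phi>])
          show "\<sigma>0 i *\<^sub>R p \<bullet> feature \<phi> x \<le> 1" for x
            using polar_atomsD(1)[OF p \<sigma>0[OF i]] by simp
          show "\<sigma>0 i *\<^sub>R p \<bullet> feature2 \<phi> t < 0" if "t \<in> cball (?t i) r" for t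
            using elim(3) i that by simp
        qed (use x' xP[OF x'] in simp_all)
        moreover have "\<exists>j\<in>{1..m}. \<zeta>0 j = s *\<^sub>R axis k 1" if s: "s \<in> {-1, 1}" "s * p $ k = 1" for s k
        proof (rule active_withinD(2)[OF act s(1)])
          have "s * p0 $ k \<le> 1"
            by (rule polar_atomsD[OF p0 s(1)])
          moreover have "\<not> s * p0 $ k < 1"
            using s elim(2) by fastforce
          ultimately show "s * p0 $ k = 1"
            by simp
        qed
        ultimately show "\<exists>x. (\<forall>i\<in>{1..n}. dist (x i) (x0 i) \<le> r) \<and> active_within n m \<phi> \<sigma>0 \<zeta>0 x p"
          unfolding active_within_def using near by metis
      qed
    qed
  qed (use r1 in simp)
qed

section \<open>Optimality and uniqueness of sparse solutions\<close>

lemma meas_op_add: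
  assumes "\<And>k. continuous_on UNIV (\<phi> k)"
  shows "meas_op \<phi> (u + v) = meas_op \<phi> u + meas_op \<phi> v"
  by (simp add: vec_eq_iff meas_op_def radon_integral_add assms)

lemma meas_op_scaleR:
  assumes "\<And>k. continuous_on UNIV (\<phi> k)"
  shows "meas_op \<phi> (a *\<^sub>R u) = a *\<^sub>R meas_op \<phi> u"
  by (simp add: vec_eq_iff meas_op_def radon_integral_scaleR assms distrib_left)

lemma meas_op_sum:
  assumes "\<And>k. continuous_on UNIV (\<phi> k)"
  shows "meas_op \<phi> (\<Sum>i\<in>I. u i) = (\<Sum>i\<in>I. meas_op \<phi> (u i))"
proof -
  have "meas_op \<phi> (0 *\<^sub>R 0) = 0 *\<^sub>R meas_op \<phi> 0"
    by (rule meas_op_scaleR[OF assms])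
  then have "meas_op \<phi> 0 = 0"
    by simp
  then show ?thesis
    by (induction I rule: infinite_finite_induct) (simp_all add: meas_op_add assms)
qed

lemma meas_op_dirac:
  assumes "\<And>k. continuous_on UNIV (\<phi> k)"
  shows "meas_op \<phi> (s *\<^sub>R dirac x, 0) = s *\<^sub>R feature \<phi> x"
  by (simp add: vec_eq_iff meas_op_def feature_def radon_integral_scaleR radon_integral_dirac assms)

lemma meas_op_vec:
  assumes "\<And>k. continuous_on UNIV (\<phi> k)"
  shows "meas_op \<phi> (0, z) = z"
proof -
  have "radon_integral 0 (\<phi> k) = 0" for k
    using radon_integral_scaleR[OF assms, of 0 0 k] by simp
  then show ?thesis
    by (simp add: vec_eq_iff meas_op_def)
qed

definition atom_family :: "('N::finite \<Rightarrow> torus \<Rightarrow> real) \<Rightarrow> (nat \<Rightarrow> real) \<Rightarrow> (nat \<Rightarrow> real^'N) \<Rightarrow>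
    (nat \<Rightarrow> torus) \<Rightarrow> nat + nat \<Rightarrow> real^'N" where
  "atom_family \<phi> \<sigma> \<zeta> x = case_sum (\<lambda>i. \<sigma> i *\<^sub>R feature \<phi> (x i)) \<zeta>"

lemma meas_op_sparse_measure:
  assumes "\<And>k. continuous_on UNIV (\<phi> k)"
  shows "meas_op \<phi> (sparse_measure n m \<sigma> \<zeta> c x d) =
    (\<Sum>l\<in>{1..n} <+> {1..m}. case_sum c d l *\<^sub>R atom_family \<phi> \<sigma> \<zeta> x l)"
  unfolding sparse_measure_def
  by (simp only: meas_op_add[OF assms] meas_op_sum[OF assms] meas_op_scaleR[OF assms]
      meas_op_dirac[OF assms] meas_op_vec[OF assms])
    (simp add: sum.Plus atom_family_def)

lemma inner_meas_op:
  assumes "\<And>k. continuous_on UNIV (\<phi> k)"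
  shows "p \<bullet> meas_op \<phi> u = radon_integral (fst u) (\<lambda>x. p \<bullet> feature \<phi> x) + p \<bullet> snd u"
proof -
  have "radon_integral (fst u) (\<lambda>x. p \<bullet> feature \<phi> x) = (\<Sum>k\<in>UNIV. p $ k * radon_integral (fst u) (\<phi> k))"
    unfolding inner_feature by (rule radon_integral_sum) (rule assms)
  then show ?thesis
    by (simp add: inner_vec_def meas_op_def distrib_left sum.distrib)
qed

lemma pairing_meas_op_pre:
  assumes "\<And>k. continuous_on UNIV (\<phi> k)"
  shows "pairing (meas_op_pre \<phi> p) u = p \<bullet> meas_op \<phi> u"
  unfolding inner_meas_op[OF assms] by (simp add: pairing_def meas_op_pre_def inner_feature)

lemma inner_le_l1:
  fixes p z :: "real^'N::finite"
  assumes "\<And>k. \<bar>p $ k\<bar> \<le> 1"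
  shows "p \<bullet> z \<le> (\<Sum>k\<in>UNIV. \<bar>z $ k\<bar>)"
  unfolding inner_vec_def
proof (rule sum_mono)
  fix k
  have "p $ k * z $ k \<le> \<bar>p $ k\<bar> * \<bar>z $ k\<bar>"
    by (metis abs_ge_self abs_mult)
  also have "\<dots> \<le> \<bar>z $ k\<bar>"
    using assms[of k] by (simp add: mult_left_le_one_le)
  finally show "p $ k \<bullet> z $ k \<le> \<bar>z $ k\<bar>"
    by simp
qed

text \<open>The two components are bounded separately because equality in the sum must later be
  split into equality in each.\<close>

lemma inner_meas_op_le_regularizer:
  assumes \<phi>: "\<And>k. continuous_on UNIV (\<phi> k)" and p: "p \<in> polar (atoms \<phi>)"
  shows "radon_integral (fst u) (\<lambda>x. p \<bullet> feature \<phi> x) \<le> tv_norm (fst u)"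
    and "p \<bullet> snd u \<le> (\<Sum>k\<in>UNIV. \<bar>snd u $ k\<bar>)"
    and "p \<bullet> meas_op \<phi> u \<le> regularizer u"
proof -
  show 1: "radon_integral (fst u) (\<lambda>x. p \<bullet> feature \<phi> x) \<le> tv_norm (fst u)"
    using p by (intro radon_integral_le_tv_norm continuous_intros continuous_feature \<phi>)
      (auto simp: polar_atoms_iff)
  show 2: "p \<bullet> snd u \<le> (\<Sum>k\<in>UNIV. \<bar>snd u $ k\<bar>)"
    using p by (intro inner_le_l1) (auto simp: polar_atoms_iff)
  show "p \<bullet> meas_op \<phi> u \<le> regularizer u"
    using 1 2 by (simp add: inner_meas_op[OF \<phi>] regularizer_def)
qed

lemma sparse_measure_components:
  "fst (sparse_measure n m \<sigma> \<zeta> c x d) = (\<Sum>i\<in>{1..n}. (c i * \<sigma> i) *\<^sub>R dirac (x i))"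
  "snd (sparse_measure n m \<sigma> \<zeta> c x d) = (\<Sum>j\<in>{1..m}. d j *\<^sub>R \<zeta> j)"
  unfolding sparse_measure_def by (simp_all add: fst_sum snd_sum)

lemma regularizer_sparse_measure_le:
  assumes \<sigma>: "\<And>i. i \<in> {1..n} \<Longrightarrow> \<sigma> i \<in> {-1, 1}"
    and \<zeta>: "\<And>j. j \<in> {1..m} \<Longrightarrow> (0, \<zeta> j) \<in> E2"
  shows "regularizer (sparse_measure n m \<sigma> \<zeta> c x d) \<le> (\<Sum>l\<in>{1..n} <+> {1..m}. \<bar>case_sum c d l\<bar>)"
proof -
  have "tv_norm (\<Sum>i\<in>{1..n}. (c i * \<sigma> i) *\<^sub>R dirac (x i)) \<le> (\<Sum>i\<in>{1..n}. \<bar>c i * \<sigma> i\<bar>)"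
    by (rule tv_norm_sum_dirac_le)
  also have "\<dots> = (\<Sum>i\<in>{1..n}. \<bar>c i\<bar>)"
    using \<sigma> by (intro sum.cong refl) (force simp: abs_mult)
  finally have 1: "tv_norm (\<Sum>i\<in>{1..n}. (c i * \<sigma> i) *\<^sub>R dirac (x i)) \<le> (\<Sum>i\<in>{1..n}. \<bar>c i\<bar>)" .
  have l1: "(\<Sum>k\<in>UNIV. \<bar>\<zeta> j $ k\<bar>) = 1" if "j \<in> {1..m}" for j
  proof -
    have "(0, \<zeta> j) \<in> E2"
      by (rule \<zeta>[OF that])
    then obtain a k where "\<zeta> j = a *\<^sub>R axis k 1" "\<bar>a\<bar> = 1"
      unfolding E2_def by blast
    then show ?thesis
      by (simp add: axis_def if_distrib cong: if_cong)
  qed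
  have "(\<Sum>k\<in>UNIV. \<bar>(\<Sum>j\<in>{1..m}. d j *\<^sub>R \<zeta> j) $ k\<bar>) \<le> (\<Sum>k\<in>UNIV. \<Sum>j\<in>{1..m}. \<bar>d j\<bar> * \<bar>\<zeta> j $ k\<bar>)"
    by (intro sum_mono) (simp add: sum_abs[THEN order_trans] abs_mult)
  also have "\<dots> = (\<Sum>j\<in>{1..m}. \<bar>d j\<bar> * (\<Sum>k\<in>UNIV. \<bar>\<zeta> j $ k\<bar>))"
    unfolding sum_distrib_left by (rule sum.swap)
  also have "\<dots> = (\<Sum>j\<in>{1..m}. \<bar>d j\<bar>)"
    using l1 by simp
  finally show ?thesis
    using 1 by (simp add: regularizer_def sparse_measure_components sum.Plus)
qed

text \<open>Necessity tests the subgradient inequality on signed Dirac masses and signed unit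
  vectors, where the regularizer is at most 1; sufficiency is the dual bound for the
  regularizer.\<close>

lemma subdiff_regularizer_0_iff:
  fixes \<phi> :: "'N::finite \<Rightarrow> torus \<Rightarrow> real"
  assumes \<phi>: "\<And>k. continuous_on UNIV (\<phi> k)"
  shows "meas_op_pre \<phi> p \<in> subdiff regularizer 0 \<longleftrightarrow> p \<in> polar (atoms \<phi>)"
proof
  have R0: "regularizer 0 = 0"
    by (simp add: regularizer_def tv_norm_zero)
  have cont: "continuous_on UNIV (fst (meas_op_pre \<phi> p))"
    using \<phi> by (auto simp: meas_op_pre_def intro!: continuous_intros)
  {
    assume "p \<in> polar (atoms \<phi>)"
    then show "meas_op_pre \<phi> p \<in> subdiff regularizer 0"
      using cont inner_meas_op_le_regularizer(3)[where \<phi> = \<phi>, OF \<phi>]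
      by (simp add: subdiff_def R0 pairing_meas_op_pre[OF \<phi>])
  }
  assume "meas_op_pre \<phi> p \<in> subdiff regularizer 0"
  then have le: "p \<bullet> meas_op \<phi> v \<le> regularizer v" for v
    by (simp add: subdiff_def R0 pairing_meas_op_pre[OF \<phi>] del: split_paired_All)
  have "p \<bullet> (s *\<^sub>R feature \<phi> x) \<le> 1" if "s \<in> {-1, 1}" for s x
  proof -
    have "tv_norm (s *\<^sub>R dirac x + 0 *\<^sub>R 0) \<le> \<bar>s\<bar> * tv_norm (dirac x) + \<bar>0\<bar> * tv_norm 0"
      by (rule tv_norm_lincomb_le)
    then have "regularizer (s *\<^sub>R dirac x, 0 :: real^'N) \<le> 1"
      using that tv_norm_dirac_le[of x] by (auto simp: regularizer_def)
    then show ?thesis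
      using le[of "(s *\<^sub>R dirac x, 0)"] by (simp add: meas_op_dirac[OF \<phi>])
  qed
  moreover have "p \<bullet> (s *\<^sub>R axis k 1) \<le> 1" if "s \<in> {-1, 1}" for s k
  proof -
    have "regularizer (0, s *\<^sub>R axis k 1 :: real^'N) = 1"
      using that by (auto simp: regularizer_def tv_norm_zero axis_def if_distrib cong: if_cong)
    then show ?thesis
      using le[of "(0, s *\<^sub>R axis k 1)"] by (simp add: meas_op_vec[OF \<phi>])
  qed
  ultimately show "p \<in> polar (atoms \<phi>)"
    unfolding polar_def mem_Collect_eq ball_atoms by blast
qed

lemma dual_solutions_eq:
  assumes "\<And>k. continuous_on UNIV (\<phi> k)"
  shows "dual_solutions \<phi> y = {p \<in> polar (atoms \<phi>). \<forall>q\<in>polar (atoms \<phi>). y \<bullet> q \<le> y \<bullet> p}"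
  by (auto simp: dual_solutions_def is_arg_max_def subdiff_regularizer_0_iff[OF assms] not_less)

text \<open>\<open>ARG_MIN\<close> is a Hilbert choice and says something only if a minimizer
  exists. The maximizers of y over the compact polar set form a nonempty compact set, so the norm
  attains its minimum there.\<close>

lemma min_norm_certificate_vector:
  assumes \<phi>: "\<And>k. continuous_on UNIV (\<phi> k)"
  obtains p0 where "min_norm_certificate \<phi> y = meas_op_pre \<phi> p0" "p0 \<in> polar (atoms \<phi>)"
    "\<And>q. q \<in> polar (atoms \<phi>) \<Longrightarrow> y \<bullet> q \<le> y \<bullet> p0"
    "\<And>q. q \<in> polar (atoms \<phi>) \<Longrightarrow> y \<bullet> q = y \<bullet> p0 \<Longrightarrow> norm p0 \<le> norm q"
proof -
  let ?C = "polar (atoms \<phi>)"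
  let ?D = "dual_solutions \<phi> y"
  have C: "compact ?C" "?C \<noteq> {}"
    using compact_polar_atoms zero_in_polar by blast+
  obtain p1 where p1: "p1 \<in> ?C" "\<forall>q\<in>?C. y \<bullet> q \<le> y \<bullet> p1"
    using continuous_attains_sup[OF C continuous_on_inner[OF continuous_on_const continuous_on_id], of y]
    by blast
  have D: "?D = ?C \<inter> {q. y \<bullet> p1 \<le> y \<bullet> q}"
    unfolding dual_solutions_eq[OF \<phi>] using p1 by (auto intro: order_trans)
  have "compact ?D"
    unfolding D by (intro compact_Int_closed C(1) closed_Collect_le continuous_intros)
  moreover have "?D \<noteq> {}"
    unfolding D using p1(1) by blast
  ultimately obtain p2 where p2: "p2 \<in> ?D" "\<forall>q\<in>?D. norm p2 \<le> norm q"
    using continuous_attains_inf[of ?D norm] continuous_on_norm_id by blast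
  define p0 where "p0 = (ARG_MIN norm p. p \<in> ?D)"
  have "is_arg_min norm (\<lambda>p. p \<in> ?D) p2"
    using p2 by (auto simp: is_arg_min_def not_less)
  then have p0: "is_arg_min norm (\<lambda>p. p \<in> ?D) p0"
    unfolding p0_def arg_min_def by (rule someI)
  show thesis
  proof (rule that[of p0])
    show "min_norm_certificate \<phi> y = meas_op_pre \<phi> p0"
      by (simp add: min_norm_certificate_def p0_def)
    have p0D: "p0 \<in> ?D" and min: "q \<in> ?D \<Longrightarrow> norm p0 \<le> norm q" for q
      using p0 by (auto simp: is_arg_min_def not_less)
    show "p0 \<in> ?C" "q \<in> ?C \<Longrightarrow> y \<bullet> q \<le> y \<bullet> p0" for q
      using p0D unfolding dual_solutions_eq[OF \<phi>] by auto
    then show "norm p0 \<le> norm q" if "q \<in> ?C" "y \<bullet> q = y \<bullet> p0" for q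
      using that by (intro min) (auto simp: dual_solutions_eq[OF \<phi>])
  qed
qed

text \<open>Collects the coefficients of all w assigned to one index. The assignment comes from a
  choice and may miss indices, which then receive coefficient 0.\<close>

lemma sum_regroup_scaleR:
  fixes h :: "'i \<Rightarrow> 'v::real_vector"
  assumes "finite W" "finite I" "idx ` W \<subseteq> I"
  shows "(\<Sum>l\<in>I. (\<Sum>w\<in>{w\<in>W. idx w = l}. c w) *\<^sub>R h l) = (\<Sum>w\<in>W. c w *\<^sub>R h (idx w))"
proof -
  have "(\<Sum>l\<in>I. (\<Sum>w\<in>{w\<in>W. idx w = l}. c w) *\<^sub>R h l) =
      (\<Sum>l\<in>I. \<Sum>w\<in>{w\<in>W. idx w = l}. c w *\<^sub>R h (idx w))"
    by (simp add: scaleR_sum_left)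
  also have "\<dots> = (\<Sum>w\<in>W. c w *\<^sub>R h (idx w))"
    by (rule sum.group) fact+
  finally show ?thesis .
qed

lemma objective_eq:
  "objective \<phi> l z u = (norm (meas_op \<phi> u - z))\<^sup>2 / 2 + l * regularizer u"
proof -
  have "(norm w)\<^sup>2 = (\<Sum>i\<in>UNIV. (w $ i)\<^sup>2)" for w :: "real^'a"
    unfolding power2_norm_eq_inner by (simp add: inner_vec_def power2_eq_square)
  then show ?thesis
    by (cases u) (simp add: objective_def regularizer_def meas_op_def)
qed

text \<open>Equality in the sum of two dual bounds forces equality in each: the measure is carried
  by the saturated points of p, and every nonzero coordinate of the vector needs |p_k| = 1.\<close>

lemma sparse_form_of_equality:
  assumes \<phi>: "\<And>k. continuous_on UNIV (\<phi> k)" and p: "p \<in> polar (atoms \<phi>)"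
    and \<sigma>: "\<And>i. i \<in> {1..n} \<Longrightarrow> \<sigma> i \<in> {-1, 1}"
    and act: "active_within n m \<phi> \<sigma> \<zeta> x p"
    and eq: "regularizer v \<le> p \<bullet> meas_op \<phi> v"
  shows "\<exists>c d. v = sparse_measure n m \<sigma> \<zeta> c x d"
proof -
  note le = inner_meas_op_le_regularizer(1,2)[OF \<phi> p, of v]
  let ?f = "\<lambda>x. p \<bullet> feature \<phi> x"
  have eq1: "radon_integral (fst v) ?f = tv_norm (fst v)"
    and eq2: "p \<bullet> snd v = (\<Sum>k\<in>UNIV. \<bar>snd v $ k\<bar>)"
    using le eq by (auto simp: inner_meas_op[OF \<phi>] regularizer_def)
  have f: "continuous_on UNIV ?f" "\<bar>?f x'\<bar> \<le> 1" for x'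
    using p by (auto simp: polar_atoms_iff intro!: continuous_intros continuous_feature \<phi>)
  let ?F = "{x'. \<bar>?f x'\<bar> = 1}"
  have ex: "\<exists>i\<in>{1..n}. x' = x i" if "x' \<in> ?F" for x'
  proof -
    have "?f x' = 1 \<or> ?f x' = -1"
      using that by (auto simp: abs_if split: if_splits)
    then show ?thesis
      using active_withinD(1)[OF act, of 1 x'] active_withinD(1)[OF act, of "-1" x'] by auto
  qed
  then obtain idx where idx: "\<And>x'. x' \<in> ?F \<Longrightarrow> idx x' \<in> {1..n} \<and> x' = x (idx x')"
    by metis
  have "?F \<subseteq> x ` {1..n}"
    using ex by blast
  then have F: "finite ?F"
    by (rule finite_subset) simp
  have "fst v = (\<Sum>x'\<in>?F. meas (fst v) {x'} *\<^sub>R dirac x')"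
    by (rule radon_eq_sum_dirac[OF F]) (rule meas_eq_0_off_saturation[OF f eq1], auto)
  also have "\<dots> = (\<Sum>x'\<in>?F. meas (fst v) {x'} *\<^sub>R dirac (x (idx x')))"
    using idx by (intro sum.cong refl) simp
  also have "\<dots> = (\<Sum>i\<in>{1..n}. (\<Sum>x'\<in>{x'\<in>?F. idx x' = i}. meas (fst v) {x'}) *\<^sub>R dirac (x i))"
    using idx F by (intro sum_regroup_scaleR[symmetric]) auto
  \<comment> \<open>Inserting the square of the sign, which is 1, brings the masses into the form c
    i * \<sigma> i.\<close>
  also have "\<dots> = (\<Sum>i\<in>{1..n}. ((\<Sum>x'\<in>{x'\<in>?F. idx x' = i}. meas (fst v) {x'}) * \<sigma> i * \<sigma> i) *\<^sub>R dirac (x i))"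
    using \<sigma> by (intro sum.cong refl) force
  finally have v1: "fst v = \<dots>" .
  have sat: "p $ k * snd v $ k = \<bar>snd v $ k\<bar>" for k
  proof -
    have "p $ k * snd v $ k \<le> \<bar>snd v $ k\<bar>" for k
    proof -
      have "p $ k * snd v $ k \<le> \<bar>p $ k\<bar> * \<bar>snd v $ k\<bar>"
        by (metis abs_ge_self abs_mult)
      also have "\<dots> \<le> \<bar>snd v $ k\<bar>"
        using p by (simp add: mult_left_le_one_le polar_atoms_iff)
      finally show ?thesis .
    qed
    moreover have "(\<Sum>k\<in>UNIV. \<bar>snd v $ k\<bar> - p $ k * snd v $ k) = 0"
      using eq2 by (simp add: sum_subtractf inner_vec_def)
    ultimately show ?thesis
      using sum_nonneg_eq_0_iff[of UNIV "\<lambda>k. \<bar>snd v $ k\<bar> - p $ k * snd v $ k"] by simp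
  qed
  let ?K = "{k. snd v $ k \<noteq> 0}"
  have "\<exists>j\<in>{1..m}. \<zeta> j = p $ k *\<^sub>R axis k 1 \<and> p $ k * p $ k = 1" if k: "k \<in> ?K" for k
  proof -
    have "\<bar>p $ k\<bar> * \<bar>snd v $ k\<bar> = \<bar>snd v $ k\<bar>"
      using arg_cong[OF sat[of k], of abs] by (simp add: abs_mult)
    then have "p $ k = 1 \<or> p $ k = -1"
      using k by (auto simp: abs_if split: if_splits)
    then show ?thesis
      using active_withinD(2)[OF act, of "p $ k" k] by auto
  qed
  then obtain jdx where jdx: "\<And>k. k \<in> ?K \<Longrightarrow>
      jdx k \<in> {1..m} \<and> \<zeta> (jdx k) = p $ k *\<^sub>R axis k 1 \<and> p $ k * p $ k = 1"
    by metis
  have "snd v = (\<Sum>k\<in>UNIV. snd v $ k *\<^sub>R axis k 1)"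
    by (simp add: vec_eq_iff axis_def if_distrib cong: if_cong)
  also have "\<dots> = (\<Sum>k\<in>?K. snd v $ k *\<^sub>R axis k 1)"
    by (intro sum.mono_neutral_right) auto
  also have "\<dots> = (\<Sum>k\<in>?K. (snd v $ k * p $ k) *\<^sub>R \<zeta> (jdx k))"
    using jdx by (intro sum.cong refl) (simp add: mult.assoc)
  also have "\<dots> = (\<Sum>j\<in>{1..m}. (\<Sum>k\<in>{k\<in>?K. jdx k = j}. snd v $ k * p $ k) *\<^sub>R \<zeta> j)"
    using jdx by (intro sum_regroup_scaleR[symmetric]) auto
  finally have v2: "snd v = \<dots>" .
  \<comment> \<open>The coefficients are left schematic and are read off from \<open>v1\<close> and
    \<open>v2\<close> by unification.\<close>
  show ?thesis
    by (intro exI prod_eqI) (simp_all only: sparse_measure_components v1[symmetric] v2[symmetric],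
      (rule v1, rule v2)?)
qed

text \<open>Optimality and uniqueness both follow from \<open>gap\<close>: the excess of the
  objective at v over that at u is at least the sum of two nonnegative terms, |K v - K u|^2 / 2 and
  l (R v - p \<bullet> K v). For a minimizer v both vanish, so K v is determined before v
  is.\<close>

lemma sparse_solution:
  fixes \<phi> :: "'N::finite \<Rightarrow> torus \<Rightarrow> real"
  assumes \<phi>: "\<And>k. continuous_on UNIV (\<phi> k)" and l: "l > 0"
    and p: "p = closest_point (polar (atoms \<phi>)) (z /\<^sub>R l)"
    and \<sigma>: "\<And>i. i \<in> {1..n} \<Longrightarrow> \<sigma> i \<in> {-1, 1}"
    and \<zeta>: "\<And>j. j \<in> {1..m} \<Longrightarrow> (0, \<zeta> j) \<in> E2"
    and act: "active_within n m \<phi> \<sigma> \<zeta> x p"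
    and bound: "\<And>c. (\<Sum>i\<in>{1..n} <+> {1..m}. \<bar>c i\<bar>) \<le>
      K * norm (\<Sum>i\<in>{1..n} <+> {1..m}. c i *\<^sub>R atom_family \<phi> \<sigma> \<zeta> x i)"
  obtains c d where
    "\<And>v. is_arg_min (objective \<phi> l z) (\<lambda>_. True) v \<longleftrightarrow> v = sparse_measure n m \<sigma> \<zeta> c x d"
    "meas_op \<phi> (sparse_measure n m \<sigma> \<zeta> c x d) = z - l *\<^sub>R p"
proof -
  let ?C = "polar (atoms \<phi>)" and ?I = "{1..n} <+> {1..m}"
  let ?a = "atom_family \<phi> \<sigma> \<zeta> x"
  have pC: "p \<in> ?C"
    unfolding p using closed_polar zero_in_polar by (intro closest_point_in_set) auto
  let ?W = "{a \<in> atoms \<phi>. p \<bullet> a = 1}"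
  have W: "\<exists>i\<in>?I. a = ?a i" if a: "a \<in> ?W" for a
  proof -
    from a consider s x' where "s \<in> {-1, 1}" "a = s *\<^sub>R feature \<phi> x'"
      | s k where "s \<in> {-1, 1}" "a = s *\<^sub>R axis k 1"
      unfolding atoms_def by blast
    then show ?thesis
    proof cases
      case 1
      then obtain i where "i \<in> {1..n}" "s = \<sigma> i" "x' = x i"
        using active_withinD(1)[OF act, of s x'] a by auto
      then show ?thesis
        using 1 by (intro bexI[of _ "Inl i"]) (auto simp: atom_family_def)
    next
      case 2
      then obtain j where "j \<in> {1..m}" "\<zeta> j = s *\<^sub>R axis k 1"
        using active_withinD(2)[OF act, of s k] a by (auto simp: inner_axis)
      then show ?thesis
        using 2 by (intro bexI[of _ "Inr j"]) (auto simp: atom_family_def)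
    qed
  qed
  then obtain idx where idx: "\<And>a. a \<in> ?W \<Longrightarrow> idx a \<in> ?I \<and> a = ?a (idx a)"
    by metis
  have "?W \<subseteq> ?a ` ?I"
    using W by blast
  then have finW: "finite ?W"
    by (rule finite_subset) simp
  have "z /\<^sub>R l - p \<in> convex_cone hull ?W"
  \<comment> \<open>The variational inequality of the projection puts z / l - p into the normal cone
    at p.\<close>
  proof (rule normal_cone_polar[OF compact_atoms[OF \<phi>] pC _ finW])
    show "(z /\<^sub>R l - p) \<bullet> (q - p) \<le> 0" if "q \<in> ?C" for q
      unfolding p by (rule closest_point_dot[OF convex_polar closed_polar that])
  qed
  then obtain b where b: "\<And>a. a \<in> ?W \<Longrightarrow> 0 \<le> b a" "z /\<^sub>R l - p = (\<Sum>a\<in>?W. b a *\<^sub>R a)"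
    using convex_cone_hull_finite_explicit[OF finW] by blast
  define C where "C i = (\<Sum>a\<in>{a\<in>?W. idx a = i}. l * b a)" for i
  have C0: "0 \<le> C i" for i
    unfolding C_def using b(1) l by (intro sum_nonneg) simp
  have regroup: "(\<Sum>i\<in>?I. C i *\<^sub>R h i) = (\<Sum>a\<in>?W. (l * b a) *\<^sub>R h (idx a))" for h :: "nat + nat \<Rightarrow> 'v::real_vector"
    unfolding C_def using finW idx by (intro sum_regroup_scaleR) auto
  define u where "u = sparse_measure n m \<sigma> \<zeta> (C \<circ> Inl) x (C \<circ> Inr)"
  have CC: "case_sum (C \<circ> Inl) (C \<circ> Inr) = C"
    by (auto simp: fun_eq_iff split: sum.split)
  have "meas_op \<phi> u = (\<Sum>a\<in>?W. (l * b a) *\<^sub>R ?a (idx a))"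
    unfolding u_def meas_op_sparse_measure[OF \<phi>] CC by (rule regroup)
  also have "\<dots> = (\<Sum>a\<in>?W. (l * b a) *\<^sub>R a)"
    using idx by (intro sum.cong refl) auto
  also have "\<dots> = l *\<^sub>R (z /\<^sub>R l - p)"
    unfolding b(2) by (simp add: scaleR_sum_right)
  also have "\<dots> = z - l *\<^sub>R p"
    using l by (simp add: scaleR_diff_right)
  finally have Ku: "meas_op \<phi> u = z - l *\<^sub>R p" .
  have "regularizer u \<le> (\<Sum>i\<in>?I. \<bar>C i\<bar>)"
    unfolding u_def using regularizer_sparse_measure_le[OF \<sigma> \<zeta>, where c = "C \<circ> Inl" and d = "C \<circ> Inr"] CC by simp
  \<comment> \<open>The factor 1 is written out so that \<open>regroup\<close> applies to real
    scalars; afterwards it is replaced by p \<bullet> a, which is 1 on active atoms.\<close>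
  also have "\<dots> = (\<Sum>i\<in>?I. C i *\<^sub>R 1)"
    using C0 by simp
  also have "\<dots> = (\<Sum>a\<in>?W. (l * b a) *\<^sub>R (p \<bullet> a))"
    unfolding regroup by (intro sum.cong) auto
  also have "\<dots> = p \<bullet> (l *\<^sub>R (z /\<^sub>R l - p))"
    unfolding b(2) by (simp add: inner_sum_right sum_distrib_left mult.assoc)
  also have "l *\<^sub>R (z /\<^sub>R l - p) = meas_op \<phi> u"
    unfolding Ku using l by (simp add: scaleR_diff_right)
  finally have Ru: "regularizer u \<le> p \<bullet> meas_op \<phi> u" .
  note Rle = inner_meas_op_le_regularizer(3)[OF \<phi> pC]
  \<comment> \<open>The square is expanded around K u - z = - l p; the cross term - l (p \<bullet>
    (K v - K u)) is combined with R u <= p \<bullet> K u.\<close>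
  have gap: "objective \<phi> l z v \<ge> objective \<phi> l z u + (norm (meas_op \<phi> v - meas_op \<phi> u))\<^sup>2 / 2
      + l * (regularizer v - p \<bullet> meas_op \<phi> v)" for v
  proof -
    let ?D = "meas_op \<phi> v - meas_op \<phi> u"
    have sq: "(norm (a - b))\<^sup>2 = (norm a)\<^sup>2 - 2 * (b \<bullet> a) + (norm b)\<^sup>2" for a b :: "real^'N"
      unfolding power2_norm_eq_inner by (simp add: inner_diff_left inner_diff_right inner_commute)
    have e: "meas_op \<phi> v - z = ?D - l *\<^sub>R p" "meas_op \<phi> u - z = - (l *\<^sub>R p)"
      by (simp_all add: Ku)
    have "objective \<phi> l z v - objective \<phi> l z u =
        (norm ?D)\<^sup>2 / 2 - l * (p \<bullet> ?D) + l * (regularizer v - regularizer u)"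
      unfolding objective_eq e sq[of ?D "l *\<^sub>R p"] norm_minus_cancel inner_scaleR_left
      by (simp add: algebra_simps add_divide_distrib diff_divide_distrib)
    moreover have "l * regularizer u \<le> l * (p \<bullet> meas_op \<phi> u)"
      using Ru l by simp
    ultimately show ?thesis
      unfolding inner_diff_right right_diff_distrib by linarith
  qed
  have opt: "objective \<phi> l z u \<le> objective \<phi> l z v" for v
  proof -
    have "0 \<le> l * (regularizer v - p \<bullet> meas_op \<phi> v)"
      using Rle[of v] l by simp
    then show ?thesis
      using gap[of v] zero_le_power2[of "norm (meas_op \<phi> v - meas_op \<phi> u)"] by linarith
  qed
  have "v = u" if v: "objective \<phi> l z v \<le> objective \<phi> l z u" for v
  proof -
    have "0 \<le> l * (regularizer v - p \<bullet> meas_op \<phi> v)"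
      using Rle[of v] l by simp
    then have "(norm (meas_op \<phi> v - meas_op \<phi> u))\<^sup>2 \<le> 0" "l * (regularizer v - p \<bullet> meas_op \<phi> v) \<le> 0"
      using gap[of v] v zero_le_power2[of "norm (meas_op \<phi> v - meas_op \<phi> u)"] by linarith+
    then have Kv: "meas_op \<phi> v = meas_op \<phi> u" and Rv: "regularizer v \<le> p \<bullet> meas_op \<phi> v"
      using l by (simp_all add: mult_le_0_iff)
    obtain c d where v_eq: "v = sparse_measure n m \<sigma> \<zeta> c x d"
      using sparse_form_of_equality[OF \<phi> pC \<sigma> act Rv] by blast
    \<comment> \<open>Since v and u use the same positions, equality of their measurements is a
      linear relation between the atoms, and \<open>bound\<close> makes its coefficients
      vanish.\<close>
    have "(\<Sum>i\<in>?I. (case_sum c d i - C i) *\<^sub>R ?a i) = 0"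
      using Kv CC unfolding v_eq u_def meas_op_sparse_measure[OF \<phi>] by (simp add: scaleR_diff_left sum_subtractf)
    then have "(\<Sum>i\<in>?I. \<bar>case_sum c d i - C i\<bar>) = 0"
      using bound[of "\<lambda>i. case_sum c d i - C i"] by (simp add: order_antisym sum_nonneg)
    then have eqC: "case_sum c d i = C i" if "i \<in> ?I" for i
      using that by (simp add: sum_nonneg_eq_0_iff)
    have "c i = C (Inl i)" if "i \<in> {1..n}" for i
      using eqC[OF InlI[OF that]] by simp
    moreover have "d j = C (Inr j)" if "j \<in> {1..m}" for j
      using eqC[OF InrI[OF that]] by simp
    ultimately show ?thesis
      unfolding v_eq u_def sparse_measure_def by (auto intro!: arg_cong2[of _ _ _ _ "(+)"] sum.cong)
  qed
  then have "is_arg_min (objective \<phi> l z) (\<lambda>_. True) v \<longleftrightarrow> v = u" for v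
    using opt unfolding is_arg_min_def by (meson not_less)
  then show thesis
    using that Ku unfolding u_def by blast
qed

section \<open>Uniqueness of the representation and the final estimates\<close>

text \<open>The balls of radius r about the x0 i are disjoint, and each contains exactly the i-th
  position of either representation. The mass of the i-th ball compares coefficients, the mass of
  \<open>{x i}\<close> compares positions; the latter detects the position because c i is
  nonzero.\<close>

lemma sparse_measure_unique:
  assumes eq: "sparse_measure n m \<sigma> \<zeta> c x d = sparse_measure n m \<sigma> \<zeta> c' x' d'"
    and \<sigma>: "\<And>i. i \<in> {1..n} \<Longrightarrow> \<sigma> i \<in> {-1, 1}"
    and sep: "\<And>i j. i \<in> {1..n} \<Longrightarrow> j \<in> {1..n} \<Longrightarrow> i \<noteq> j \<Longrightarrow> 2 * r < dist (x0 i) (x0 j)"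
    and x: "\<And>i. i \<in> {1..n} \<Longrightarrow> dist (x i) (x0 i) \<le> r"
    and x': "\<And>i. i \<in> {1..n} \<Longrightarrow> dist (x' i) (x0 i) \<le> r"
    and c: "\<And>i. i \<in> {1..n} \<Longrightarrow> c i \<noteq> 0"
    and \<zeta>: "\<And>a. (\<Sum>j\<in>{1..m}. a j *\<^sub>R \<zeta> j) = 0 \<Longrightarrow> \<forall>j\<in>{1..m}. a j = 0"
  shows "\<forall>i\<in>{1..n}. c i = c' i \<and> x i = x' i" "\<forall>j\<in>{1..m}. d j = d' j"
proof -
  have "(\<Sum>j\<in>{1..m}. (d j - d' j) *\<^sub>R \<zeta> j) = 0"
    using arg_cong[OF eq, of snd] by (simp add: sparse_measure_components scaleR_diff_left sum_subtractf)
  then show "\<forall>j\<in>{1..m}. d j = d' j"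
    using \<zeta>[of "\<lambda>j. d j - d' j"] by simp
  have m_eq: "(\<Sum>j\<in>{1..n}. c j * \<sigma> j * dirac_fun (x j) A) = (\<Sum>j\<in>{1..n}. c' j * \<sigma> j * dirac_fun (x' j) A)" for A
    using arg_cong[OF eq, of "\<lambda>u. meas (fst u) A"]
    by (simp add: sparse_measure_components meas_sum meas_simps meas_dirac)
  have far: "dist z (x0 i) > r" if "i \<in> {1..n}" "j \<in> {1..n}" "i \<noteq> j" "dist z (x0 j) \<le> r" for i j z
    using sep[OF that(1-3)] that(4) dist_triangle2[of "x0 i" "x0 j" z] by (simp add: dist_commute)
  have single: "(\<Sum>j\<in>{1..n}. b j * \<sigma> j * dirac_fun (w j) A) = b i * \<sigma> i * dirac_fun (w i) A"
    if i: "i \<in> {1..n}" and w: "\<And>j. j \<in> {1..n} \<Longrightarrow> dist (w j) (x0 j) \<le> r" and A: "A \<subseteq> cball (x0 i) r"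
    for i b w A
  proof -
    have "dirac_fun (w j) A = 0" if "j \<in> {1..n}" "j \<noteq> i" for j
      using far[OF i that(1) that(2)[symmetric] w[OF that(1)]] A
      by (auto simp: dirac_fun_def dist_commute)
    then have "(\<Sum>j\<in>{1..n}. b j * \<sigma> j * dirac_fun (w j) A) = (\<Sum>j\<in>{i}. b j * \<sigma> j * dirac_fun (w j) A)"
      using i by (intro sum.mono_neutral_right) auto
    then show ?thesis
      by simp
  qed
  show "\<forall>i\<in>{1..n}. c i = c' i \<and> x i = x' i"
  proof
    fix i assume i: "i \<in> {1..n}"
    have s0: "\<sigma> i \<noteq> 0"
      using \<sigma>[OF i] by auto
    have "c i * \<sigma> i = c' i * \<sigma> i"
      using m_eq[of "cball (x0 i) r"] single[OF i x order_refl] single[OF i x' order_refl] x[OF i] x'[OF i]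
      by (simp add: dirac_fun_def dist_commute)
    then have cc: "c i = c' i"
      using s0 by simp
    have sub: "{x i} \<subseteq> cball (x0 i) r"
      using x[OF i] by (simp add: dist_commute)
    have "c i * \<sigma> i = c' i * \<sigma> i * dirac_fun (x' i) {x i}"
      using m_eq[of "{x i}"] single[OF i x sub] single[OF i x' sub] by (simp add: dirac_fun_def)
    then have "x i = x' i"
      using cc c[OF i] s0 by (auto simp: dirac_fun_def split: if_splits)
    then show "c i = c' i \<and> x i = x' i"
      using cc by simp
  qed
qed

lemma ex1_tripleI:
  assumes "P a b c" "\<And>a' b' c'. P a' b' c' \<Longrightarrow> a' = a \<and> b' = b \<and> c' = c"
  shows "\<exists>!(a, b, c). P a b c"
proof (rule ex1I[of _ "(a, b, c)"])
  fix z assume z: "case z of (a, b, c) \<Rightarrow> P a b c"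
  obtain a' b' c' where z_eq: "z = (a', b', c')"
    by (rule prod_cases3)
  then have "P a' b' c'"
    using z by simp
  from assms(2)[OF this] show "z = (a, b, c)"
    unfolding z_eq by simp
qed (use assms(1) in simp)

lemma sparse_measure_restrict:
  "sparse_measure n m \<sigma> \<zeta> (restrict c {1..n}) (restrict x {1..n}) (restrict d {1..m}) =
    sparse_measure n m \<sigma> \<zeta> c x d"
  unfolding sparse_measure_def by simp

text \<open>Equal positions would make the members i and j proportional, whereas the vector dual to
  i pairs to 1 with the first and to 0 with the second.\<close>

lemma atom_family_positions_inj:
  assumes "independent_family ({1..n} <+> {1..m}) (atom_family \<phi> \<sigma> \<zeta> x)"
    and "i \<in> {1..n}" "j \<in> {1..n}" "i \<noteq> j" "\<sigma> j \<noteq> 0"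
  shows "x i \<noteq> x j"
proof
  assume "x i = x j"
  obtain g where g: "\<And>l. l \<in> {1..n} <+> {1..m} \<Longrightarrow>
      g \<bullet> atom_family \<phi> \<sigma> \<zeta> x l = (if l = Inl i then 1 else 0)"
    using independent_family_dual[OF assms(1) InlI[OF assms(2)]] by blast
  show False
    using g[OF InlI[OF assms(2)]] g[OF InlI[OF assms(3)]] assms(4,5) \<open>x i = x j\<close>
    by (simp add: atom_family_def)
qed

lemma atom_family_dist_le:
  assumes "l \<in> {1..n} <+> {1..m}" "0 \<le> e"
    and "\<And>i. i \<in> {1..n} \<Longrightarrow> \<sigma> i \<in> {-1, 1}"
    and "\<And>i. i \<in> {1..n} \<Longrightarrow> norm (feature \<phi> (x i) - feature \<phi> (x' i)) \<le> e"
  shows "norm (atom_family \<phi> \<sigma> \<zeta> x l - atom_family \<phi> \<sigma> \<zeta> x' l) \<le> e"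
  using assms(1)
proof (elim PlusE)
  fix i assume i: "i \<in> {1..n}" "l = Inl i"
  have "norm (\<sigma> i *\<^sub>R feature \<phi> (x i) - \<sigma> i *\<^sub>R feature \<phi> (x' i)) = norm (feature \<phi> (x i) - feature \<phi> (x' i))"
    unfolding scaleR_diff_right[symmetric] using assms(3)[OF i(1)] by auto
  then show ?thesis
    using assms(4)[OF i(1)] i(2) by (simp add: atom_family_def)
qed (use assms(2) in \<open>simp add: atom_family_def\<close>)

lemma feature_uniformly_close:
  assumes "\<And>k. continuous_on UNIV (\<phi> k)" "e > 0"
  shows "\<forall>\<^sub>F r in at_right 0. \<forall>x'. dist x' x \<le> r \<longrightarrow> norm (feature \<phi> x' - feature \<phi> x) \<le> e"
proof -
  have "continuous_on UNIV (feature \<phi>)"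
    by (rule continuous_feature[OF assms(1)])
  then obtain d where d: "d > 0" "\<And>x'. dist x' x < d \<Longrightarrow> dist (feature \<phi> x') (feature \<phi> x) < e"
    using assms(2) unfolding continuous_on_iff by blast
  have "\<forall>\<^sub>F r in at_right 0. r < d"
    using d(1) by (rule eventually_at_right_real[THEN eventually_mono]) auto
  then show ?thesis
  proof (rule eventually_mono, intro allI impI)
    fix r x' assume "r < d" "dist x' x \<le> r"
    then show "norm (feature \<phi> x' - feature \<phi> x) \<le> e"
      using d(2)[of x'] by (simp add: dist_norm)
  qed
qed

theorem theorem5p3:
  fixes \<phi> :: "'N::finite \<Rightarrow> torus \<Rightarrow> real"
    and n m :: nat
    and c0 \<sigma>0 d0 :: "nat \<Rightarrow> real"
    and x0 :: "nat \<Rightarrow> torus"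
    and \<zeta>0 :: "nat \<Rightarrow> real^'N"
    and \<mu>0 :: "radon \<times> (real^'N)"
    and y \<eta>02 :: "real^'N"
    and \<eta>01 :: "torus \<Rightarrow> real"
  assumes \<phi>_C2: "\<And>k. torus_C2 (\<phi> k)"
    and c0: "\<And>i. i \<in> {1..n} \<Longrightarrow> c0 i \<noteq> 0"
    and \<sigma>0: "\<And>i. i \<in> {1..n} \<Longrightarrow> \<sigma>0 i \<in> {-1, 1}"
    and d0: "\<And>j. j \<in> {1..m} \<Longrightarrow> d0 j \<noteq> 0"
    and \<zeta>0: "\<And>j. j \<in> {1..m} \<Longrightarrow> (0, \<zeta>0 j) \<in> E2"
    and \<mu>0: "\<mu>0 = sparse_measure n m \<sigma>0 \<zeta>0 c0 x0 d0"
    and y: "y = meas_op \<phi> \<mu>0"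
    and \<eta>0: "(\<eta>01, \<eta>02) = min_norm_certificate \<phi> y"
    and a: "range (meas_op_pre \<phi>) \<inter> subdiff regularizer \<mu>0 \<noteq> {}"
    and b1: "\<And>\<sigma> x. \<sigma> \<in> {-1, 1} \<Longrightarrow>
      \<sigma> * \<eta>01 x = 1 \<longleftrightarrow> (\<exists>i\<in>{1..n}. (\<sigma>, x) = (\<sigma>0 i, x0 i))"
    and b2: "\<And>\<zeta>. (0, \<zeta>) \<in> E2 \<Longrightarrow> \<eta>02 \<bullet> \<zeta> = 1 \<longleftrightarrow> (\<exists>j\<in>{1..m}. \<zeta> = \<zeta>0 j)"
    and c1: "torus_C2 \<eta>01"
    and c2: "\<And>i. i \<in> {1..n} \<Longrightarrow> \<sigma>0 i * torus_deriv2 \<eta>01 (x0 i) < 0"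
    and indep: "independent_family ({1..n} <+> {1..m})
      (case_sum (\<lambda>i. meas_op \<phi> (\<sigma>0 i *\<^sub>R dirac (x0 i), 0)) (\<lambda>j. meas_op \<phi> (0, \<zeta>0 j)))"
  shows "\<exists>\<epsilon>0>0. \<forall>\<epsilon>. 0 < \<epsilon> \<and> \<epsilon> \<le> \<epsilon>0 \<longrightarrow>
    (\<exists>\<alpha>>0. \<exists>l0>0. \<forall>l w. 0 < l \<and> l \<le> l0 \<and> norm w \<le> \<alpha> * l \<longrightarrow>
      (\<exists>u. (\<forall>v. is_arg_min (objective \<phi> l (y + w)) (\<lambda>_. True) v \<longleftrightarrow> v = u) \<and>
        (\<exists>!(c, x, d).
          c \<in> extensional {1..n} \<and> x \<in> extensional {1..n} \<and> d \<in> extensional {1..m} \<and>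
          u = sparse_measure n m \<sigma>0 \<zeta>0 c x d \<and>
          (\<forall>i\<in>{1..n}. dist (x i) (x0 i) \<le> \<epsilon> \<and> \<bar>c i - c0 i\<bar> \<le> \<epsilon>) \<and>
          (\<forall>j\<in>{1..m}. \<bar>d j - d0 j\<bar> \<le> \<epsilon>))))"
proof -
  let ?I = "{1..n} <+> {1..m}"
  let ?C = "polar (atoms \<phi>)"
  have cont: "\<And>k. continuous_on UNIV (\<phi> k)"
    by (rule torus_C2_continuous[OF \<phi>_C2])
  obtain p0 where p0: "min_norm_certificate \<phi> y = meas_op_pre \<phi> p0" "p0 \<in> ?C"
    and p0_max: "\<And>q. q \<in> ?C \<Longrightarrow> y \<bullet> q \<le> y \<bullet> p0"
    and p0_min: "\<And>q. q \<in> ?C \<Longrightarrow> y \<bullet> q = y \<bullet> p0 \<Longrightarrow> norm p0 \<le> norm q"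
    using min_norm_certificate_vector[where \<phi> = \<phi>, OF cont] by blast
  have \<eta>: "\<eta>01 = (\<lambda>x. p0 \<bullet> feature \<phi> x)" "\<eta>02 = p0"
    using \<eta>0 p0(1) by (simp_all add: meas_op_pre_def inner_feature)
  have act0: "active_within n m \<phi> \<sigma>0 \<zeta>0 x0 p0"
    unfolding active_within_def
  proof (intro ballI conjI allI impI)
    fix s :: real assume s: "s \<in> {-1, 1}"
    show "\<exists>i\<in>{1..n}. s = \<sigma>0 i \<and> x = x0 i" if "s * (p0 \<bullet> feature \<phi> x) = 1" for x
      using b1[OF s, of x] that unfolding \<eta> by simp
    show "\<exists>j\<in>{1..m}. \<zeta>0 j = s *\<^sub>R axis k 1" if "s * p0 $ k = 1" for k
    proof -
      have "(0, s *\<^sub>R axis k 1) \<in> E2"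
        unfolding E2_def using s by (intro CollectI exI[of _ s] exI[of _ k]) auto
      then show ?thesis
        using b2[of "s *\<^sub>R axis k 1"] that unfolding \<eta> by (auto simp: inner_axis)
    qed
  qed
  have neg: "\<sigma>0 i * (p0 \<bullet> feature2 \<phi> (torus_rep (x0 i))) < 0" if "i \<in> {1..n}" for i
    using c2[OF that] unfolding \<eta> by (simp add: torus_deriv2_inner_feature \<phi>_C2)
  have ind: "independent_family ?I (atom_family \<phi> \<sigma>0 \<zeta>0 x0)"
    using indep unfolding meas_op_dirac[OF cont] meas_op_vec[OF cont] atom_family_def .
  obtain \<delta> K where \<delta>: "\<delta> > 0" and K: "K > 0"
    and bound: "\<And>w c. (\<And>l. l \<in> ?I \<Longrightarrow> norm (w l - atom_family \<phi> \<sigma>0 \<zeta>0 x0 l) \<le> \<delta>) \<Longrightarrow>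
      (\<Sum>l\<in>?I. \<bar>c l\<bar>) \<le> K * norm (\<Sum>l\<in>?I. c l *\<^sub>R w l)"
    proof -
      show thesis
        by (rule independent_family_perturb[OF ind finite_Plus[OF finite_atLeastAtMost finite_atLeastAtMost]]) (fact that | assumption)+
    qed
  \<comment> \<open>The coefficient bound for the unmoved family, with zero coefficients on the
    Dirac part.\<close>
  have \<zeta>_ind: "\<forall>j\<in>{1..m}. b j = 0" if "(\<Sum>j\<in>{1..m}. b j *\<^sub>R \<zeta>0 j) = 0" for b
  proof -
    have "(\<Sum>l\<in>?I. \<bar>case_sum (\<lambda>_. 0) b l\<bar>) \<le> K * norm (\<Sum>l\<in>?I. case_sum (\<lambda>_. 0) b l *\<^sub>R atom_family \<phi> \<sigma>0 \<zeta>0 x0 l)"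
      using \<delta> by (intro bound) simp
    then have "(\<Sum>j\<in>{1..m}. \<bar>b j\<bar>) \<le> 0"
      using that by (simp add: sum.Plus atom_family_def)
    then have "(\<Sum>j\<in>{1..m}. \<bar>b j\<bar>) = 0"
      by (simp add: order_antisym sum_nonneg)
    then show ?thesis
      by (simp add: sum_nonneg_eq_0_iff)
  qed
  obtain r0 where r0: "r0 > 0"
    and stable: "\<And>r. 0 < r \<Longrightarrow> r \<le> r0 \<Longrightarrow> \<forall>\<^sub>F p in nhds p0. p \<in> ?C \<longrightarrow>
      (\<exists>x. (\<forall>i\<in>{1..n}. dist (x i) (x0 i) \<le> r) \<and> active_within n m \<phi> \<sigma>0 \<zeta>0 x p)"
    proof -
      show thesis
        by (rule active_set_stable[where \<phi> = \<phi>, OF \<phi>_C2 \<sigma>0 p0(2) act0 neg]) (fact that | assumption)+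
    qed
  have less_ev: "\<forall>\<^sub>F e in at_right 0. e < b" if "b > 0" for b :: real
    using that by (rule eventually_at_right_real[THEN eventually_mono]) auto
  have "\<forall>\<^sub>F e in at_right 0. \<forall>i\<in>{1..n}. e < \<bar>c0 i\<bar>"
    by (intro eventually_ball_finite ballI less_ev) (simp_all add: c0)
  moreover have "\<forall>\<^sub>F e in at_right 0. \<forall>i\<in>{1..n}. \<forall>j\<in>{1..n} - {i}. e < dist (x0 i) (x0 j) / 2"
  proof (intro eventually_ball_finite ballI less_ev)
    fix i j assume ij: "i \<in> {1..n}" "j \<in> {1..n} - {i}"
    then have "x0 i \<noteq> x0 j"
      using \<sigma>0[of j] by (intro atom_family_positions_inj[OF ind]) auto
    then show "0 < dist (x0 i) (x0 j) / 2"
      by simp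
  qed simp_all
  \<comment> \<open>These bounds define a sufficiently small \<epsilon>: below |c0 i| the perturbed
    coefficients stay nonzero, below half the distances the balls around the positions are disjoint,
    and below r0 the active set is stable.\<close>
  ultimately have "\<forall>\<^sub>F e in at_right 0. (\<forall>i\<in>{1..n}. e < \<bar>c0 i\<bar>) \<and>
      (\<forall>i\<in>{1..n}. \<forall>j\<in>{1..n} - {i}. e < dist (x0 i) (x0 j) / 2) \<and> e < r0"
    using less_ev[OF r0] by eventually_elim simp
  then obtain e1 where e1: "e1 > 0"
    and small: "\<And>e. 0 < e \<Longrightarrow> e < e1 \<Longrightarrow> (\<forall>i\<in>{1..n}. e < \<bar>c0 i\<bar>) \<and>
      (\<forall>i\<in>{1..n}. \<forall>j\<in>{1..n} - {i}. e < dist (x0 i) (x0 j) / 2) \<and> e < r0"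
    unfolding eventually_at_right_field by blast
  obtain B where B: "B > 0" "\<And>p. p \<in> ?C \<Longrightarrow> norm p \<le> B"
    using compact_imp_bounded[OF compact_polar_atoms] unfolding bounded_pos by blast
  define C0 where "C0 = case_sum c0 d0"
  define S0 where "S0 = (\<Sum>l\<in>?I. \<bar>C0 l\<bar>)"
  have S0: "S0 \<ge> 0"
    unfolding S0_def by (simp add: sum_nonneg)
  have y_eq: "y = (\<Sum>l\<in>?I. C0 l *\<^sub>R atom_family \<phi> \<sigma>0 \<zeta>0 x0 l)"
    unfolding y \<mu>0 meas_op_sparse_measure[OF cont] C0_def ..
  have main: "\<exists>\<alpha>>0. \<exists>l0>0. \<forall>l w. 0 < l \<and> l \<le> l0 \<and> norm w \<le> \<alpha> * l \<longrightarrow>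
      (\<exists>u. (\<forall>v. is_arg_min (objective \<phi> l (y + w)) (\<lambda>_. True) v \<longleftrightarrow> v = u) \<and>
        (\<exists>!(c, x, d).
          c \<in> extensional {1..n} \<and> x \<in> extensional {1..n} \<and> d \<in> extensional {1..m} \<and>
          u = sparse_measure n m \<sigma>0 \<zeta>0 c x d \<and>
          (\<forall>i\<in>{1..n}. dist (x i) (x0 i) \<le> \<epsilon> \<and> \<bar>c i - c0 i\<bar> \<le> \<epsilon>) \<and>
          (\<forall>j\<in>{1..m}. \<bar>d j - d0 j\<bar> \<le> \<epsilon>)))"
    if \<epsilon>: "0 < \<epsilon>" "\<epsilon> \<le> e1 / 2" for \<epsilon>
  proof -
    have sm: "\<forall>i\<in>{1..n}. \<epsilon> < \<bar>c0 i\<bar>" "\<epsilon> < r0"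
      "\<forall>i\<in>{1..n}. \<forall>j\<in>{1..n} - {i}. \<epsilon> < dist (x0 i) (x0 j) / 2"
      using small[of \<epsilon>] \<epsilon> e1 by simp_all
    have sep: "2 * \<epsilon> < dist (x0 i) (x0 j)" if "i \<in> {1..n}" "j \<in> {1..n}" "i \<noteq> j" for i j
      using bspec[OF bspec[OF sm(3) that(1)], of j] that by simp
    \<comment> \<open>\<tau> bounds the displacement of the atoms: \<delta> keeps the coefficient
      bound valid for the moved family, and the other term keeps K \<tau> S0 at most \<epsilon> / 2,
      with S0 + 1 in case S0 = 0.\<close>
    define \<tau> where "\<tau> = min \<delta> (\<epsilon> / (2 * K * (S0 + 1)))"
    have \<tau>: "\<tau> > 0" "\<tau> \<le> \<delta>" "\<tau> \<le> \<epsilon> / (2 * K * (S0 + 1))"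
      using \<delta> K S0 \<epsilon>(1) by (simp_all add: \<tau>_def)
    have "\<tau> * S0 \<le> (\<epsilon> / (2 * K * (S0 + 1))) * (S0 + 1)"
      using \<tau> S0 by (intro mult_mono) auto
    also have "\<dots> = \<epsilon> / (2 * K)"
      using S0 by simp
    finally have \<tau>S0: "K * (\<tau> * S0) \<le> \<epsilon> / 2"
      using K by (simp add: field_simps)
    have "\<forall>\<^sub>F r in at_right 0. \<forall>i\<in>{1..n}. \<forall>x'. dist x' (x0 i) \<le> r \<longrightarrow>
        norm (feature \<phi> x' - feature \<phi> (x0 i)) \<le> \<tau>"
      by (intro eventually_ball_finite ballI feature_uniformly_close cont \<tau>) simp
    then obtain r1 where r1: "r1 > 0" "\<And>r i x'. 0 < r \<Longrightarrow> r < r1 \<Longrightarrow> i \<in> {1..n} \<Longrightarrow> dist x' (x0 i) \<le> r \<Longrightarrow>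
        norm (feature \<phi> x' - feature \<phi> (x0 i)) \<le> \<tau>"
      unfolding eventually_at_right_field by blast
    define r where "r = min \<epsilon> (r1 / 2)"
    have r: "0 < r" "r \<le> \<epsilon>" "r < r1"
      using r1(1) \<epsilon>(1) by (auto simp: r_def)
    obtain \<rho> where \<rho>: "\<rho> > 0"
      and near: "\<And>p. dist p p0 < \<rho> \<Longrightarrow> p \<in> ?C \<Longrightarrow>
        \<exists>x. (\<forall>i\<in>{1..n}. dist (x i) (x0 i) \<le> r) \<and> active_within n m \<phi> \<sigma>0 \<zeta>0 x p"
      using stable[of r] r sm(2) unfolding eventually_nhds_metric by auto
    obtain \<alpha>1 l1 where \<alpha>1: "\<alpha>1 > 0" "l1 > 0"
      and close: "\<And>l w. 0 < l \<Longrightarrow> l \<le> l1 \<Longrightarrow> norm w \<le> \<alpha>1 * l \<Longrightarrow>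
        norm (closest_point ?C ((y + w) /\<^sub>R l) - p0) < \<rho>"
      proof -
        show thesis
          by (rule closest_point_near_min_norm[OF compact_polar_atoms convex_polar p0(2) p0_max p0_min \<rho>]) (fact that | assumption)+
      qed
    \<comment> \<open>The cap 1 on \<alpha> gives |w| <= l, so w - l p has norm at most l (1 + B);
      the cap on l makes K times this at most \<epsilon> / 2, the other half of the error
      budget.\<close>
    have pos: "0 < min \<alpha>1 1" "0 < min l1 (\<epsilon> / (2 * K * (1 + B)))"
      using \<alpha>1 \<epsilon>(1) K B(1) by simp_all
    show ?thesis
    proof (rule exI[of _ "min \<alpha>1 1"], rule conjI[OF pos(1)],
        rule exI[of _ "min l1 (\<epsilon> / (2 * K * (1 + B)))"], rule conjI[OF pos(2)], intro allI impI)
      fix l and w :: "real^'N"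
      assume "0 < l \<and> l \<le> min l1 (\<epsilon> / (2 * K * (1 + B))) \<and> norm w \<le> min \<alpha>1 1 * l"
      then have l: "0 < l" "l \<le> l1" "l \<le> \<epsilon> / (2 * K * (1 + B))" and w: "norm w \<le> min \<alpha>1 1 * l"
        by simp_all
      have w1: "norm w \<le> \<alpha>1 * l" "norm w \<le> l"
        using order_trans[OF w mult_right_mono[of "min \<alpha>1 1" \<alpha>1 l]]
          order_trans[OF w mult_right_mono[of "min \<alpha>1 1" 1 l]] l(1) by simp_all
      define p where "p = closest_point ?C ((y + w) /\<^sub>R l)"
      have pC: "p \<in> ?C"
        unfolding p_def using closed_polar zero_in_polar by (intro closest_point_in_set) auto
      have "dist p p0 < \<rho>"
        unfolding p_def dist_norm by (rule close[OF l(1,2) w1(1)])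
      from near[OF this pC] obtain x where x: "\<And>i. i \<in> {1..n} \<Longrightarrow> dist (x i) (x0 i) \<le> r"
        and act: "active_within n m \<phi> \<sigma>0 \<zeta>0 x p"
        by blast
      let ?a = "atom_family \<phi> \<sigma>0 \<zeta>0 x" and ?b = "atom_family \<phi> \<sigma>0 \<zeta>0 x0"
      have x_feature: "norm (feature \<phi> (x k) - feature \<phi> (x0 k)) \<le> \<tau>" if "k \<in> {1..n}" for k
        by (rule r1(2)[OF r(1,3) that x[OF that]])
      have a_close: "norm (?a i - ?b i) \<le> \<tau>" if "i \<in> ?I" for i
        by (rule atom_family_dist_le[OF that less_imp_le[OF \<tau>(1)] \<sigma>0 x_feature])
      have xbound: "(\<Sum>i\<in>?I. \<bar>b i\<bar>) \<le> K * norm (\<Sum>i\<in>?I. b i *\<^sub>R ?a i)" for b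
        by (rule bound) (rule order_trans[OF a_close \<tau>(2)])
      obtain c d where sol: "\<And>v. is_arg_min (objective \<phi> l (y + w)) (\<lambda>_. True) v \<longleftrightarrow>
            v = sparse_measure n m \<sigma>0 \<zeta>0 c x d"
        and Ku: "meas_op \<phi> (sparse_measure n m \<sigma>0 \<zeta>0 c x d) = (y + w) - l *\<^sub>R p"
        proof -
          show thesis
            by (rule sparse_solution[where \<phi> = \<phi>, OF cont l(1) p_def \<sigma>0 \<zeta>0 act xbound]) (fact that | assumption)+
        qed
      let ?C1 = "case_sum c d"
      \<comment> \<open>Both coefficient vectors are tested on the moved atoms: the result is K u -
        y = w - l p, up to the error of replacing the atoms at x0 by those at x.\<close>
      have "(\<Sum>i\<in>?I. (?C1 i - C0 i) *\<^sub>R ?a i) = (\<Sum>i\<in>?I. ?C1 i *\<^sub>R ?a i) - (\<Sum>i\<in>?I. C0 i *\<^sub>R ?a i)"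
        by (simp add: scaleR_diff_left sum_subtractf)
      also have "\<dots> = w - l *\<^sub>R p - (\<Sum>i\<in>?I. C0 i *\<^sub>R (?a i - ?b i))"
        using Ku unfolding meas_op_sparse_measure[OF cont] by (simp add: y_eq scaleR_diff_right sum_subtractf)
      finally have diff: "(\<Sum>i\<in>?I. (?C1 i - C0 i) *\<^sub>R ?a i) = \<dots>" .
      have "norm (\<Sum>i\<in>?I. C0 i *\<^sub>R (?a i - ?b i)) \<le> (\<Sum>i\<in>?I. \<bar>C0 i\<bar> * \<tau>)"
        by (rule sum_norm_le) (simp add: a_close mult_left_mono)
      also have "\<dots> = \<tau> * S0"
        unfolding S0_def sum_distrib_right[symmetric] by (rule mult.commute)
      finally have n1: "norm (\<Sum>i\<in>?I. C0 i *\<^sub>R (?a i - ?b i)) \<le> \<tau> * S0" .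
      have "norm (w - l *\<^sub>R p) \<le> norm w + norm (l *\<^sub>R p)"
        by (rule norm_triangle_ineq4)
      also have "\<dots> \<le> l + l * B"
        using w1(2) B(2)[OF pC] l(1) by (intro add_mono) simp_all
      also have "\<dots> = l * (1 + B)"
        by (simp add: distrib_left)
      finally have n2: "norm (w - l *\<^sub>R p) \<le> l * (1 + B)" .
      have "norm (\<Sum>i\<in>?I. (?C1 i - C0 i) *\<^sub>R ?a i) \<le> l * (1 + B) + \<tau> * S0"
        unfolding diff by (rule order_trans[OF norm_triangle_ineq4 add_mono[OF n2 n1]])
      then have "K * norm (\<Sum>i\<in>?I. (?C1 i - C0 i) *\<^sub>R ?a i) \<le> K * (l * (1 + B)) + K * (\<tau> * S0)"
        using K by (simp flip: distrib_left)
      moreover have "K * (l * (1 + B)) \<le> \<epsilon> / 2"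
      proof -
        have "l * (2 * K * (1 + B)) \<le> \<epsilon>"
          using l(3) K B(1) by (subst (asm) pos_le_divide_eq) simp_all
        then show ?thesis
          by (simp add: mult_ac)
      qed
      ultimately have sum_le: "(\<Sum>i\<in>?I. \<bar>?C1 i - C0 i\<bar>) \<le> \<epsilon>"
        using xbound[of "\<lambda>i. ?C1 i - C0 i"] \<tau>S0 by linarith
      have coeff: "\<bar>?C1 i - C0 i\<bar> \<le> \<epsilon>" if "i \<in> ?I" for i
        using sum_le member_le_sum[OF that, of "\<lambda>i. \<bar>?C1 i - C0 i\<bar>"] by simp
      have c_close: "\<bar>c i - c0 i\<bar> \<le> \<epsilon>" if "i \<in> {1..n}" for i
        using coeff[OF InlI[OF that]] by (simp add: C0_def)
      have d_close: "\<bar>d j - d0 j\<bar> \<le> \<epsilon>" if "j \<in> {1..m}" for j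
        using coeff[OF InrI[OF that]] by (simp add: C0_def)
      have x_close: "dist (x i) (x0 i) \<le> \<epsilon>" if "i \<in> {1..n}" for i
        using x[OF that] r(2) by simp
      have c_nz: "c i \<noteq> 0" if "i \<in> {1..n}" for i
        using c_close[OF that] sm(1) that by fastforce
      have uniq: "c' = restrict c {1..n} \<and> x' = restrict x {1..n} \<and> d' = restrict d {1..m}"
        if ext: "c' \<in> extensional {1..n}" "x' \<in> extensional {1..n}" "d' \<in> extensional {1..m}"
          and rep: "sparse_measure n m \<sigma>0 \<zeta>0 c x d = sparse_measure n m \<sigma>0 \<zeta>0 c' x' d'"
          and x': "\<And>i. i \<in> {1..n} \<Longrightarrow> dist (x' i) (x0 i) \<le> \<epsilon>" for c' x' d'
      proof -
        \<comment> \<open>The radius for uniqueness is \<epsilon> rather than r, because competing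
          positions are only required to lie within \<epsilon>.\<close>
        note U = sparse_measure_unique[OF rep \<sigma>0 sep x_close x' c_nz \<zeta>_ind]
        have "c' = restrict c {1..n}"
          by (rule extensionalityI[OF ext(1) restrict_extensional]) (use U(1) in simp)
        moreover have "x' = restrict x {1..n}"
          by (rule extensionalityI[OF ext(2) restrict_extensional]) (use U(1) in simp)
        moreover have "d' = restrict d {1..m}"
          by (rule extensionalityI[OF ext(3) restrict_extensional]) (use U(2) in simp)
        ultimately show ?thesis
          by simp
      qed
      show "\<exists>u. (\<forall>v. is_arg_min (objective \<phi> l (y + w)) (\<lambda>_. True) v \<longleftrightarrow> v = u) \<and>
        (\<exists>!(c, x, d).
          c \<in> extensional {1..n} \<and> x \<in> extensional {1..n} \<and> d \<in> extensional {1..m} \<and>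
          u = sparse_measure n m \<sigma>0 \<zeta>0 c x d \<and>
          (\<forall>i\<in>{1..n}. dist (x i) (x0 i) \<le> \<epsilon> \<and> \<bar>c i - c0 i\<bar> \<le> \<epsilon>) \<and>
          (\<forall>j\<in>{1..m}. \<bar>d j - d0 j\<bar> \<le> \<epsilon>))"
      proof (intro exI conjI allI)
        show "is_arg_min (objective \<phi> l (y + w)) (\<lambda>_. True) v \<longleftrightarrow> v = sparse_measure n m \<sigma>0 \<zeta>0 c x d" for v
          by (rule sol)
        show "\<exists>!(c', x', d').
          c' \<in> extensional {1..n} \<and> x' \<in> extensional {1..n} \<and> d' \<in> extensional {1..m} \<and>
          sparse_measure n m \<sigma>0 \<zeta>0 c x d = sparse_measure n m \<sigma>0 \<zeta>0 c' x' d' \<and>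
          (\<forall>i\<in>{1..n}. dist (x' i) (x0 i) \<le> \<epsilon> \<and> \<bar>c' i - c0 i\<bar> \<le> \<epsilon>) \<and>
          (\<forall>j\<in>{1..m}. \<bar>d' j - d0 j\<bar> \<le> \<epsilon>)"
        proof (rule ex1_tripleI)
          let ?c = "restrict c {1..n}" and ?x = "restrict x {1..n}" and ?d = "restrict d {1..m}"
          show "?c \<in> extensional {1..n} \<and> ?x \<in> extensional {1..n} \<and> ?d \<in> extensional {1..m} \<and>
            sparse_measure n m \<sigma>0 \<zeta>0 c x d = sparse_measure n m \<sigma>0 \<zeta>0 ?c ?x ?d \<and>
            (\<forall>i\<in>{1..n}. dist (?x i) (x0 i) \<le> \<epsilon> \<and> \<bar>?c i - c0 i\<bar> \<le> \<epsilon>) \<and>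
            (\<forall>j\<in>{1..m}. \<bar>?d j - d0 j\<bar> \<le> \<epsilon>)"
            unfolding sparse_measure_restrict
            by (intro conjI ballI restrict_extensional refl) (simp_all only: restrict_apply' c_close d_close x_close)
        qed (elim conjE, rule uniq, simp_all)
      qed
    qed
  qed
  show ?thesis
    using e1 main by (intro exI[of _ "e1 / 2"] conjI allI impI main) simp_all
qed

end
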